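(* Let $j,k$ be coprime natural numbers, $k\ge2$, and let $f(z)$ and $g(-z)$ be (complex) entire functions of genus $0$ having only negative zeros, at least one of them non-constant. Put $$H_1(z)=f(z^k)+z^jg(z^k),\quad H_2(z)=g(z^k)+z^jf(z^k),\quad \alpha=-\frac{g(0)}{f(0)},\quad F_i(z)=z^{p}\,\frac{f(z^k)/f(0)}{g(z^k)/g(0)}\ \text{ with } p=(-1)^ij\quad(i=1,2).$$ Then for $i=1,2$ the zero set of $H_i$ coincides with the $\alpha$-set of $F_i$, with the same multiplicities, and the zeros of $H_i$ are located as follows (with $p=(-1)^ij$). Let $\cdots<\xi_n<\xi_{n+1}<\cdots$ be the absolute values of the zeros of $H_i$ and let $z_n$ denote any zero with $|z_n|=\xi_n$. Choose $q\in\{0,\dots,k-1\}$, $\varkappa\in\{0,1\}$ with $\alpha\in\widetilde Q_{2q-\varkappa}$. (A) If $\Im\alpha^k\neq0$, then all zeros are simple, have pairwise distinct absolute values and satisfy $\Im z_n^k\ne0$; if $z_n\in Q_{2m-\sigma}$ with $m\in\mathbb{Z}$, $\sigma\in\{0,1\}$, and $z_{n+1}$ exists, then $z_{n+1}\in Q_{2l-1+\sigma}$ with $p(l+m)\equiv2q+1-\varkappa-\sigma\pmod k$. (B) If $\Im\alpha^k=0$, let $s$ be an integer with $\Im(\alpha e_{ps})=0$, put $z_n^*=\overline z_ne_{-2s}$, and for $m\in\mathbb{Z}$ let $l$ satisfy $p(m-l)\equiv1\pmod k$. Then the zeros of absolute value $\xi_n$ are exactly $z_n,z_n^*$. If $z_n\in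 Q_{2m}\cup Q_{-2s-2m-1}$, then $z_n\neq z_n^*$ are simple and $z_{n+1}\in\overline Q_{2l}\cup\overline Q_{-2s-2l-1}$ (if $\xi_{n+1}$ exists). If $z_n=z_n^*$ and $\arg z_n=\arg z_{n+1}$, then $z_n,z_{n+1}$ are simple, $\arg z_{n-1}\ne\arg z_n$ and $\arg z_{n+2}\neq\arg z_{n+1}$ (whenever these zeros exist). If $z_n=z_n^*$ and $\arg z_n\ne\arg z_{n+1}$, then $z_n$ is simple or double (corresponding, if $\xi_{n-1}$ exists, to $\arg z_n=\arg z_{n-1}$ or $\arg z_n\ne\arg z_{n-1}$ respectively), and $z_n\in\overline Q_{2m}\cap\overline Q_{-2s-2m-1}$ implies $z_{n+1}\in\overline Q_{2l}\cup\overline Q_{-2s-2l-1}$. If $z_n=z_n^*$ and $\xi_{n+1}$ does not exist, then $z_n$ has multiplicity at most $2$. (C) Case $i=2$ ($p=j>0$), zeros closest to the origin (when $H_2$ has zeros). Let $pm\equiv q\pmod k$. If $\alpha^k$ is not negative, the zero $z_*$ closest to the origin is simple and distinct in argument and absolute value from the succeeding zeros; $\alpha\in Q_{2q-\varkappa}$ implies $z_*\in Q_{2m-\varkappa}$; $\alpha e_{-2q}>0$ implies $z_*e_{-2m}>0$. If $\alpha^k<0$, the two zeros closest to the origin (counting double zeros as two) either have equal arguments (including the case of a double zero), which is possible only for $p=1$ and then both lie on $\{ze_{-2m+1}>0\}$, or are distinct and of equal absolute value, and then one lies in $Q_{2m-1}$ and the other in $Q_{2\widetilde m}=Q_{-2m-2s}$,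 where $p\widetilde m\equiv q-1\pmod k$ and $\Im(\alpha e_{ps})=0$. (D) Case $i=1$ ($p=-j<0$), zeros closest to the origin (when $H_1$ has zeros). If $\alpha\in Q_{2q-\varkappa}$, the zero $z_0$ closest to the origin is simple, distinct in argument and absolute value from the succeeding zero, and $z_0\in Q_{2m-\sigma}$, where $\sigma=\varkappa$ for even $p$, $\sigma=1-\varkappa$ for odd $p$, and $pm\equiv q-(-1)^\sigma\lceil\frac p2\rceil\pmod k$. If $\alpha e_{-2q+\varkappa}>0$ with $p,\varkappa$ of the same parity, the zero $z_0$ closest to the origin is simple, distinct in argument and absolute value from the succeeding zero, and $z_0e_{-2m+1}>0$ with $pm\equiv q+\lceil\frac{p-1}2\rceil\pmod k$. If $\alpha e_{-2q+\varkappa}>0$ with $p,\varkappa$ of distinct parity, let $pm\equiv q-\lceil\frac{p+1}2\rceil\pmod k$; then the two zeros closest to the origin (counting double zeros as two) either have equal arguments (including the case of a double zero), which is possible only for $p=-1$ and then both lie on $\{ze_{-2m}>0\}$, or are distinct and of equal absolute value, and then one lies in $Q_{2m}$ and the other in $Q_{-2s-2m-1}$, where $\Im(\alpha e_{ps})=0$.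
   Context: $e_m:=\exp\left(i\frac{m}{k}\pi\right)$ (here $i$ is the imaginary unit); for $s\in\mathbb{Z}$, $Q_s:=\{z\ne0:0<\operatorname{Arg}(ze_{-s})<\frac{\pi}{k}\}$, $\widetilde Q_s:=\{z\ne0:0\le\operatorname{Arg}(ze_{-s})<\frac{\pi}{k}\}$ ($\operatorname{Arg}$ the principal argument), $\overline Q_s$ is the closure; indices are modulo $2k$. The $\alpha$-set of $F$ is $\{z:F(z)=\alpha\}$, the multiplicity of an $\alpha$-point being the order of the zero of $F-\alpha$. A genus $0$ entire function with only negative zeros is $c\prod_\nu(1+z/a_\nu)$ with $c\ne0$, $a_\nu>0$, $\sum1/a_\nu<\infty$ (finite, infinite or empty product). "Succeeding zeros" are those with the next smallest absolute value. Equality of arguments is modulo $2\pi$; "$x>0$" for a complex expression means real and positive. *)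

theory Defs
  imports "HOL-Complex_Analysis.Complex_Analysis" "HOL-Number_Theory.Cong"
begin

(* The index set N may be empty, finite or infinite; a factor with \<nu> \<notin> N is 1. *)
definition genus0_neg :: "(complex \<Rightarrow> complex) \<Rightarrow> bool" where
  "genus0_neg f \<longleftrightarrow> (\<exists>(c::complex) (N::nat set) (a::nat \<Rightarrow> real).
     c \<noteq> 0 \<and> (\<forall>\<nu>\<in>N. 0 < a \<nu>) \<and> (\<lambda>\<nu>. 1 / a \<nu>) summable_on N \<and>
     (\<forall>z. f z = c * (\<Prod>\<nu>. if \<nu> \<in> N then 1 + z / of_real (a \<nu>) else 1)))"

definition eunit :: "nat \<Rightarrow> int \<Rightarrow> complex" where
  "eunit k m = exp (\<i> * (of_int m / of_nat k) * of_real pi)"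

definition Q :: "nat \<Rightarrow> int \<Rightarrow> complex set" where
  "Q k s = {z. z \<noteq> 0 \<and> 0 < Arg (z * eunit k (- s)) \<and> Arg (z * eunit k (- s)) < pi / real k}"

definition Qtilde :: "nat \<Rightarrow> int \<Rightarrow> complex set" where
  "Qtilde k s = {z. z \<noteq> 0 \<and> 0 \<le> Arg (z * eunit k (- s)) \<and> Arg (z * eunit k (- s)) < pi / real k}"

abbreviation Qbar :: "nat \<Rightarrow> int \<Rightarrow> complex set" where
  "Qbar k s \<equiv> closure (Q k s)"

definition pos_real :: "complex \<Rightarrow> bool" where
  "pos_real z \<longleftrightarrow> Im z = 0 \<and> 0 < Re z"

definition neg_real :: "complex \<Rightarrow> bool" where
  "neg_real z \<longleftrightarrow> Im z = 0 \<and> Re z < 0"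

(* z = z_n and w = z_(n+1): w is a zero whose absolute value is the next one after that of z. *)
definition next_zero :: "(complex \<Rightarrow> complex) \<Rightarrow> complex \<Rightarrow> complex \<Rightarrow> bool" where
  "next_zero H z w \<longleftrightarrow> H z = 0 \<and> H w = 0 \<and> cmod z < cmod w \<and>
     \<not> (\<exists>v. H v = 0 \<and> cmod z < cmod v \<and> cmod v < cmod w)"

definition simple_separate_first_zero :: "(complex \<Rightarrow> complex) \<Rightarrow> complex \<Rightarrow> bool" where
  "simple_separate_first_zero H z \<longleftrightarrow> H z = 0 \<and> zorder H z = 1 \<and>
     (\<forall>w. H w = 0 \<and> w \<noteq> z \<longrightarrow> cmod z < cmod w) \<and>
     (\<forall>w. next_zero H z w \<longrightarrow> Arg w \<noteq> Arg z)"

(* a, b can be taken as the first two entries when the zeros are listed with multiplicity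
   by non-decreasing absolute value; a = b means a multiple zero. *)
definition first_two_zeros :: "(complex \<Rightarrow> complex) \<Rightarrow> complex \<Rightarrow> complex \<Rightarrow> bool" where
  "first_two_zeros H a b \<longleftrightarrow> H a = 0 \<and> H b = 0 \<and> (\<forall>z. H z = 0 \<longrightarrow> cmod a \<le> cmod z) \<and>
     (if a = b then 2 \<le> zorder H a
      else (cmod a < cmod b \<longrightarrow> zorder H a = 1) \<and>
           (\<forall>z. H z = 0 \<and> z \<noteq> a \<longrightarrow> cmod b \<le> cmod z))"

end

theory Submission
  imports Defs
begin

text \<open>
  Write \<open>F (exp u) = exp (\<psi> u)\<close> on the strip \<open>0 \<le> Im u \<le> \<pi>/k\<close>. Up to the linear term \<open>p u\<close>, the function
  \<open>\<psi>\<close> is a sum of terms \<open>Ln (1 + x exp (k u))\<close> and of their reflections, and each of these has a derivative with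
  positive imaginary part inside the strip. Hence \<open>Im ((\<psi> u - \<psi> v) * cnj (u - v)) \<ge> 0\<close>, strictly unless \<open>u\<close>
  and \<open>v\<close> lie on the same boundary line. Consequently every vertical segment of the strip contains at most one
  point with \<open>\<bar>F\<bar> = \<bar>\<alpha>\<bar>\<close>; these points lie on a curve over the real axis along which the argument of \<open>F\<close>
  is nondecreasing, and it is constant only along a boundary line.

  All zeros arise from curve points and their conjugates by the rotations \<open>e\<^sub>2\<^sub>m\<close>. With arguments measured in
  units of \<open>\<pi>/k\<close> and \<open>t\<^sub>0\<close> the argument of \<open>\<alpha>\<close>, the radii of the zeros are those at which the argument along the
  curve is in \<open>t\<^sub>0 + 2\<int>\<close> or in \<open>- t\<^sub>0 + 2\<int>\<close>, and, \<open>p\<close> being prime to \<open>k\<close>, the level determines \<open>m\<close>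
  modulo \<open>k\<close>. Consecutive zeros belong to consecutive levels. Multiplicities come from the leading
  term \<open>c h\<^sup>N\<close> of \<open>\<psi> (u + h) - \<psi> u\<close>: the inequality above forces \<open>N = 1\<close> inside the strip and
  \<open>N \<le> 2\<close> on its boundary, where \<open>N = 2\<close> means that the curve touches the boundary from inside.
\<close>

subsection \<open>Canonical products on the upper half plane\<close>

text \<open>The zeros of \<open>g\<close> lie on the positive axis. The logarithm of the denominator
  is therefore taken at the reflected point \<open>refl u\<close>, where its factors fall into the
  same half plane as those of the numerator; the conjugation and the minus sign in
  \<open>psi\<close> together restore the sign of the monotonicity. The obstacle is that a vertical
  segment may contain no point with modulus exactly |\<alpha>|. There the curve is continued along
  the bottom edge if |F| is too small on it, along the top edge if |F| is too large on it. On such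
  stretches the argument lies in a discrete set, so it can change only at radii where the modulus is
  right; this is why every level that is crossed is attained at a genuine zero. An edge also fixes
  the argument modulo k: it is a multiple of k below, and p plus a multiple of k above. Comparison
  with the levels decides whether a boundary ray can carry a zero, and singles out p = 1 and p = -1
  in (C) and (D). Near the origin F behaves like z^p, so the curve starts with argument 0 on the
  bottom edge for p > 0 and with argument p on the top edge for p < 0; the ceilings in (D) locate
  the first level from p upwards.\<close>

definition gprod :: "(nat \<Rightarrow> real) \<Rightarrow> complex \<Rightarrow> complex" where
  "gprod x z = (\<Prod>n. 1 + z * of_real (x n))"

text \<open>With its cut along the negative imaginary axis, this branch is holomorphic across the boundary
  of the upper half plane.\<close>

definition lg :: "complex \<Rightarrow> complex" where
  "lg z = Ln (- \<i> * z) + \<i> * of_real (pi / 2)"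

lemma exp_lg: "z \<noteq> 0 \<Longrightarrow> exp (lg z) = z"
proof -
  assume "z \<noteq> 0"
  have "exp (\<i> * of_real (pi / 2)) = \<i>"
    using cis_conv_exp[of "pi / 2"] by simp
  then have "exp (lg z) = - \<i> * z * \<i>" using \<open>z \<noteq> 0\<close> by (simp add: lg_def exp_add)
  then show ?thesis by (simp add: complex_eq_iff)
qed

text \<open>Multiplication by -i turns the closed upper half plane into the closed right half plane,
  which meets the cut of \<open>Ln\<close> only in 0.\<close>

lemma lg_nonpos: "0 \<le> Im z \<Longrightarrow> z \<noteq> 0 \<Longrightarrow> - (\<i> * z) \<notin> \<real>\<^sub>\<le>\<^sub>0"
  by (auto simp: complex_nonpos_Reals_iff complex_eq_iff)

lemma lg_has_field_derivative:
  "0 \<le> Im z \<Longrightarrow> z \<noteq> 0 \<Longrightarrow> (lg has_field_derivative inverse z) (at z within S)"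
  unfolding lg_def using lg_nonpos[of z]
  by (auto intro!: derivative_eq_intros simp: field_simps)

text \<open>The far factors of a product are close to 1; there this makes the bounds for
  \<open>Ln\<close> available for \<open>lg\<close>.\<close>

lemma lg_eq_Ln: "Re z > 0 \<Longrightarrow> lg z = Ln z"
proof -
  assume a: "Re z > 0"
  then have z0: "z \<noteq> 0" by auto
  have "\<bar>Im (Ln z)\<bar> < pi / 2" using Re_Ln_pos_lt[OF z0] a by simp
  then have "Ln (- \<i> * z) = Ln (- \<i>) + Ln z"
    by (intro Ln_times_simple) (use z0 in auto)
  then show ?thesis by (simp add: lg_def)
qed

lemma lg_pos_real: "r > 0 \<Longrightarrow> lg (of_real r) = of_real (ln r)"
  by (subst lg_eq_Ln) (auto simp: Ln_of_real)

lemma lg_neg_real: "r < 0 \<Longrightarrow> lg (of_real r) = of_real (ln (- r)) + \<i> * pi"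
proof -
  assume a: "r < 0"
  have e: "- \<i> * complex_of_real r = of_real (- r) * \<i>" by simp
  have "Ln (- \<i> * complex_of_real r) = of_real (ln (-r)) + Ln \<i>"
    unfolding e by (subst Ln_times_of_real) (use a Ln_of_real[of "- r"] in auto)
  then show ?thesis by (simp add: lg_def)
qed

section \<open>One factor of the product in the logarithmic coordinate\<close>

definition softplus :: "real \<Rightarrow> complex \<Rightarrow> complex" where
  "softplus a v = lg (1 + of_real a * exp v)"

lemma Im_one_plus_exp: "0 \<le> a \<Longrightarrow> 0 \<le> Im v \<Longrightarrow> Im v \<le> pi \<Longrightarrow> 0 \<le> Im (1 + of_real a * exp v)"
  by (simp add: Im_exp sin_ge_zero)

lemma sp_has_field_derivative:
  assumes "0 \<le> a" "0 \<le> Im v" "Im v \<le> pi" "1 + of_real a * exp v \<noteq> 0"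
  shows "(softplus a has_field_derivative (of_real a * exp v / (1 + of_real a * exp v))) (at v within S)"
proof -
  have "((\<lambda>v. lg (1 + of_real a * exp v)) has_field_derivative
      inverse (1 + of_real a * exp v) * (of_real a * exp v)) (at v within S)"
    by (rule DERIV_chain2[where f = lg and g = "\<lambda>v. 1 + of_real a * exp v"])
       (use assms in \<open>auto intro!: derivative_eq_intros lg_has_field_derivative Im_one_plus_exp\<close>)
  then show ?thesis unfolding softplus_def[abs_def] by (simp add: field_simps)
qed

lemma one_plus_exp_nz:
  assumes "0 \<le> a" "0 < Im v" "Im v < pi"
  shows "1 + of_real a * exp v \<noteq> 0"
proof
  assume *: "1 + of_real a * exp v = 0"
  then have "Im (1 + of_real a * exp v) = 0" by simp
  then have "a = 0" using sin_gt_zero[of "Im v"] assms by (simp add: Im_exp)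
  then show False using * by simp
qed

text \<open>The derivative is 1 - 1 / (1 + a exp v): inversion sends the upper half plane to the
  lower one, and the minus sign brings it back.\<close>

lemma Im_sp_deriv_pos:
  assumes "0 < a" "0 < Im v" "Im v < pi"
  shows "0 < Im (of_real a * exp v / (1 + of_real a * exp v))"
proof -
  have nz: "1 + of_real a * exp v \<noteq> 0" using assms one_plus_exp_nz by simp
  have s: "sin (Im v) > 0" using assms sin_gt_zero by blast
  have "of_real a * exp v / (1 + of_real a * exp v) = 1 - 1 / (1 + of_real a * exp v)"
    using nz by (simp add: field_simps)
  also have "Im \<dots> = Im (1 + of_real a * exp v) / (cmod (1 + of_real a * exp v))\<^sup>2"
    by (simp add: Im_divide cmod_power2)
  also have "\<dots> > 0"
    using nz assms s by (intro divide_pos_pos) (auto simp: Im_exp)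
  finally show ?thesis .
qed

lemma Im_sp_0: "0 \<le> a \<Longrightarrow> Im v = 0 \<Longrightarrow> Im (softplus a v) = 0"
proof -
  assume a: "0 \<le> a" "Im v = 0"
  have e: "1 + of_real a * exp v = of_real (1 + a * exp (Re v))"
    using a by (simp add: complex_eq_iff Re_exp Im_exp)
  have "1 + a * exp (Re v) > 0" using a by (simp add: add_pos_nonneg)
  then show ?thesis unfolding softplus_def e by (subst lg_pos_real) auto
qed

text \<open>On the top edge the factor is real and becomes negative once a exp (Re v) exceeds 1;
  \<open>lg\<close> then contributes a full pi. This jump is what later counts zeros and
  poles.\<close>

lemma Im_sp_pi:
  assumes "0 \<le> a" "Im v = pi" "1 + of_real a * exp v \<noteq> 0"
  shows "Im (softplus a v) = (if 1 < a * exp (Re v) then pi else 0)"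
proof -
  have e: "1 + of_real a * exp v = of_real (1 - a * exp (Re v))"
    using assms by (simp add: complex_eq_iff Re_exp Im_exp)
  have "1 - a * exp (Re v) \<noteq> 0" using assms(3) unfolding e by (metis of_real_0)
  moreover have "Im (lg (of_real (1 - a * exp (Re v)))) = 0" if "1 - a * exp (Re v) > 0"
    by (subst lg_pos_real[OF that]) simp
  moreover have "Im (lg (of_real (1 - a * exp (Re v)))) = pi" if "1 - a * exp (Re v) < 0"
    by (subst lg_neg_real[OF that]) simp
  ultimately show ?thesis unfolding softplus_def e by auto
qed

text \<open>Along the segment between two points of the strip the derivative of the real function
  below is \<open>|v - u|\<^sup>2\<close> times the imaginary part of the derivative of \<open>softplus a\<close>.\<close>

lemma Im_sp_diff_pos:
  assumes a: "0 < a" and u: "0 \<le> Im u" "Im u \<le> pi" "1 + of_real a * exp u \<noteq> 0"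
    and v: "0 \<le> Im v" "Im v \<le> pi" "1 + of_real a * exp v \<noteq> 0"
    and ne: "u \<noteq> v" "\<not> (Im u = Im v \<and> Im v \<in> {0, pi})"
  shows "0 < Im ((softplus a v - softplus a u) * cnj (v - u))"
proof -
  define \<gamma> where "\<gamma> = (\<lambda>\<tau>::real. u + of_real \<tau> * (v - u))"
  define h where "h = (\<lambda>\<tau>. Im (softplus a (\<gamma> \<tau>) * cnj (v - u)))"
  have Img: "Im (\<gamma> \<tau>) = (1 - \<tau>) * Im u + \<tau> * Im v" for \<tau>
    by (simp add: \<gamma>_def algebra_simps)
  \<comment> \<open>Only segments contained in an edge are excluded by the hypotheses; the relative
    interior of every other segment lies in the open strip, where the derivative is under
    control.\<close>
  have inner: "0 < Im (\<gamma> \<tau>) \<and> Im (\<gamma> \<tau>) < pi" if "0 < \<tau>" "\<tau> < 1" for \<tau>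
  proof
    show "0 < Im (\<gamma> \<tau>)"
    proof (cases "Im u = 0")
      case True
      then have "Im v > 0" using ne v(1) by force
      then show ?thesis unfolding Img using that True by simp
    next
      case False
      then have "(1 - \<tau>) * Im u > 0" using that u by simp
      moreover have "\<tau> * Im v \<ge> 0" using that v by simp
      ultimately show ?thesis unfolding Img by linarith
    qed
    have "(1 - \<tau>) * (pi - Im u) + \<tau> * (pi - Im v) > 0"
    proof (cases "Im u = pi")
      case True
      then have "Im v < pi" using ne v(2) by force
      then show ?thesis using that True by simp
    next
      case False
      then have "(1 - \<tau>) * (pi - Im u) > 0" using that u by simp
      moreover have "\<tau> * (pi - Im v) \<ge> 0" using that v by simp
      ultimately show ?thesis by linarith
    qed
    then show "Im (\<gamma> \<tau>) < pi" unfolding Img by (simp add: algebra_simps)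
  qed
  have strip: "0 \<le> Im (\<gamma> \<tau>) \<and> Im (\<gamma> \<tau>) \<le> pi \<and> 1 + of_real a * exp (\<gamma> \<tau>) \<noteq> 0"
    if "0 \<le> \<tau>" "\<tau> \<le> 1" for \<tau>
  proof -
    consider "\<tau> = 0" | "\<tau> = 1" | "0 < \<tau>" "\<tau> < 1" using \<open>0 \<le> \<tau>\<close> \<open>\<tau> \<le> 1\<close> by linarith
    then show ?thesis
    proof cases
      case 1
      then have "\<gamma> \<tau> = u" by (simp add: \<gamma>_def)
      then show ?thesis using u by simp
    next
      case 2
      then have "\<gamma> \<tau> = v" by (simp add: \<gamma>_def)
      then show ?thesis using v by simp
    next
      case 3
      then show ?thesis using inner one_plus_exp_nz[of a "\<gamma> \<tau>"] a by force
    qed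
  qed
  have der: "((\<lambda>\<tau>. softplus a (\<gamma> \<tau>) * cnj (v - u)) has_vector_derivative
      (v - u) * (of_real a * exp (\<gamma> \<tau>) / (1 + of_real a * exp (\<gamma> \<tau>))) * cnj (v - u)) (at \<tau> within S)"
    if "0 \<le> \<tau>" "\<tau> \<le> 1" for \<tau> S
  proof -
    have 1: "(\<gamma> has_vector_derivative (v - u)) (at \<tau> within S)"
      unfolding \<gamma>_def by (auto intro!: derivative_eq_intros simp: has_vector_derivative_def scaleR_conv_of_real)
    have 2: "(softplus a has_field_derivative (of_real a * exp (\<gamma> \<tau>) / (1 + of_real a * exp (\<gamma> \<tau>))))
       (at (\<gamma> \<tau>) within \<gamma> ` S)"
      by (rule sp_has_field_derivative) (use a strip[OF that] in auto)
    show ?thesis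
      using field_vector_diff_chain_within[OF 1 2] by (auto intro!: derivative_eq_intros simp: o_def)
  qed
  have hder: "(h has_real_derivative
      Im ((v - u) * (of_real a * exp (\<gamma> \<tau>) / (1 + of_real a * exp (\<gamma> \<tau>))) * cnj (v - u))) (at \<tau> within S)"
    if "0 \<le> \<tau>" "\<tau> \<le> 1" for \<tau> S
    unfolding h_def has_real_derivative_iff_has_vector_derivative
    using bounded_linear.has_vector_derivative[OF bounded_linear_Im der[OF that]] by simp
  have "h 0 < h 1"
  proof (rule DERIV_pos_imp_increasing_open[where f = h and a = 0 and b = 1])
    fix \<tau> :: real assume t: "0 < \<tau>" "\<tau> < 1"
    define c where "c = of_real a * exp (\<gamma> \<tau>) / (1 + of_real a * exp (\<gamma> \<tau>))"
    have "(v - u) * c * cnj (v - u) = of_real ((cmod (v - u))\<^sup>2) * c"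
      unfolding complex_norm_square by (simp only: mult_ac)
    then have "Im ((v - u) * c * cnj (v - u)) = (cmod (v - u))\<^sup>2 * Im c"
      by (simp only: times_complex.sel Re_complex_of_real Im_complex_of_real)
    also have "\<dots> > 0"
      using Im_sp_deriv_pos[OF a] inner[OF t] ne(1) unfolding c_def by (intro mult_pos_pos) auto
    finally show "\<exists>y. (h has_real_derivative y) (at \<tau>) \<and> 0 < y"
      using hder[of \<tau> UNIV] t unfolding c_def by force
  next
    show "continuous_on {0..1} h"
      by (intro DERIV_continuous_on[OF hder]) auto
  qed simp
  then show ?thesis by (simp add: h_def \<gamma>_def algebra_simps)
qed

lemma Im_sp_diff_nonneg:
  assumes a: "0 \<le> a" and u: "0 \<le> Im u" "Im u \<le> pi" "1 + of_real a * exp u \<noteq> 0"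
    and v: "0 \<le> Im v" "Im v \<le> pi" "1 + of_real a * exp v \<noteq> 0"
  shows "0 \<le> Im ((softplus a v - softplus a u) * cnj (v - u))"
proof (cases "a = 0 \<or> u = v")
  case True
  then show ?thesis by (auto simp: softplus_def)
next
  case nt: False
  show ?thesis
  proof (cases "Im u = Im v \<and> Im v \<in> {0, pi}")
    case False
    then show ?thesis using Im_sp_diff_pos[of a u v] nt assms by simp
  next
    case True
    \<comment> \<open>On a common edge only the increments of Im \<open>softplus\<close> and of Re
      remain. Im \<open>softplus\<close> is 0 below and a nondecreasing step function of Re
      above.\<close>
    then have e: "Im ((softplus a v - softplus a u) * cnj (v - u)) = (Im (softplus a v) - Im (softplus a u)) * (Re v - Re u)"
      by simp
    show ?thesis
    proof (cases "Im v = 0")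
      case t0: True
      then have "Im (softplus a v) = 0" "Im (softplus a u) = 0" using True a Im_sp_0 by auto
      then show ?thesis unfolding e by simp
    next
      case False
      then have ip: "Im v = pi" "Im u = pi" using True by auto
      show ?thesis
        unfolding e Im_sp_pi[OF a ip(1) v(3)] Im_sp_pi[OF a ip(2) u(3)]
        using a mult_left_mono[of "exp (Re u)" "exp (Re v)" a]
          mult_left_mono[of "exp (Re v)" "exp (Re u)" a]
        by (cases "Re u \<le> Re v") (auto simp: mult_nonneg_nonneg mult_nonneg_nonpos)
    qed
  qed
qed


section \<open>The logarithm of a canonical product on the closed strip\<close>

definition regular :: "(nat \<Rightarrow> real) \<Rightarrow> complex \<Rightarrow> bool" where
  "regular x v \<longleftrightarrow> 0 \<le> Im v \<and> Im v \<le> pi \<and> (\<forall>n. 1 + of_real (x n) * exp v \<noteq> 0)"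

definition log_gprod :: "(nat \<Rightarrow> real) \<Rightarrow> complex \<Rightarrow> complex" where
  "log_gprod x v = (\<Sum>n. softplus (x n) v)"

text \<open>The weights are the reciprocals 1/a of the numbers in the product. Weight 0 stands for
  an absent factor, so empty and finite products need no separate treatment.\<close>

locale summable_weights =
  fixes x :: "nat \<Rightarrow> real"
  assumes nonneg: "0 \<le> x n" and summable: "summable x"
begin

lemma convergent: "convergent_prod (\<lambda>n. 1 + z * complex_of_real (x n))"
proof -
  have "summable (\<lambda>n. norm (z * of_real (x n)))"
    using summable_mult[OF summable, of "norm z"] nonneg by (simp add: norm_mult)
  then show ?thesis
    by (intro abs_convergent_prod_imp_convergent_prod) (simp add: abs_convergent_prod_conv_summable)
qed

lemma gprod_eq_0_iff: "gprod x z = 0 \<longleftrightarrow> (\<exists>n. 1 + z * of_real (x n) = 0)"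
  unfolding gprod_def
  using has_prod_eq_0_iff[OF convergent_prod_has_prod[OF convergent[of z]]] by auto

lemma gprod_0 [simp]: "gprod x 0 = 1"
  by (simp add: gprod_def)

lemma gprod_LIMSEQ: "(\<lambda>n. \<Prod>i<n. 1 + z * of_real (x i)) \<longlonglongrightarrow> gprod x z"
proof -
  have "(\<lambda>n. \<Prod>i\<le>n. 1 + z * of_real (x i)) \<longlonglongrightarrow> gprod x z"
    using convergent_prod_LIMSEQ[OF convergent[of z]] unfolding gprod_def by simp
  then show ?thesis by (simp add: LIMSEQ_lessThan_iff_atMost)
qed

lemma gprod_cnj: "gprod x (cnj z) = cnj (gprod x z)"
proof -
  have "(\<lambda>n. cnj (\<Prod>i<n. 1 + z * of_real (x i))) \<longlonglongrightarrow> cnj (gprod x z)"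
    by (intro tendsto_cnj gprod_LIMSEQ)
  then show ?thesis
    by (intro LIMSEQ_unique[OF gprod_LIMSEQ]) simp
qed

lemma gprod_uniform_limit:
  "uniform_limit (cball 0 R) (\<lambda>N z. \<Prod>n<N. 1 + z * of_real (x n)) (gprod x) sequentially"
proof -
  have "uniformly_convergent_on (cball 0 R) (\<lambda>N z. \<Prod>n<N. 1 + z * complex_of_real (x n))"
  proof (rule uniformly_convergent_on_prod')
    show "uniformly_convergent_on (cball 0 R) (\<lambda>N z. \<Sum>n<N. norm (1 + z * complex_of_real (x n) - 1))"
    proof (rule Weierstrass_m_test'_ev)
      show "\<forall>\<^sub>F n in sequentially. \<forall>z\<in>cball 0 R.
          norm (norm (1 + z * complex_of_real (x n) - 1)) \<le> R * x n"
        using nonneg by (auto simp: norm_mult intro!: always_eventually mult_right_mono)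
      show "summable (\<lambda>n. R * x n)" by (intro summable_mult summable)
    qed
  qed (auto intro!: continuous_intros)
  then obtain g where g: "uniform_limit (cball 0 R) (\<lambda>N z. \<Prod>n<N. 1 + z * complex_of_real (x n)) g sequentially"
    by (auto simp: uniformly_convergent_on_def)
  have "g z = gprod x z" if "z \<in> cball 0 R" for z
    by (rule LIMSEQ_unique[OF tendsto_uniform_limitI[OF g that] gprod_LIMSEQ])
  then show ?thesis
    by (intro uniform_limit_cong'[THEN iffD1, OF _ _ g]) auto
qed

lemma gprod_holomorphic: "gprod x holomorphic_on A"
proof (rule holomorphic_on_subset)
  show "gprod x holomorphic_on UNIV"
  proof (rule holomorphic_uniform_sequence)
    fix z :: complex
    have "uniform_limit (cball z 1) (\<lambda>N z. \<Prod>n<N. 1 + z * of_real (x n)) (gprod x) sequentially"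
      by (rule uniform_limit_on_subset[OF gprod_uniform_limit[of "norm z + 1"]])
         (simp add: cball_subset_cball_iff)
    then show "\<exists>d>0. cball z d \<subseteq> UNIV \<and>
        uniform_limit (cball z d) (\<lambda>N z. \<Prod>n<N. 1 + z * of_real (x n)) (gprod x) sequentially"
      by (intro exI[of _ 1]) auto
  qed (auto intro!: holomorphic_intros)
qed auto

text \<open>Below 1/2 the factor 1 + c has positive real part, so \<open>lg\<close> is
  \<open>Ln\<close> there and |Ln (1 + c)| is at most 2 |c|. The weights thus dominate the series of
  logarithms.\<close>

lemma norm_sp_le:
  assumes "x n * exp (Re v) < 1 / 2"
  shows "norm (softplus (x n) v) \<le> 2 * (x n * exp (Re v))"
proof -
  define c where "c = of_real (x n) * exp v"
  have n: "norm c = x n * exp (Re v)" using nonneg by (simp add: c_def norm_mult)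
  have "\<bar>Re c\<bar> < 1 / 2" using abs_Re_le_cmod[of c] n assms by linarith
  then have "lg (1 + c) = Ln (1 + c)" by (intro lg_eq_Ln) auto
  then show ?thesis using norm_Ln_le[of c] n assms by (simp add: softplus_def c_def)
qed

lemma eventually_small: "\<forall>\<^sub>F n in sequentially. x n * r < 1 / 2"
proof -
  have "(\<lambda>n. x n * r) \<longlonglongrightarrow> 0 * r"
    by (intro tendsto_mult summable_LIMSEQ_zero[OF summable] tendsto_const)
  then show ?thesis by (rule order_tendstoD(2)) simp
qed

lemma summable_sp: "summable (\<lambda>n. softplus (x n) v)"
proof (rule summable_comparison_test_ev)
  show "\<forall>\<^sub>F n in sequentially. norm (softplus (x n) v) \<le> 2 * (x n * exp (Re v))"
    using eventually_small[of "exp (Re v)"] by eventually_elim (rule norm_sp_le)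
  show "summable (\<lambda>n. 2 * (x n * exp (Re v)))"
    by (intro summable_mult summable_mult2 summable)
qed

lemma exp_LL:
  assumes "regular x v"
  shows "exp (log_gprod x v) = gprod x (exp v)"
proof -
  have "(\<lambda>n. \<Sum>i<n. softplus (x i) v) \<longlonglongrightarrow> log_gprod x v"
    unfolding log_gprod_def by (rule summable_LIMSEQ[OF summable_sp])
  then have "(\<lambda>n. exp (\<Sum>i<n. softplus (x i) v)) \<longlonglongrightarrow> exp (log_gprod x v)" by (rule tendsto_exp)
  moreover have "exp (\<Sum>i<n. softplus (x i) v) = (\<Prod>i<n. 1 + exp v * of_real (x i))" for n
    using assms by (simp add: exp_sum softplus_def exp_lg regular_def mult.commute)
  ultimately have "(\<lambda>n. \<Prod>i<n. 1 + exp v * of_real (x i)) \<longlonglongrightarrow> exp (log_gprod x v)" by simp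
  then show ?thesis by (rule LIMSEQ_unique[OF _ gprod_LIMSEQ])
qed

lemma regular_iff: "regular x v \<longleftrightarrow> 0 \<le> Im v \<and> Im v \<le> pi \<and> gprod x (exp v) \<noteq> 0"
  by (simp add: regular_def gprod_eq_0_iff mult.commute)

text \<open>A factor vanishes only where exp v is a negative real number, that is, on the line Im v
  = pi.\<close>

lemma regular_inner: "0 \<le> Im v \<Longrightarrow> Im v < pi \<Longrightarrow> regular x v"
proof (cases "Im v = 0")
  case True
  then have "Re (1 + of_real (x n) * exp v) > 0" for n
    using nonneg[of n] by (simp add: Re_exp add_pos_nonneg)
  then have "1 + of_real (x n) * exp v \<noteq> 0" for n by (metis less_irrefl zero_complex.simps(1))
  then show ?thesis using True by (simp add: regular_def)
next
  case False
  assume "0 \<le> Im v" "Im v < pi"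
  then show ?thesis using False one_plus_exp_nz[OF nonneg] by (simp add: regular_def)
qed

lemma Im_LL_diff_sums:
  "(\<lambda>n. Im ((softplus (x n) v - softplus (x n) u) * cnj (v - u))) sums Im ((log_gprod x v - log_gprod x u) * cnj (v - u))"
proof -
  have "(\<lambda>n. (softplus (x n) v - softplus (x n) u) * cnj (v - u)) sums ((log_gprod x v - log_gprod x u) * cnj (v - u))"
    unfolding log_gprod_def by (intro sums_mult2 sums_diff summable_sums summable_sp)
  then show ?thesis by (simp only: sums_complex_iff)
qed

lemma Im_LL_diff_nonneg:
  assumes "regular x u" "regular x v"
  shows "0 \<le> Im ((log_gprod x v - log_gprod x u) * cnj (v - u))"
proof (rule sums_le[OF _ sums_zero Im_LL_diff_sums])
  fix n show "0 \<le> Im ((softplus (x n) v - softplus (x n) u) * cnj (v - u))"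
    using assms nonneg by (intro Im_sp_diff_nonneg) (auto simp: regular_def)
qed

lemma Im_LL_diff_pos:
  assumes "regular x u" "regular x v" "u \<noteq> v" "\<not> (Im u = Im v \<and> Im v \<in> {0, pi})" "x n \<noteq> 0"
  shows "0 < Im ((log_gprod x v - log_gprod x u) * cnj (v - u))"
proof -
  have "0 < (\<Sum>n. Im ((softplus (x n) v - softplus (x n) u) * cnj (v - u)))"
  proof (rule suminf_pos2[where i = n])
    show "summable (\<lambda>n. Im ((softplus (x n) v - softplus (x n) u) * cnj (v - u)))"
      using Im_LL_diff_sums sums_summable by blast
    show "0 \<le> Im ((softplus (x n) v - softplus (x n) u) * cnj (v - u))" for n
      using assms nonneg by (intro Im_sp_diff_nonneg) (auto simp: regular_def)
    show "0 < Im ((softplus (x n) v - softplus (x n) u) * cnj (v - u))"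
      using assms nonneg[of n] by (intro Im_sp_diff_pos) (auto simp: regular_def)
  qed
  then show ?thesis by (simp only: sums_unique[OF Im_LL_diff_sums])
qed

lemma Im_LL_sums: "(\<lambda>n. Im (softplus (x n) v)) sums Im (log_gprod x v)"
proof -
  have "(\<lambda>n. softplus (x n) v) sums log_gprod x v" unfolding log_gprod_def by (rule summable_sums[OF summable_sp])
  then show ?thesis by (simp only: sums_complex_iff)
qed

lemma Im_LL_0: "Im v = 0 \<Longrightarrow> Im (log_gprod x v) = 0"
  using Im_LL_sums[of v] Im_sp_0[OF nonneg] by (simp add: sums_iff)

text \<open>Each factor that has changed sign contributes pi, and as the weights tend to 0 only
  finitely many have done so.\<close>

lemma Im_LL_pi:
  assumes "Im v = pi" "regular x v"
  shows "Im (log_gprod x v) = pi * real (card {n. 1 < x n * exp (Re v)})" "finite {n. 1 < x n * exp (Re v)}"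
proof -
  let ?S = "{n. 1 < x n * exp (Re v)}"
  have "\<forall>\<^sub>F n in sequentially. n \<notin> ?S"
    using eventually_small[of "exp (Re v)"] by eventually_elim auto
  then obtain N where "\<And>n. n \<ge> N \<Longrightarrow> n \<notin> ?S" by (auto simp: eventually_sequentially)
  then have "?S \<subseteq> {..<N}" by (meson lessThan_iff linorder_not_le subsetI)
  then show fin: "finite ?S" by (rule finite_subset) simp
  have "Im (softplus (x n) v) = (if n \<in> ?S then pi else 0)" for n
    using Im_sp_pi[OF nonneg assms(1)] assms(2) by (auto simp: regular_def)
  then have "Im (log_gprod x v) = (\<Sum>n. if n \<in> ?S then pi else 0)"
    using Im_LL_sums[of v] by (simp add: sums_iff)
  also have "\<dots> = (\<Sum>n\<in>?S. if n \<in> ?S then pi else 0)"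
    by (rule suminf_finite[OF fin]) auto
  finally show "Im (log_gprod x v) = pi * real (card ?S)" by simp
qed

lemma LL_continuous: "continuous_on {v. regular x v} (log_gprod x)"
proof -
  have "continuous (at v within {v. regular x v}) (log_gprod x)" if v: "regular x v" for v
  proof -
    \<comment> \<open>The majorants need an upper bound for Re w; this relative neighbourhood of v
      provides one and is enough for continuity at v.\<close>
    define U where "U = {w. regular x w \<and> Re w < Re v + 1}"
    have "\<forall>\<^sub>F n in sequentially. x n * exp (Re v + 1) < 1 / 2" by (rule eventually_small)
    then obtain N where N: "\<And>n. n \<ge> N \<Longrightarrow> x n * exp (Re v + 1) < 1 / 2"
      by (auto simp: eventually_sequentially)
    have bnd: "x n * exp (Re w) \<le> x n * exp (Re v + 1)" if "w \<in> U" for w n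
      using that nonneg by (auto simp: U_def intro!: mult_left_mono)
    have "uniform_limit U (\<lambda>n w. \<Sum>i<n. softplus (x i) w) (\<lambda>w. \<Sum>i. softplus (x i) w) sequentially"
    proof (rule Weierstrass_m_test_ev)
      show "\<forall>\<^sub>F n in sequentially. \<forall>w\<in>U. norm (softplus (x n) w) \<le> 2 * (x n * exp (Re v + 1))"
        using eventually_ge_at_top[of N]
      proof eventually_elim
        case (elim n)
        show ?case
        proof
          fix w assume "w \<in> U"
          then show "norm (softplus (x n) w) \<le> 2 * (x n * exp (Re v + 1))"
            using norm_sp_le[of n w] bnd[of w n] N[OF elim] by linarith
        qed
      qed
      show "summable (\<lambda>n. 2 * (x n * exp (Re v + 1)))"
        by (intro summable_mult summable_mult2 summable)
    qed
    then have "continuous_on U (\<lambda>w. \<Sum>i. softplus (x i) w)"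
    proof (rule uniform_limit_theorem[rotated])
      show "\<forall>\<^sub>F n in sequentially. continuous_on U (\<lambda>w. \<Sum>i<n. softplus (x i) w)"
      proof (intro always_eventually allI continuous_on_sum)
        fix i
        have "(softplus (x i) has_field_derivative
           (of_real (x i) * exp w / (1 + of_real (x i) * exp w))) (at w within U)" if "w \<in> U" for w
          using that by (intro sp_has_field_derivative nonneg) (auto simp: U_def regular_def)
        then show "continuous_on U (softplus (x i))" by (rule DERIV_continuous_on)
      qed
    qed auto
    moreover have "v \<in> U" using v by (simp add: U_def)
    ultimately have "continuous (at v within U) (log_gprod x)"
      unfolding log_gprod_def by (auto simp: continuous_on_eq_continuous_within)
    moreover have "at v within U = at v within {v. regular x v}"
      by (rule at_within_nhd[of v "{w. Re w < Re v + 1}"]) (auto simp: U_def open_halfspace_Re_lt)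
    ultimately show ?thesis by simp
  qed
  then show ?thesis by (simp add: continuous_on_eq_continuous_within)
qed

end

subsection \<open>The level curve of the quotient\<close>

locale product_quotient = X: summable_weights x + Y: summable_weights y for x y +
  fixes k :: nat and p :: int and \<rho> :: real
  assumes k2: "2 \<le> k" and p_nz: "p \<noteq> 0" and \<rho>_pos: "0 < \<rho>"
    and nontrivial: "(\<exists>n. x n \<noteq> 0) \<or> (\<exists>n. y n \<noteq> 0)"
begin

definition w :: real where "w = pi / real k"

text \<open>Chosen so that exp (refl u) is the conjugate of -exp (k u), the point at which the
  denominator is evaluated. It maps the strip of width pi/k onto that of width pi and exchanges the
  two edges.\<close>

definition refl :: "complex \<Rightarrow> complex" where
  "refl u = of_nat k * cnj u + \<i> * of_real pi"

definition Fn :: "complex \<Rightarrow> complex" where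
  "Fn z = z powi p * (gprod x (z ^ k) / gprod y (- (z ^ k)))"

definition psi :: "complex \<Rightarrow> complex" where
  "psi u = of_int p * u + log_gprod x (of_nat k * u) - cnj (log_gprod y (refl u))"

definition strip :: "complex set" where "strip = {u. 0 \<le> Im u \<and> Im u \<le> w}"

definition reg :: "complex \<Rightarrow> bool" where
  "reg u \<longleftrightarrow> regular x (of_nat k * u) \<and> regular y (refl u)"

text \<open>The sign of |F| - \<rho>, with the denominator multiplied out so that the function is
  continuous across the poles as well.\<close>

definition Dn :: "complex \<Rightarrow> real" where
  "Dn u = exp (of_int p * Re u) * cmod (gprod x (exp (of_nat k * u)))
     - \<rho> * cmod (gprod y (- exp (of_nat k * u)))"

lemma w_pos [simp]: "0 < w" and w_nz [simp]: "w \<noteq> 0" and kw: "real k * w = pi" and k_pos: "0 < real k"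
  using k2 by (auto simp: w_def)

lemma Im_refl: "Im (refl u) = pi - real k * Im u" and Re_refl: "Re (refl u) = real k * Re u"
  by (auto simp: refl_def)

lemma exp_refl: "exp (refl u) = cnj (- exp (of_nat k * u))"
  by (simp add: refl_def exp_add exp_cnj)

lemma Im_scale:
  "0 \<le> real k * t \<longleftrightarrow> 0 \<le> t" "real k * t \<le> pi \<longleftrightarrow> t \<le> w" "real k * t < pi \<longleftrightarrow> t < w"
  "real k * t = pi \<longleftrightarrow> t = w"
  using k_pos by (auto simp: w_def field_simps zero_le_mult_iff)

lemma reg_iff: "reg u \<longleftrightarrow> u \<in> strip \<and> gprod x (exp (of_nat k * u)) \<noteq> 0
    \<and> gprod y (- exp (of_nat k * u)) \<noteq> 0"
  unfolding reg_def X.regular_iff Y.regular_iff exp_refl Y.gprod_cnj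
  by (auto simp: strip_def Im_refl Im_scale)

lemma gprod_x_nz: "0 \<le> Im u \<Longrightarrow> Im u < w \<Longrightarrow> gprod x (exp (of_nat k * u)) \<noteq> 0"
  using X.regular_inner[of "of_nat k * u"] X.regular_iff by (simp add: Im_scale)

lemma gprod_y_nz: "0 < Im u \<Longrightarrow> Im u \<le> w \<Longrightarrow> gprod y (- exp (of_nat k * u)) \<noteq> 0"
  using Y.regular_inner[of "refl u"] Y.regular_iff[of "refl u"] k_pos
  by (simp add: Im_refl Im_scale exp_refl Y.gprod_cnj flip: complex_cnj_minus)

lemma reg_inner: "0 < Im u \<Longrightarrow> Im u < w \<Longrightarrow> reg u"
  by (simp add: reg_iff strip_def gprod_x_nz gprod_y_nz)

lemma Fn_exp: "Fn (exp u) = exp (of_int p * u) * gprod x (exp (of_nat k * u)) / gprod y (- exp (of_nat k * u))"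
  by (simp add: Fn_def exp_power_int exp_of_nat_mult[symmetric] mult.commute)

lemma exp_psi: "reg u \<Longrightarrow> exp (psi u) = Fn (exp u)"
proof -
  assume r: "reg u"
  have "exp (cnj (log_gprod y (refl u))) = gprod y (- exp (of_nat k * u))"
    using r by (simp only: exp_cnj[symmetric] reg_def Y.exp_LL exp_refl Y.gprod_cnj complex_cnj_cnj)
  then show ?thesis using r by (simp add: psi_def exp_add exp_diff X.exp_LL reg_def Fn_exp)
qed

text \<open>The linear term contributes the real number p |v - u|^2. For the denominator Im (- cnj a
  * b) = Im (a * cnj b), so its minus sign and its reflection cancel.\<close>

lemma psi_diff:
  "Im ((psi v - psi u) * cnj (v - u)) =
     Im ((log_gprod x (of_nat k * v) - log_gprod x (of_nat k * u)) * cnj (of_nat k * v - of_nat k * u)) / k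
   + Im ((log_gprod y (refl v) - log_gprod y (refl u)) * cnj (refl v - refl u)) / k"
proof -
  have 1: "cnj (v - u) = cnj (of_nat k * v - of_nat k * u) / of_nat k"
          "cnj (v - u) = (refl v - refl u) / of_nat k"
    using k_pos by (simp_all add: refl_def field_simps)
  have "Im (of_int p * (v - u) * cnj (v - u)) = 0"
    by (simp add: algebra_simps)
  moreover have "Im ((log_gprod x (of_nat k * v) - log_gprod x (of_nat k * u)) * cnj (v - u)) =
      Im ((log_gprod x (of_nat k * v) - log_gprod x (of_nat k * u)) * cnj (of_nat k * v - of_nat k * u)) / k"
    unfolding 1(1) by (simp only: times_divide_eq_right Im_divide_of_nat)
  moreover have "Im (- cnj (log_gprod y (refl v) - log_gprod y (refl u)) * cnj (v - u)) =
      Im ((log_gprod y (refl v) - log_gprod y (refl u)) * cnj (refl v - refl u)) / k"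
  proof -
    have "Im (- cnj a * b) = Im (a * cnj b)" for a b :: complex by (simp add: algebra_simps)
    then show ?thesis
      unfolding 1(2) times_divide_eq_right Im_divide_of_nat by (simp add: algebra_simps)
  qed
  moreover have "(psi v - psi u) * cnj (v - u) = of_int p * (v - u) * cnj (v - u)
      + (log_gprod x (of_nat k * v) - log_gprod x (of_nat k * u)) * cnj (v - u)
      + (- cnj (log_gprod y (refl v) - log_gprod y (refl u)) * cnj (v - u))"
    by (simp add: psi_def algebra_simps)
  ultimately show ?thesis by (simp only: plus_complex.sel)
qed

lemma psi_diff_nonneg:
  assumes "reg u" "reg v"
  shows "0 \<le> Im ((psi v - psi u) * cnj (v - u))"
  unfolding psi_diff using assms
  by (intro add_nonneg_nonneg divide_nonneg_nonneg X.Im_LL_diff_nonneg Y.Im_LL_diff_nonneg) (auto simp: reg_def)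

text \<open>One nontrivial factor, available because \<open>f\<close> or \<open>g\<close> is
  nonconstant, makes the whole sum strict.\<close>

lemma psi_diff_pos:
  assumes "reg u" "reg v" "u \<noteq> v" "\<not> (Im u = Im v \<and> Im v \<in> {0, w})"
  shows "0 < Im ((psi v - psi u) * cnj (v - u))"
proof -
  have x0: "0 \<le> Im ((log_gprod x (of_nat k * v) - log_gprod x (of_nat k * u)) * cnj (of_nat k * v - of_nat k * u)) / k"
    using assms by (intro divide_nonneg_nonneg X.Im_LL_diff_nonneg) (auto simp: reg_def)
  have y0: "0 \<le> Im ((log_gprod y (refl v) - log_gprod y (refl u)) * cnj (refl v - refl u)) / k"
    using assms by (intro divide_nonneg_nonneg Y.Im_LL_diff_nonneg) (auto simp: reg_def)
  from nontrivial show ?thesis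
  proof (elim disjE exE)
    fix n assume n: "x n \<noteq> 0"
    have "0 < Im ((log_gprod x (of_nat k * v) - log_gprod x (of_nat k * u)) * cnj (of_nat k * v - of_nat k * u)) / k"
    proof (intro divide_pos_pos X.Im_LL_diff_pos[OF _ _ _ _ n])
      show "\<not> (Im (of_nat k * u) = Im (of_nat k * v) \<and> Im (of_nat k * v) \<in> {0, pi})"
        using assms(4) k_pos by (auto simp: Im_scale)
    qed (use assms k_pos in \<open>auto simp: reg_def\<close>)
    then show ?thesis unfolding psi_diff using y0 by linarith
  next
    fix n assume n: "y n \<noteq> 0"
    have "0 < Im ((log_gprod y (refl v) - log_gprod y (refl u)) * cnj (refl v - refl u)) / k"
    proof (intro divide_pos_pos Y.Im_LL_diff_pos[OF _ _ _ _ n])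
      show "\<not> (Im (refl u) = Im (refl v) \<and> Im (refl v) \<in> {0, pi})"
        using assms(4) k_pos Im_scale(4)[of "Im v"] by (auto simp: Im_refl)
      show "refl u \<noteq> refl v" using assms(3) k_pos by (auto simp: refl_def)
    qed (use assms k_pos in \<open>auto simp: reg_def\<close>)
    then show ?thesis unfolding psi_diff using x0 by linarith
  qed
qed

lemma psi_continuous: "continuous_on {u. reg u} psi"
proof -
  have 1: "continuous_on {u. reg u} (\<lambda>u. log_gprod x (of_nat k * u))"
    by (rule continuous_on_compose2[OF X.LL_continuous]) (auto simp: reg_def intro!: continuous_intros)
  have 2: "continuous_on {u. reg u} (\<lambda>u. log_gprod y (refl u))"
    by (rule continuous_on_compose2[OF Y.LL_continuous]) (auto simp: reg_def refl_def intro!: continuous_intros)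
  show ?thesis unfolding psi_def by (intro continuous_intros 1 2)
qed

lemma Im_psi_0:
  assumes "reg u" "Im u = 0"
  shows "Im (psi u) = pi * real (card {n. 1 < y n * exp (real k * Re u)})"
    "finite {n. 1 < y n * exp (real k * Re u)}"
  using assms Y.Im_LL_pi[of "refl u"] X.Im_LL_0[of "of_nat k * u"]
  by (simp_all add: psi_def reg_def Im_refl Re_refl)

lemma Im_psi_w:
  assumes "reg u" "Im u = w"
  shows "Im (psi u) = of_int p * w + pi * real (card {n. 1 < x n * exp (real k * Re u)})"
    "finite {n. 1 < x n * exp (real k * Re u)}"
  using assms X.Im_LL_pi[of "of_nat k * u"] Y.Im_LL_0[of "refl u"]
  by (simp_all add: psi_def reg_def Im_refl kw)

lemma Dn_continuous: "continuous_on S Dn"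
proof -
  have 1: "continuous_on UNIV (gprod x)" "continuous_on UNIV (gprod y)"
    by (intro holomorphic_on_imp_continuous_on X.gprod_holomorphic Y.gprod_holomorphic)+
  have 2: "continuous_on S (\<lambda>u. gprod x (exp (of_nat k * u)))"
      "continuous_on S (\<lambda>u. gprod y (- exp (of_nat k * u)))"
    by (rule continuous_on_compose2[OF 1(1)] continuous_on_compose2[OF 1(2)];
        auto intro!: continuous_intros)+
  show ?thesis unfolding Dn_def by (intro continuous_intros 2)
qed

section \<open>The level curve as a graph over the real axis\<close>

definition R :: "complex \<Rightarrow> real" where "R u = Re (psi u)"

lemma exp_R: "reg u \<Longrightarrow>
   exp (R u) * cmod (gprod y (- exp (of_nat k * u))) = exp (of_int p * Re u) * cmod (gprod x (exp (of_nat k * u)))"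
proof -
  assume r: "reg u"
  have "exp (R u) = cmod (exp (psi u))" by (simp add: R_def)
  also have "\<dots> = exp (of_int p * Re u) * cmod (gprod x (exp (of_nat k * u))) / cmod (gprod y (- exp (of_nat k * u)))"
    unfolding exp_psi[OF r] Fn_exp by (simp add: norm_mult norm_divide)
  finally show ?thesis using r by (simp add: reg_iff)
qed

lemma Dn_R: "reg u \<Longrightarrow> Dn u = (exp (R u) - \<rho>) * cmod (gprod y (- exp (of_nat k * u)))"
  by (simp only: Dn_def exp_R[symmetric] left_diff_distrib)

lemma Dn_sgn:
  assumes "reg u"
  shows "Dn u < 0 \<longleftrightarrow> R u < ln \<rho>" "Dn u = 0 \<longleftrightarrow> R u = ln \<rho>" "0 < Dn u \<longleftrightarrow> ln \<rho> < R u"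
proof -
  have c: "cmod (gprod y (- exp (of_nat k * u))) > 0" using assms by (simp add: reg_iff)
  have "exp (R u) < \<rho> \<longleftrightarrow> R u < ln \<rho>" "\<rho> < exp (R u) \<longleftrightarrow> ln \<rho> < R u" "exp (R u) = \<rho> \<longleftrightarrow> R u = ln \<rho>"
    using \<rho>_pos by (metis exp_less_cancel_iff exp_ln, metis exp_less_cancel_iff exp_ln, metis exp_ln ln_exp)
  then show "Dn u < 0 \<longleftrightarrow> R u < ln \<rho>" "Dn u = 0 \<longleftrightarrow> R u = ln \<rho>" "0 < Dn u \<longleftrightarrow> ln \<rho> < R u"
    unfolding Dn_R[OF assms] using c by (auto simp: mult_less_0_iff zero_less_mult_iff)
qed

text \<open>The level set of \<open>\<bar>Fn\<bar>\<close> at height \<open>\<rho>\<close>, closed up along the boundary of the strip where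
  \<open>\<bar>Fn\<bar>\<close> stays on one side of \<open>\<rho>\<close>.\<close>

definition root :: "complex \<Rightarrow> bool" where
  "root u \<longleftrightarrow> u \<in> strip \<and> (Dn u = 0 \<or> Im u = 0 \<and> Dn u < 0 \<or> Im u = w \<and> 0 < Dn u)"

text \<open>On the bottom edge only poles could do harm, and there \<open>Dn\<close> is positive,
  contrary to the clause for that edge; on the top edge only zeros could, and there
  \<open>Dn\<close> is negative.\<close>

lemma root_reg: assumes "root u" shows "reg u"
proof -
  have s: "0 \<le> Im u" "Im u \<le> w" using assms by (auto simp: root_def strip_def)
  consider "0 < Im u" "Im u < w" | "Im u = 0" | "Im u = w" using s by linarith
  then show ?thesis
  proof cases
    case 1
    then show ?thesis by (rule reg_inner)
  next
    case 2
    then have gx: "gprod x (exp (of_nat k * u)) \<noteq> 0" by (intro gprod_x_nz) auto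
    have "Dn u \<le> 0" using assms 2 w_pos by (auto simp: root_def)
    moreover have "Dn u > 0" if "gprod y (- exp (of_nat k * u)) = 0"
      using gx that by (simp add: Dn_def)
    ultimately show ?thesis using gx s by (auto simp: reg_iff strip_def)
  next
    case 3
    then have gy: "gprod y (- exp (of_nat k * u)) \<noteq> 0" by (intro gprod_y_nz) auto
    have "Dn u \<ge> 0" using assms 3 w_pos by (auto simp: root_def)
    moreover have "Dn u < 0" if "gprod x (exp (of_nat k * u)) = 0"
      using gy that \<rho>_pos by (simp add: Dn_def)
    ultimately show ?thesis using gy s by (auto simp: reg_iff strip_def)
  qed
qed

lemma root_cases:
  assumes "root u"
  obtains "R u = ln \<rho>" | "Im u = 0" "R u < ln \<rho>" | "Im u = w" "ln \<rho> < R u"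
  using assms Dn_sgn[OF root_reg[OF assms]] by (auto simp: root_def)

text \<open>A modulus that is too small occurs only on the bottom edge and one that is too large
  only on the top edge, so modulus and height are ordered alike.\<close>

lemma root_R_Im:
  assumes "root u" "root v"
  shows "0 \<le> (R v - R u) * (Im v - Im u)"
proof -
  have s: "0 \<le> Im u" "Im u \<le> w" "0 \<le> Im v" "Im v \<le> w"
    using assms by (auto simp: root_def strip_def)
  show ?thesis
    using assms(1)
  proof (cases rule: root_cases)
    case 1
    show ?thesis
      by (rule root_cases[OF assms(2)]; use 1 s in \<open>auto simp: zero_le_mult_iff mult_le_0_iff\<close>)
  next
    case 2
    show ?thesis
      by (rule root_cases[OF assms(2)]; use 2 s in \<open>auto simp: zero_le_mult_iff mult_le_0_iff\<close>)
  next
    case 3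
    show ?thesis
      by (rule root_cases[OF assms(2)]; use 3 s in \<open>auto simp: zero_le_mult_iff mult_le_0_iff\<close>)
  qed
qed

lemma Im_psi_diff_expand:
  "Im ((psi v - psi u) * cnj (v - u)) = (Im (psi v) - Im (psi u)) * (Re v - Re u) - (R v - R u) * (Im v - Im u)"
  by (simp add: R_def algebra_simps)

text \<open>For equal real parts the monotone expression reduces to minus the product estimated in
  \<open>root_R_Im\<close>, which contradicts strict positivity.\<close>

lemma root_unique:
  assumes "root u" "root v" "Re u = Re v"
  shows "u = v"
proof (rule ccontr)
  assume ne: "u \<noteq> v"
  then have "Im u \<noteq> Im v" using assms(3) by (simp add: complex_eq_iff)
  then have "0 < Im ((psi v - psi u) * cnj (v - u))"
    using psi_diff_pos[of u v] root_reg assms ne by auto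
  then show False using root_R_Im[OF assms(1,2)] assms(3) unfolding Im_psi_diff_expand by simp
qed

text \<open>If neither edge qualifies by a strict clause, \<open>Dn\<close> is nonnegative below and
  nonpositive above, and the intermediate value theorem applies.\<close>

lemma root_exists: "\<exists>t. root (Complex s t)"
proof -
  have c: "continuous_on {0..w} (\<lambda>t. Dn (Complex s t))"
  proof -
    have "continuous_on {0..w} (\<lambda>t. Complex s t)"
      unfolding Complex_eq by (intro continuous_intros)
    then show ?thesis by (rule continuous_on_compose2[OF Dn_continuous[of UNIV]]) auto
  qed
  consider "Dn (Complex s 0) < 0" | "Dn (Complex s w) > 0"
    | "Dn (Complex s 0) \<ge> 0" "Dn (Complex s w) \<le> 0" by linarith
  then show ?thesis
  proof cases
    case 1
    then show ?thesis by (intro exI[of _ 0]) (auto simp: root_def strip_def less_imp_le)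
  next
    case 2
    then show ?thesis by (intro exI[of _ w]) (auto simp: root_def strip_def less_imp_le)
  next
    case 3
    then obtain t where "0 \<le> t" "t \<le> w" "Dn (Complex s t) = 0"
      using IVT2'[of "\<lambda>t. Dn (Complex s t)" w 0 0] c by (auto simp: less_imp_le)
    then show ?thesis by (intro exI[of _ t]) (auto simp: root_def strip_def)
  qed
qed

definition T :: "real \<Rightarrow> real" where "T s = (THE t. root (Complex s t))"

abbreviation cu :: "real \<Rightarrow> complex" where "cu s \<equiv> Complex s (T s)"

lemma root_cu: "root (cu s)" and T_eqI: "root (Complex s t) \<Longrightarrow> T s = t"
proof -
  have "\<exists>!t. root (Complex s t)"
    using root_exists[of s] root_unique by (metis complex.sel)
  then show "root (cu s)" "root (Complex s t) \<Longrightarrow> T s = t"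
    unfolding T_def by (auto intro: theI' the1_equality)
qed

lemma reg_cu: "reg (cu s)" by (rule root_reg[OF root_cu])

lemma T_range: "0 \<le> T s" "T s \<le> w"
  using root_cu[of s] by (auto simp: root_def strip_def)


text \<open>The range is compact, so a closed graph is enough.\<close>

lemma continuous_T: "continuous_on UNIV T"
proof (rule continuous_from_closed_graph[where T = "{0..w}"])
  have C: "continuous_on UNIV (\<lambda>q::real \<times> real. Complex (fst q) (snd q))"
    unfolding Complex_eq by (intro continuous_intros)
  have D: "continuous_on UNIV (\<lambda>q. Dn (Complex (fst q) (snd q)))"
    by (rule continuous_on_compose2[OF Dn_continuous[of UNIV] C]) auto
  have "q \<in> (\<lambda>s. (s, T s)) ` UNIV \<longleftrightarrow> root (Complex (fst q) (snd q))" for q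
    by (cases q) (auto simp: root_cu T_eqI)
  then have "(\<lambda>s. (s, T s)) ` UNIV = {q. root (Complex (fst q) (snd q))}" by blast
  \<comment> \<open>The strict inequalities of \<open>root\<close> may be relaxed because equality
    is covered by its first alternative; this shows closedness.\<close>
  also have "\<dots> = {q. 0 \<le> snd q} \<inter> {q. snd q \<le> w} \<inter> ({q. Dn (Complex (fst q) (snd q)) = 0}
      \<union> ({q. snd q = 0} \<inter> {q. Dn (Complex (fst q) (snd q)) \<le> 0})
      \<union> ({q. snd q = w} \<inter> {q. 0 \<le> Dn (Complex (fst q) (snd q))}))"
    by (auto simp: root_def strip_def)
  also have "closed \<dots>"
    by (intro closed_Int closed_Un closed_Collect_le closed_Collect_eq D continuous_intros)
  finally show "closed ((\<lambda>s. (s, T s)) ` UNIV)" .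
qed (simp_all add: T_range)

lemma continuous_cu: "continuous_on UNIV cu"
  unfolding Complex_eq using continuous_T by (intro continuous_intros) auto

definition Z :: "real set" where "Z = {s. Dn (cu s) = 0}"

definition B :: "real \<Rightarrow> real" where "B s = Im (psi (cu s)) / w"

lemma Z_R: "s \<in> Z \<longleftrightarrow> R (cu s) = ln \<rho>"
  using Dn_sgn(2)[OF reg_cu] by (simp add: Z_def)

lemma continuous_B: "continuous_on UNIV B"
proof -
  have "continuous_on UNIV (\<lambda>s. psi (cu s))"
    by (rule continuous_on_compose2[OF psi_continuous continuous_cu]) (auto simp: reg_cu)
  then show ?thesis unfolding B_def by (intro continuous_intros) auto
qed

text \<open>The increment of the argument times s' - s is the monotone expression plus the product
  from \<open>root_R_Im\<close>, both nonnegative. Equality makes the former vanish, which happens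
  only along an edge.\<close>

lemma B_step:
  assumes "s < s'"
  shows "B s \<le> B s'" "B s = B s' \<Longrightarrow> T s = T s' \<and> T s' \<in> {0, w}"
proof -
  let ?d = "Im ((psi (cu s') - psi (cu s)) * cnj (cu s' - cu s))"
  have e: "(Im (psi (cu s')) - Im (psi (cu s))) * (s' - s) = ?d + (R (cu s') - R (cu s)) * (T s' - T s)"
    unfolding Im_psi_diff_expand by simp
  have q: "0 \<le> (R (cu s') - R (cu s)) * (T s' - T s)"
    using root_R_Im[OF root_cu root_cu] by simp
  have d: "0 \<le> ?d" by (intro psi_diff_nonneg reg_cu)
  have "0 \<le> (Im (psi (cu s')) - Im (psi (cu s))) * (s' - s)" unfolding e using q d by linarith
  then have "Im (psi (cu s)) \<le> Im (psi (cu s'))" using assms by (simp add: zero_le_mult_iff)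
  then show "B s \<le> B s'" unfolding B_def by (intro divide_right_mono) (auto simp: less_imp_le)
  assume "B s = B s'"
  then have "Im (psi (cu s)) = Im (psi (cu s'))" by (simp add: B_def)
  then have "?d + (R (cu s') - R (cu s)) * (T s' - T s) = 0" using e by simp
  then have "\<not> 0 < ?d" using q by linarith
  then show "T s = T s' \<and> T s' \<in> {0, w}"
    using psi_diff_pos[OF reg_cu[of s] reg_cu[of s']] assms by (auto simp: complex_eq_iff)
qed

lemma mono_B: "s \<le> s' \<Longrightarrow> B s \<le> B s'"
  using B_step(1) by (cases "s = s'") auto

text \<open>A factor that has changed sign adds pi, which is k units of pi/k. Here the sign changes
  are poles of the quotient; in \<open>B_T_w\<close> they are zeros, and z^p adds p.\<close>

lemma B_T_0: "T s = 0 \<Longrightarrow> B s = real k * real (card {n. 1 < y n * exp (real k * s)})"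
  using Im_psi_0(1)[OF reg_cu, of s] k_pos by (simp add: B_def w_def)

lemma B_T_w: "T s = w \<Longrightarrow> B s = of_int p + real k * real (card {n. 1 < x n * exp (real k * s)})"
  using Im_psi_w(1)[OF reg_cu, of s] k_pos by (simp add: B_def w_def field_simps)

lemma neg_T: "R (cu s) < ln \<rho> \<Longrightarrow> T s = 0" and pos_T: "ln \<rho> < R (cu s) \<Longrightarrow> T s = w"
  using root_cases[OF root_cu[of s]] by fastforce+

end

subsection \<open>Order of contact along the level curve\<close>

context product_quotient begin

text \<open>The limit stays inside the closed strip because the monotonicity of \<open>psi\<close>
  is available only there.\<close>

definition expansion :: "real \<Rightarrow> nat \<Rightarrow> complex \<Rightarrow> bool" where
  "expansion s N c \<longleftrightarrow> 0 < N \<and> c \<noteq> 0 \<and>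
     ((\<lambda>h. (psi (cu s + h) - psi (cu s)) / h ^ N) \<longlongrightarrow> c) (at 0 within {h. reg (cu s + h)})"

lemma eventually_reg:
  assumes "reg u" "(g \<longlongrightarrow> 0) F" "\<forall>\<^sub>F a in F. u + g a \<in> strip"
  shows "\<forall>\<^sub>F a in F. reg (u + g a)"
proof -
  define P where "P v = gprod x (exp (of_nat k * v)) * gprod y (- exp (of_nat k * v))" for v
  have 1: "continuous_on UNIV (gprod x)" "continuous_on UNIV (gprod y)"
    by (intro holomorphic_on_imp_continuous_on X.gprod_holomorphic Y.gprod_holomorphic)+
  have "continuous_on UNIV P" unfolding P_def
    by (intro continuous_on_mult; rule continuous_on_compose2[OF 1(1)] continuous_on_compose2[OF 1(2)];
        auto intro!: continuous_intros)
  then have "isCont P u" by (simp add: continuous_on_eq_continuous_at)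
  moreover have "((\<lambda>a. u + g a) \<longlongrightarrow> u) F" using tendsto_add[OF tendsto_const[of u] assms(2)] by simp
  ultimately have "((\<lambda>a. P (u + g a)) \<longlongrightarrow> P u) F" by (rule isCont_tendsto_compose)
  moreover have "P u \<noteq> 0" using assms(1) by (simp add: reg_iff P_def)
  ultimately have "\<forall>\<^sub>F a in F. P (u + g a) \<noteq> 0" by (rule tendsto_imp_eventually_ne)
  with assms(3) show ?thesis by eventually_elim (auto simp: reg_iff P_def)
qed

text \<open>Along h = r cis \<theta> the number c h^N * cnj h has the argument of c cis ((N - 1)
  \<theta>). Divide the monotonicity inequality by r^(N+1) and let r tend to 0.\<close>

lemma expansion_direction:
  assumes e: "expansion s N c" and st: "\<forall>\<^sub>F r in at_right 0. cu s + of_real r * cis \<theta> \<in> strip"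
  shows "0 \<le> Im (c * cis (real (N - 1) * \<theta>))"
proof -
  let ?h = "\<lambda>r. of_real r * cis \<theta>"
  have h0: "(?h \<longlongrightarrow> 0) (at_right 0)"
    by (rule tendsto_eq_intros | simp)+
  have reg: "\<forall>\<^sub>F r in at_right 0. reg (cu s + ?h r)"
    by (rule eventually_reg[OF reg_cu h0 st])
  have pos: "\<forall>\<^sub>F r::real in at_right 0. 0 < r" by (simp add: eventually_at_right_less)
  have "\<forall>\<^sub>F r in at_right 0. ?h r \<in> {h. reg (cu s + h)} \<and> ?h r \<noteq> 0"
    using reg pos by eventually_elim auto
  then have "filterlim ?h (at 0 within {h. reg (cu s + h)}) (at_right 0)"
    using h0 by (simp add: filterlim_at)
  then have "((\<lambda>r. (psi (cu s + ?h r) - psi (cu s)) / ?h r ^ N) \<longlongrightarrow> c) (at_right 0)"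
    using e unfolding expansion_def by (auto intro: filterlim_compose[rotated])
  then have "((\<lambda>r. Im ((psi (cu s + ?h r) - psi (cu s)) / ?h r ^ N * cis (real (N - 1) * \<theta>)))
      \<longlongrightarrow> Im (c * cis (real (N - 1) * \<theta>))) (at_right 0)"
    by (intro tendsto_Im tendsto_mult_right)
  moreover have "\<forall>\<^sub>F r in at_right 0. 0 \<le> Im ((psi (cu s + ?h r) - psi (cu s)) / ?h r ^ N * cis (real (N - 1) * \<theta>))"
    using reg pos
  proof eventually_elim
    case (elim r)
    obtain n where n: "N = Suc n" using e by (cases N) (auto simp: expansion_def)
    have dm: "cis \<theta> ^ n = cis (real n * \<theta>)" by (rule Complex.DeMoivre)
    have "?h r ^ N = of_real (r ^ N) * cis (real (N - 1) * \<theta>) * cis \<theta>"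
      by (simp add: n power_mult_distrib dm)
    then have "(psi (cu s + ?h r) - psi (cu s)) / ?h r ^ N * cis (real (N - 1) * \<theta>)
       = (psi (cu s + ?h r) - psi (cu s)) * cnj (cis \<theta>) / of_real (r ^ N)"
      by (simp add: divide_inverse cis_cnj cis_inverse cis_mult)
    also have "\<dots> = (psi (cu s + ?h r) - psi (cu s)) * cnj (?h r) / of_real (r ^ Suc N)"
      using elim by (simp add: field_simps)
    also have "Im \<dots> = Im ((psi (cu s + ?h r) - psi (cu s)) * cnj (?h r)) / r ^ Suc N"
      by (simp only: Im_divide_of_real)
    also have "\<dots> \<ge> 0"
    proof (rule divide_nonneg_nonneg)
      show "0 \<le> Im ((psi (cu s + ?h r) - psi (cu s)) * cnj (?h r))"
        using psi_diff_nonneg[OF reg_cu[of s] elim(1)] by (simp only: add_diff_cancel_left')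
    qed (use elim(2) in simp)
    finally show ?case .
  qed
  ultimately show ?thesis by (intro tendsto_lowerbound) auto
qed

lemma strip_direction:
  assumes "0 < T s \<or> 0 \<le> sin \<theta>" "T s < w \<or> sin \<theta> \<le> 0"
  shows "\<forall>\<^sub>F r in at_right 0. cu s + of_real r * cis \<theta> \<in> strip"
proof -
  have t: "((\<lambda>r. T s + r * sin \<theta>) \<longlongrightarrow> T s) (at_right 0)"
    by (rule tendsto_eq_intros | simp)+
  have pos: "\<forall>\<^sub>F r::real in at_right 0. 0 < r" by (simp add: eventually_at_right_less)
  have "\<forall>\<^sub>F r in at_right 0. 0 \<le> T s + r * sin \<theta>"
  proof (cases "0 < T s")
    case True
    show ?thesis using order_tendstoD(1)[OF t True] by (auto elim!: eventually_mono)
  next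
    case False
    with assms show ?thesis using pos T_range[of s] by (auto elim!: eventually_mono)
  qed
  moreover have "\<forall>\<^sub>F r in at_right 0. T s + r * sin \<theta> \<le> w"
  proof (cases "T s < w")
    case True
    show ?thesis using order_tendstoD(2)[OF t True] by (auto elim!: eventually_mono)
  next
    case False
    then have "sin \<theta> \<le> 0" "T s = w" using assms T_range[of s] by auto
    then show ?thesis using pos by (auto elim!: eventually_mono simp: mult_nonneg_nonpos)
  qed
  ultimately show ?thesis by eventually_elim (simp add: strip_def)
qed

text \<open>All directions are admissible. For N > 1 the number c cis ((N - 1) \<theta>) runs
  through every argument and cannot stay in a half plane; four directions already force c =
  0.\<close>

lemma expansion_inner:
  assumes e: "expansion s N c" and T: "0 < T s" "T s < w"
  shows "N = 1"
proof (rule ccontr)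
  assume "N \<noteq> 1"
  define n where "n = N - 1"
  have n: "0 < n" using \<open>N \<noteq> 1\<close> e by (auto simp: n_def expansion_def)
  have d: "0 \<le> Im (c * cis (real n * \<theta>))" for \<theta>
    unfolding n_def using T by (intro expansion_direction[OF e] strip_direction) auto
  have "Im c = 0" using d[of 0] d[of "pi / n"] n by simp
  moreover have "Re c = 0" using d[of "pi / 2 / n"] d[of "- (pi / 2) / n"] n by simp
  ultimately show False using e by (simp add: expansion_def complex_eq_iff)
qed

text \<open>Only a half circle of directions is admissible, and (N - 1) \<theta> sweeps an angle (N
  - 1) pi. For N = 2 this is exactly a half circle, which makes c real and fixes its sign; for N > 2
  the angle 3 pi / 2 is reached and gives the opposite sign.\<close>

lemma expansion_boundary:
  assumes e: "expansion s N c" and T: "T s \<in> {0, w}"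
  shows "N = 1 \<or> N = 2 \<and> Im c = 0 \<and> (T s = 0 \<longrightarrow> 0 < Re c) \<and> (T s = w \<longrightarrow> Re c < 0)"
proof (cases "N = 1")
  case False
  define n where "n = N - 1"
  have n: "0 < n" using False e by (auto simp: n_def expansion_def)
  \<comment> \<open>Orientation of the admissible directions: upwards from the bottom edge,
    downwards from the top edge.\<close>
  define \<epsilon> :: real where "\<epsilon> = (if T s = 0 then 1 else -1)"
  have d: "0 \<le> Im (c * cis (real n * (\<epsilon> * \<theta>)))" if "0 \<le> \<theta>" "\<theta> \<le> pi" for \<theta>
    unfolding n_def using T that
    by (intro expansion_direction[OF e] strip_direction) (auto simp: \<epsilon>_def sin_ge_zero)
  have s: "cis (real n * (\<epsilon> * (a / real n))) = cis (\<epsilon> * a)" for a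
    using n by (simp add: field_simps)
  have d': "0 \<le> Im (c * cis (\<epsilon> * a))" if "0 \<le> a" "a \<le> pi * n" for a
    using d[of "a / n"] that n unfolding s by (simp add: field_simps)
  have 1: "Im c = 0"
    using d'[of 0] d'[of pi] n by (auto simp: \<epsilon>_def split: if_splits)
  have 2: "0 \<le> \<epsilon> * Re c"
    using d'[of "pi / 2"] n pi_gt_zero by (auto simp: \<epsilon>_def field_simps split: if_splits)
  have r: "Re c \<noteq> 0" using 1 e by (auto simp: expansion_def complex_eq_iff)
  have "n = 1"
  proof (rule ccontr)
    assume "n \<noteq> 1"
    then have "real n \<ge> 2" using n by linarith
    then have "3 * pi / 2 \<le> pi * n" using pi_gt_zero by (simp add: field_simps)
    then have "0 \<le> Im (c * cis (\<epsilon> * (3 / 2 * pi)))" by (intro d') auto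
    then have "0 \<le> - (\<epsilon> * Re c)"
      using sin_3over2_pi cos_3over2_pi by (cases "T s = 0") (simp_all add: \<epsilon>_def)
    then show False using 2 r by (auto simp: \<epsilon>_def split: if_splits)
  qed
  then have "N = 2" by (simp add: n_def)
  then show ?thesis using 1 2 r T by (auto simp: \<epsilon>_def split: if_splits)
qed auto

text \<open>Real increments keep the point on its edge. As Im \<open>psi\<close> is locally constant
  there, the coefficient c is real and describes the modulus alone.\<close>

lemma expansion_along_boundary:
  assumes e: "expansion s N c" and T: "T s \<in> {0, w}" and s: "s \<in> Z"
  shows "\<forall>\<^sub>F a in at s. Im (psi (Complex a (T s))) = Im (psi (cu s))"
    "((\<lambda>a. (R (Complex a (T s)) - ln \<rho>) / (a - s) ^ N) \<longlongrightarrow> Re c) (at s)" "Im c = 0"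
    "\<forall>\<^sub>F a in at s. reg (Complex a (T s))"
proof -
  let ?h = "\<lambda>a. of_real (a - s) :: complex"
  have cx: "cu s + ?h a = Complex a (T s)" for a by (simp add: complex_eq_iff)
  have h0: "(?h \<longlongrightarrow> 0) (at s)" by (rule tendsto_eq_intros | simp)+
  show reg: "\<forall>\<^sub>F a in at s. reg (Complex a (T s))"
  proof -
    have "\<forall>\<^sub>F a in at s. reg (cu s + ?h a)"
      by (rule eventually_reg[OF reg_cu h0]) (simp add: strip_def T_range)
    then show ?thesis by (simp only: cx)
  qed
  have ne: "\<forall>\<^sub>F a in at s. a \<noteq> s" by (simp add: eventually_at_filter)
  have fl: "filterlim ?h (at 0 within {h. reg (cu s + h)}) (at s)"
  proof -
    have "\<forall>\<^sub>F a in at s. ?h a \<in> {h. reg (cu s + h)} \<and> ?h a \<noteq> 0"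
      using reg ne by eventually_elim (simp only: cx mem_Collect_eq, simp)
    then show ?thesis using h0 by (simp add: filterlim_at)
  qed
  have lim: "((\<lambda>a. (psi (Complex a (T s)) - psi (cu s)) / ?h a ^ N) \<longlongrightarrow> c) (at s)"
    using filterlim_compose[OF _ fl, of "\<lambda>h. (psi (cu s + h) - psi (cu s)) / h ^ N"] e
    unfolding expansion_def cx by auto
  have "((\<lambda>a. (psi (Complex a (T s)) - psi (cu s)) / ?h a ^ N * ?h a ^ N) \<longlongrightarrow> c * 0 ^ N) (at s)"
    by (intro tendsto_mult lim tendsto_power h0)
  then have "((\<lambda>a. Im ((psi (Complex a (T s)) - psi (cu s)) / ?h a ^ N * ?h a ^ N)) \<longlongrightarrow> 0) (at s)"
    by (rule tendsto_eq_rhs[OF tendsto_Im]) (use e in \<open>simp add: expansion_def\<close>)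
  then have "\<forall>\<^sub>F a in at s. dist (Im ((psi (Complex a (T s)) - psi (cu s)) / ?h a ^ N * ?h a ^ N)) 0 < pi"
    by (rule tendstoD) simp
  with reg ne show const: "\<forall>\<^sub>F a in at s. Im (psi (Complex a (T s))) = Im (psi (cu s))"
  proof eventually_elim
    case (elim a)
    \<comment> \<open>On a fixed edge Im \<open>psi\<close> takes values in one translate of the
      multiples of pi, so an increment smaller than pi is 0.\<close>
    have f: "\<exists>n::nat. Im (psi v) = (if T s = 0 then 0 else of_int p * w) + pi * real n"
      if "reg v" "Im v = T s" for v
      using Im_psi_0(1)[OF that(1)] Im_psi_w(1)[OF that(1)] that(2) T by auto
    obtain n m :: nat where "Im (psi (Complex a (T s))) = (if T s = 0 then 0 else of_int p * w) + pi * real n"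
      "Im (psi (cu s)) = (if T s = 0 then 0 else of_int p * w) + pi * real m"
      using f[OF elim(1)] f[OF reg_cu] by force
    then have nm: "Im (psi (Complex a (T s))) - Im (psi (cu s)) = pi * (real n - real m)"
      by (simp only: right_diff_distrib)
    have "\<bar>pi * (real n - real m)\<bar> < pi" using elim nm by simp
    then have "\<bar>real n - real m\<bar> < 1" by (simp add: abs_mult)
    then have "n = m" by linarith
    then show ?case using nm by simp
  qed
  have pw: "z / ?h a ^ N = z / of_real ((a - s) ^ N)" for z a by simp
  have "((\<lambda>a. Re ((psi (Complex a (T s)) - psi (cu s)) / ?h a ^ N)) \<longlongrightarrow> Re c) (at s)"
    by (rule tendsto_Re[OF lim])
  then show "((\<lambda>a. (R (Complex a (T s)) - ln \<rho>) / (a - s) ^ N) \<longlongrightarrow> Re c) (at s)"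
    unfolding pw Re_divide_of_real using s by (simp add: Z_R R_def)
  have "((\<lambda>a. Im ((psi (Complex a (T s)) - psi (cu s)) / ?h a ^ N)) \<longlongrightarrow> Im c) (at s)"
    by (rule tendsto_Im[OF lim])
  then have "((\<lambda>a. 0) \<longlongrightarrow> Im c) (at s)"
    unfolding pw Im_divide_of_real
    by (rule Lim_transform_eventually) (use const in \<open>auto elim!: eventually_mono\<close>)
  then show "Im c = 0" by (simp add: tendsto_const_iff)
qed

text \<open>Too small a modulus below, or too large a modulus above, is precisely what a closing
  clause of \<open>root\<close> asks for; \<open>T_boundary_pos\<close> is the opposite
  situation.\<close>

lemma T_boundary_neg:
  assumes "T s = 0 \<and> R (Complex a (T s)) < ln \<rho> \<or> T s = w \<and> ln \<rho> < R (Complex a (T s))"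
    "reg (Complex a (T s))"
  shows "T a = T s"
proof (rule T_eqI)
  show "root (Complex a (T s))"
    using assms Dn_sgn[OF assms(2)] by (auto simp: root_def reg_iff)
qed

lemma T_boundary_pos:
  assumes "T s = 0 \<and> ln \<rho> < R (Complex a (T s)) \<or> T s = w \<and> R (Complex a (T s)) < ln \<rho>"
    "reg (Complex a (T s))"
  shows "T a \<noteq> T s"
proof
  assume eq: "T a = T s"
  have "root (Complex a (T s))" using root_cu[of a] eq by simp
  then show False
    using assms Dn_sgn[OF assms(2)] w_pos by (auto simp: root_def)
qed

text \<open>If the values agreed, \<open>B\<close> would by monotonicity be constant in between, and
  \<open>B_step\<close> would freeze \<open>T\<close> immediately to the right of s.\<close>

lemma B_neq_of_near:
  assumes "\<forall>\<^sub>F a in at_right s. T a \<noteq> T s" "s < s'"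
  shows "B s' \<noteq> B s"
proof
  assume eq: "B s' = B s"
  obtain b where b: "b > s" "\<And>a. s < a \<Longrightarrow> a < b \<Longrightarrow> T a \<noteq> T s"
    using assms(1) by (auto simp: eventually_at_right_field)
  define a where "a = min ((s + b) / 2) s'"
  have a: "s < a" "a < b" "a \<le> s'" using b assms(2) by (auto simp: a_def min_def field_simps)
  have "B s = B a" using mono_B[of s a] mono_B[of a s'] a eq by simp
  then show False using B_step(2)[OF a(1)] b(2) a by auto
qed

lemma B_neq_of_near':
  assumes "\<forall>\<^sub>F a in at_left s. T a \<noteq> T s" "s' < s"
  shows "B s' \<noteq> B s"
proof
  assume eq: "B s' = B s"
  obtain b where b: "b < s" "\<And>a. b < a \<Longrightarrow> a < s \<Longrightarrow> T a \<noteq> T s"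
    using assms(1) by (auto simp: eventually_at_left_field)
  define a where "a = max ((s + b) / 2) s'"
  have a: "a < s" "b < a" "s' \<le> a" using b assms(2) by (auto simp: a_def max_def field_simps)
  have "B a = B s" using mono_B[of s' a] mono_B[of a s] a eq by simp
  then show False using B_step(2)[OF a(1)] b(2) a by auto
qed

text \<open>Along the edge R - ln \<rho> behaves like Re c (a - s)^N. For N = 1 it changes sign: on
  one side the edge still belongs to the curve and \<open>B\<close> is constant, on the other side
  the curve departs. For N = 2 the sign is the one that expels the curve on both sides.\<close>

lemma expansion_boundary_B:
  assumes e: "expansion s N c" and T: "T s \<in> {0, w}" and s: "s \<in> Z"
  shows "N = 1 \<and> (\<exists>a>s. B a = B s) \<and> (\<forall>a<s. B a \<noteq> B s) \<or>
         N = 1 \<and> (\<exists>a<s. B a = B s) \<and> (\<forall>a>s. B a \<noteq> B s) \<or>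
         N = 2 \<and> (\<forall>a. a \<noteq> s \<longrightarrow> B a \<noteq> B s)"
proof -
  note ab = expansion_along_boundary[OF e T s]
  \<comment> \<open>Normalises the two edges: a point of the edge belongs to the curve if \<epsilon>
    (R - ln \<rho>) is negative, and not if it is positive.\<close>
  define \<epsilon> :: real where "\<epsilon> = (if T s = 0 then 1 else -1)"
  have c: "Re c \<noteq> 0" using ab(3) e by (auto simp: expansion_def complex_eq_iff)
  have lim: "((\<lambda>a. (R (Complex a (T s)) - ln \<rho>) / (a - s) ^ N * (\<epsilon> / Re c)) \<longlongrightarrow> Re c * (\<epsilon> / Re c)) (at s)"
    by (intro tendsto_mult ab(2) tendsto_const)
  have Rc: "Re c * (\<epsilon> / Re c) = \<epsilon>" using c by simp
  have sg: "\<forall>\<^sub>F a in at s. 0 < (R (Complex a (T s)) - ln \<rho>) / (a - s) ^ N / Re c"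
  proof -
    have "((\<lambda>a. (R (Complex a (T s)) - ln \<rho>) / (a - s) ^ N / Re c) \<longlongrightarrow> Re c / Re c) (at s)"
      by (intro tendsto_divide ab(2) tendsto_const c)
    then show ?thesis by (rule order_tendstoD(1)) (use c in simp)
  qed
  have T2: "T s = 0 \<and> \<epsilon> = 1 \<or> T s = w \<and> \<epsilon> = -1" using T by (auto simp: \<epsilon>_def)
  have stay: "B a = B s"
    if "\<epsilon> * (R (Complex a (T s)) - ln \<rho>) < 0" "reg (Complex a (T s))"
      "Im (psi (Complex a (T s))) = Im (psi (cu s))" for a
  proof -
    have "T a = T s" by (rule T_boundary_neg[OF _ that(2)]) (use T2 that(1) in auto)
    then show ?thesis using that(3) by (simp add: B_def)
  qed
  have leave: "T a \<noteq> T s"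
    if "0 < \<epsilon> * (R (Complex a (T s)) - ln \<rho>)" "reg (Complex a (T s))" for a
    by (rule T_boundary_pos[OF _ that(2)]) (use T2 that(1) in auto)
  have all: "\<forall>\<^sub>F a in at s. 0 < (R (Complex a (T s)) - ln \<rho>) / (a - s) ^ N / Re c \<and>
     reg (Complex a (T s)) \<and> Im (psi (Complex a (T s))) = Im (psi (cu s)) \<and> a \<noteq> s"
    using sg ab(4) ab(1) by (intro eventually_conj) (auto simp: eventually_at_filter)
  then have R: "\<forall>\<^sub>F a in at_right s. 0 < (R (Complex a (T s)) - ln \<rho>) / (a - s) ^ N / Re c \<and>
     reg (Complex a (T s)) \<and> Im (psi (Complex a (T s))) = Im (psi (cu s)) \<and> s < a"
    and L: "\<forall>\<^sub>F a in at_left s. 0 < (R (Complex a (T s)) - ln \<rho>) / (a - s) ^ N / Re c \<and>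
     reg (Complex a (T s)) \<and> Im (psi (Complex a (T s))) = Im (psi (cu s)) \<and> a < s"
    by (auto simp: eventually_at_filter elim!: eventually_mono)
  have triv: "at_right s \<noteq> bot" "at_left s \<noteq> bot" by auto
  from expansion_boundary[OF e T] show ?thesis
  proof (elim disjE conjE)
    assume N: "N = 2" and i: "T s = 0 \<longrightarrow> 0 < Re c" "T s = w \<longrightarrow> Re c < 0"
    have ev: "0 < \<epsilon> * (R (Complex a (T s)) - ln \<rho>)"
      if "0 < (R (Complex a (T s)) - ln \<rho>) / (a - s) ^ N / Re c" for a
      using that i T2 N by (auto simp: zero_less_divide_iff divide_less_0_iff zero_less_mult_iff mult_less_0_iff)
    have "\<forall>\<^sub>F a in at_right s. T a \<noteq> T s" "\<forall>\<^sub>F a in at_left s. T a \<noteq> T s"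
      by (rule eventually_mono[OF R] eventually_mono[OF L]; use leave ev in blast)+
    then have "B a \<noteq> B s" if "a \<noteq> s" for a
      using B_neq_of_near[of s a] B_neq_of_near'[of s a] that by (cases "a < s") auto
    then show ?thesis using N by blast
  next
    assume N: "N = 1"
    show ?thesis
    proof (cases "0 < \<epsilon> * Re c")
      case True
      have pos: "0 < \<epsilon> * (R (Complex a (T s)) - ln \<rho>)"
        if "0 < (R (Complex a (T s)) - ln \<rho>) / (a - s) ^ N / Re c" "s < a" for a
        using that True T2 N by (auto simp: zero_less_divide_iff divide_less_0_iff zero_less_mult_iff mult_less_0_iff)
      have neg: "\<epsilon> * (R (Complex a (T s)) - ln \<rho>) < 0"
        if "0 < (R (Complex a (T s)) - ln \<rho>) / (a - s) ^ N / Re c" "a < s" for a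
        using that True T2 N by (auto simp: zero_less_divide_iff divide_less_0_iff zero_less_mult_iff mult_less_0_iff)
      have "\<forall>\<^sub>F a in at_right s. T a \<noteq> T s"
        by (rule eventually_mono[OF R]) (use leave pos in blast)
      then have "\<forall>a>s. B a \<noteq> B s" using B_neq_of_near by blast
      moreover have "\<forall>\<^sub>F a in at_left s. a < s \<and> B a = B s"
        by (rule eventually_mono[OF L]) (use stay neg in blast)
      then have "\<exists>a<s. B a = B s" using eventually_happens'[OF triv(2)] by blast
      ultimately show ?thesis using N by blast
    next
      case False
      have pos: "0 < \<epsilon> * (R (Complex a (T s)) - ln \<rho>)"
        if "0 < (R (Complex a (T s)) - ln \<rho>) / (a - s) ^ N / Re c" "a < s" for a
        using that False T2 N by (auto simp: zero_less_divide_iff divide_less_0_iff zero_less_mult_iff mult_less_0_iff)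
      have neg: "\<epsilon> * (R (Complex a (T s)) - ln \<rho>) < 0"
        if "0 < (R (Complex a (T s)) - ln \<rho>) / (a - s) ^ N / Re c" "s < a" for a
        using that False T2 N by (auto simp: zero_less_divide_iff divide_less_0_iff zero_less_mult_iff mult_less_0_iff)
      have "\<forall>\<^sub>F a in at_left s. T a \<noteq> T s"
        by (rule eventually_mono[OF L]) (use leave pos in blast)
      then have "\<forall>a<s. B a \<noteq> B s" using B_neq_of_near' by blast
      moreover have "\<forall>\<^sub>F a in at_right s. s < a \<and> B a = B s"
        by (rule eventually_mono[OF R]) (use stay neg in blast)
      then have "\<exists>a>s. B a = B s" using eventually_happens'[OF triv(1)] by blast
      ultimately show ?thesis using N by blast
    qed
  qed
qed


lemma psi_increment_tendsto:
  assumes "reg u"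
  shows "((\<lambda>h. psi (u + h) - psi u) \<longlongrightarrow> 0) (at 0 within {h. reg (u + h)})"
proof -
  have "(psi \<longlongrightarrow> psi u) (at u within {v. reg v})"
    using psi_continuous assms by (simp add: continuous_on_def)
  moreover have "filterlim (\<lambda>h. u + h) (at u within {v. reg v}) (at 0 within {h. reg (u + h)})"
    unfolding filterlim_at
    by (intro conjI tendsto_eq_intros) (auto simp: eventually_at_filter)
  ultimately have "((\<lambda>h. psi (u + h)) \<longlongrightarrow> psi u) (at 0 within {h. reg (u + h)})"
    by (rule filterlim_compose)
  then show ?thesis using tendsto_diff[OF _ tendsto_const[of "psi u"]] by fastforce
qed

text \<open>This turns the order of a zero of Fn - b into the order of contact of
  \<open>psi\<close>. With z = z0 exp (cj h), the differences z - z0 and exp (increment of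
  \<open>psi\<close>) - 1 are linear to first order in cj h and in the increment. Conjugation is the
  choice of \<open>cj\<close> at zeros that come from the conjugate curve.\<close>

lemma expansionI:
  assumes N: "0 < N" and b: "b \<noteq> 0" and G: "isCont G z0" "G z0 \<noteq> 0" and z0: "z0 \<noteq> 0"
    and ev: "\<forall>\<^sub>F z in nhds z0. Fn z - b = G z * (z - z0) ^ N"
    and cj: "cj = (\<lambda>z. z) \<or> cj = cnj"
    and par: "\<And>h. reg (cu s + h) \<Longrightarrow> Fn (z0 * exp (cj h)) = b * cj (exp (psi (cu s + h) - psi (cu s)))"
  shows "\<exists>c. expansion s N c"
proof -
  let ?F = "at (0::complex) within {h. reg (cu s + h)}"
  let ?d = "\<lambda>h. psi (cu s + h) - psi (cu s)"
  have cc: "cj (cj z) = z" "(cj z = 0) = (z = 0)" "cj (z * v) = cj z * cj v" "cj (z ^ n) = cj z ^ n"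
    "cj (z - v) = cj z - cj v" "cj 1 = 1" "cj (z / v) = cj z / cj v" for z v n
    using cj by auto
  have tc: "(f \<longlongrightarrow> l) F \<Longrightarrow> ((\<lambda>x. cj (f x)) \<longlongrightarrow> cj l) F" for f :: "complex \<Rightarrow> complex" and l F
    using cj by (auto intro: tendsto_cnj)
  have h0: "((\<lambda>h. h) \<longlongrightarrow> 0) ?F" by (rule tendsto_ident_at)
  have c0: "((\<lambda>h. cj h) \<longlongrightarrow> 0) ?F" using tc[OF h0] cc(2)[of 0] by simp
  have zt: "((\<lambda>h. z0 * exp (cj h)) \<longlongrightarrow> z0) ?F"
    using tendsto_mult[OF tendsto_const[of z0] tendsto_exp[OF c0]] by simp
  have reg: "\<forall>\<^sub>F h in ?F. reg (cu s + h) \<and> h \<noteq> 0" by (simp add: eventually_at_filter)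
  have ex1: "((\<lambda>z::complex. (exp z - 1) / z) \<longlongrightarrow> 1) (at 0)"
    using DERIV_exp[of "0::complex"] by (simp add: has_field_derivative_iff)
  have expq: "((\<lambda>h. (exp (cj h) - 1) / cj h) \<longlongrightarrow> 1) ?F"
  proof (rule filterlim_compose[OF ex1])
    show "filterlim cj (at 0) ?F"
      using c0 cc(2) by (auto simp: filterlim_at eventually_at_filter)
  qed
  define q where "q = (\<lambda>h. exp (?d h) - 1)"
  \<comment> \<open>From z - z0 = z0 (exp (cj h) - 1), which is z0 cj h to first order, after
    division by b.\<close>
  define c where "c = cj (G z0 * z0 ^ N / b)"
  have c: "c \<noteq> 0" using G(2) z0 b by (simp add: c_def cc)
  have q: "((\<lambda>h. q h / h ^ N) \<longlongrightarrow> c) ?F"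
  proof -
    have "((\<lambda>h. cj (G (z0 * exp (cj h)) * (z0 ^ N * ((exp (cj h) - 1) / cj h) ^ N) / b))
        \<longlongrightarrow> cj (G z0 * (z0 ^ N * 1 ^ N) / b)) ?F"
      by (intro tc tendsto_divide tendsto_mult tendsto_power expq tendsto_const isCont_tendsto_compose[OF G(1) zt] b)
    then have "((\<lambda>h. cj (G (z0 * exp (cj h)) * (z0 ^ N * ((exp (cj h) - 1) / cj h) ^ N) / b))
        \<longlongrightarrow> c) ?F" by (simp add: c_def)
    moreover have "\<forall>\<^sub>F h in ?F. cj (G (z0 * exp (cj h)) * (z0 ^ N * ((exp (cj h) - 1) / cj h) ^ N) / b)
       = q h / h ^ N"
      using reg eventually_compose_filterlim[OF ev zt]
    proof eventually_elim
      case (elim h)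
      then have "b * (cj (exp (?d h)) - 1) = G (z0 * exp (cj h)) * (z0 * exp (cj h) - z0) ^ N"
        using par[of h] by (simp add: algebra_simps)
      also have "z0 * exp (cj h) - z0 = z0 * (exp (cj h) - 1)" by (simp add: algebra_simps)
      finally have "G (z0 * exp (cj h)) * (z0 ^ N * (exp (cj h) - 1) ^ N) = b * (cj (exp (?d h)) - 1)"
        by (simp only: power_mult_distrib)
      then have e: "G (z0 * exp (cj h)) * (z0 ^ N * (exp (cj h) - 1) ^ N) / b = cj (exp (?d h)) - 1"
        using b by simp
      have "G (z0 * exp (cj h)) * (z0 ^ N * ((exp (cj h) - 1) / cj h) ^ N) / b =
         (G (z0 * exp (cj h)) * (z0 ^ N * (exp (cj h) - 1) ^ N) / b) / cj h ^ N"
        by (simp add: power_divide)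
      also have "\<dots> = (cj (exp (?d h)) - 1) / cj h ^ N" unfolding e ..
      also have "cj \<dots> = q h / h ^ N" by (simp only: cc q_def)
      finally show ?case .
    qed
    ultimately show ?thesis by (rule Lim_transform_eventually)
  qed
  have qne: "\<forall>\<^sub>F h in ?F. q h \<noteq> 0"
    using tendsto_imp_eventually_ne[OF q c] by (auto elim!: eventually_mono)
  have d0: "(?d \<longlongrightarrow> 0) ?F" by (rule psi_increment_tendsto[OF reg_cu])
  have dne: "\<forall>\<^sub>F h in ?F. ?d h \<noteq> 0"
    using qne by (auto elim!: eventually_mono simp: q_def)
  have "((\<lambda>h. (exp (?d h) - 1) / ?d h) \<longlongrightarrow> 1) ?F"
    by (rule filterlim_compose[OF ex1]) (use d0 dne in \<open>auto simp: filterlim_at\<close>)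
  then have "((\<lambda>h. q h / h ^ N / (q h / ?d h)) \<longlongrightarrow> c / 1) ?F"
    by (intro tendsto_divide q) (auto simp: q_def)
  then have lim: "((\<lambda>h. q h / h ^ N / (q h / ?d h)) \<longlongrightarrow> c) ?F" by simp
  have gen: "(a / b) / (a / e) = e / b" if "a \<noteq> 0" for a b e :: complex
    using that by simp
  have "\<forall>\<^sub>F h in ?F. q h / h ^ N / (q h / ?d h) = ?d h / h ^ N"
    by (rule eventually_mono[OF qne]) (rule gen)
  with lim have "((\<lambda>h. ?d h / h ^ N) \<longlongrightarrow> c) ?F" by (rule Lim_transform_eventually)
  then show ?thesis using N c unfolding expansion_def by blast
qed

end

subsection \<open>Sectors in polar coordinates\<close>

text \<open>The angle is measured in units of pi/k, so that \<open>eunit k m\<close> has angle m,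
  the sector Q_j is the interval from j to j + 1, and a full turn is 2 k.\<close>

definition pol :: "nat \<Rightarrow> real \<Rightarrow> real \<Rightarrow> complex" where
  "pol k r \<tau> = of_real r * cis (pi / real k * \<tau>)"

lemma eunit_cis: "eunit k m = cis (pi / real k * of_int m)"
  by (simp add: eunit_def cis_conv_exp mult.commute mult.left_commute)

lemma pol_eunit: "pol k r \<tau> * eunit k m = pol k r (\<tau> + of_int m)"
  by (simp add: pol_def eunit_cis cis_mult distrib_left add_divide_distrib)

lemma norm_pol: "0 < r \<Longrightarrow> cmod (pol k r \<tau>) = r"
  by (simp add: pol_def norm_mult)

lemma pol_nz: "0 < r \<Longrightarrow> pol k r \<tau> \<noteq> 0"
  using norm_pol[of r k \<tau>] by auto

lemma cnj_pol: "cnj (pol k r \<tau>) = pol k r (- \<tau>)"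
  by (simp add: pol_def cis_cnj)

lemma cis_eq_iff: "cis x = cis y \<longleftrightarrow> (\<exists>n::int. x = y + 2 * pi * of_int n)"
  using sin_cos_eq_iff[of x y] by (auto simp: complex_eq_iff)

lemma pol_eq_iff:
  assumes "0 < k" "0 < r" "0 < r'"
  shows "pol k r \<tau> = pol k r' \<tau>' \<longleftrightarrow> r = r' \<and> (\<exists>n::int. \<tau> = \<tau>' + 2 * real k * of_int n)"
proof -
  have "pol k r \<tau> = pol k r' \<tau>' \<longleftrightarrow> r = r' \<and> cis (pi / k * \<tau>) = cis (pi / k * \<tau>')"
    using assms norm_pol[of r k \<tau>] norm_pol[of r' k \<tau>'] by (auto simp: pol_def)
  also have "cis (pi / k * \<tau>) = cis (pi / k * \<tau>') \<longleftrightarrow> (\<exists>n::int. \<tau> = \<tau>' + 2 * real k * of_int n)"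
    unfolding cis_eq_iff
  proof (intro ex_cong1)
    fix n :: int
    have "pi / k * \<tau> = pi / k * \<tau>' + 2 * pi * n \<longleftrightarrow> pi * \<tau> = pi * (\<tau>' + 2 * real k * n)"
      using assms(1) by (simp add: field_simps)
    then show "pi / k * \<tau> = pi / k * \<tau>' + 2 * pi * n \<longleftrightarrow> \<tau> = \<tau>' + 2 * real k * n" by simp
  qed
  finally show ?thesis .
qed

lemma Arg_pol_exists:
  assumes "0 < k" "0 < r"
  obtains n :: int where "Arg (pol k r \<tau>) = pi / k * (\<tau> + 2 * real k * of_int n)"
proof -
  have "pol k r \<tau> = of_real r * cis (Arg (pol k r \<tau>))"
    using rcis_cmod_Arg[of "pol k r \<tau>"] norm_pol[OF assms(2), of k \<tau>] by (simp add: rcis_def)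
  also have "\<dots> = pol k r (k / pi * Arg (pol k r \<tau>))" using assms by (simp add: pol_def)
  finally obtain n :: int where "k / pi * Arg (pol k r \<tau>) = \<tau> + 2 * real k * of_int n"
    using pol_eq_iff[of k r r "k / pi * Arg (pol k r \<tau>)" \<tau>] assms by auto
  then have "Arg (pol k r \<tau>) = pi / k * (\<tau> + 2 * real k * of_int n)"
    using assms by (simp add: field_simps)
  then show ?thesis by (rule that)
qed

lemma Arg_pol_eqI:
  assumes "0 < k" "0 < r" "- real k < \<tau> + 2 * real k * of_int n" "\<tau> + 2 * real k * of_int n \<le> real k"
  shows "Arg (pol k r \<tau>) = pi / k * (\<tau> + 2 * real k * of_int n)"
proof (rule Arg_unique'[OF assms(2)])
  have "pi * (\<tau> + 2 * real k * of_int n) > pi * (- real k)" "pi * (\<tau> + 2 * real k * of_int n) \<le> pi * real k"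
    using assms by (intro mult_strict_left_mono mult_left_mono; simp)+
  then show "pi / k * (\<tau> + 2 * real k * of_int n) \<in> {- pi<..pi}"
    using assms(1) by (simp add: field_simps)
  have "pol k r \<tau> = pol k r (\<tau> + 2 * real k * of_int n)"
    using assms by (subst pol_eq_iff) (auto intro!: exI[of _ "- n"])
  then show "pol k r \<tau> = rcis r (pi / k * (\<tau> + 2 * real k * of_int n))" by (simp add: pol_def rcis_def)
qed

lemma Arg_pol_eq_iff:
  assumes "0 < k" "0 < r" "0 < r'"
  shows "Arg (pol k r \<tau>) = Arg (pol k r' \<tau>') \<longleftrightarrow> (\<exists>n::int. \<tau> = \<tau>' + 2 * real k * of_int n)"
proof -
  have "Arg (pol k r \<tau>) = Arg (pol k r' \<tau>')" if "\<tau> = \<tau>' + 2 * real k * of_int n" for n :: int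
  proof -
    have e: "pol k r' \<tau> = pol k r' \<tau>'" using assms that by (subst pol_eq_iff) auto
    have "Arg (pol k r \<tau>) = Arg (of_real (r / r') * pol k r' \<tau>)"
      using assms by (simp add: pol_def)
    then show ?thesis using assms e by simp
  qed
  moreover have "\<exists>n::int. \<tau> = \<tau>' + 2 * real k * of_int n" if "Arg (pol k r \<tau>) = Arg (pol k r' \<tau>')"
  proof -
    obtain n m :: int where "Arg (pol k r \<tau>) = pi / k * (\<tau> + 2 * real k * of_int n)"
       "Arg (pol k r' \<tau>') = pi / k * (\<tau>' + 2 * real k * of_int m)"
      using Arg_pol_exists assms by metis
    then have "\<tau> + 2 * real k * of_int n = \<tau>' + 2 * real k * of_int m" using that assms(1) by simp
    then show ?thesis by (intro exI[of _ "m - n"]) (simp add: algebra_simps)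
  qed
  ultimately show ?thesis by blast
qed

lemma angle_less: "0 < k \<Longrightarrow> pi / real k * a < pi / real k * b \<longleftrightarrow> a < b"
  "0 < k \<Longrightarrow> pi / real k * a \<le> pi / real k * b \<longleftrightarrow> a \<le> b"
  by (simp_all add: divide_less_cancel divide_le_cancel)

lemma Q_pol:
  assumes "0 < k" "0 < r"
  shows "pol k r \<tau> \<in> Q k j \<longleftrightarrow> (\<exists>n::int. of_int j < \<tau> + 2 * real k * of_int n \<and> \<tau> + 2 * real k * of_int n < of_int j + 1)"
proof -
  let ?\<tau> = "\<tau> - of_int j"
  have e: "pol k r \<tau> * eunit k (- j) = pol k r ?\<tau>" by (simp add: pol_eunit)
  have "pol k r \<tau> \<in> Q k j \<longleftrightarrow> 0 < Arg (pol k r ?\<tau>) \<and> Arg (pol k r ?\<tau>) < pi / k"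
    unfolding Q_def mem_Collect_eq e using pol_nz[OF assms(2)] by simp
  also have "\<dots> \<longleftrightarrow> (\<exists>n::int. 0 < ?\<tau> + 2 * real k * of_int n \<and> ?\<tau> + 2 * real k * of_int n < 1)"
  proof
    assume a: "0 < Arg (pol k r ?\<tau>) \<and> Arg (pol k r ?\<tau>) < pi / k"
    obtain n :: int where n: "Arg (pol k r ?\<tau>) = pi / k * (?\<tau> + 2 * real k * of_int n)"
      using Arg_pol_exists assms by blast
    show "\<exists>n::int. 0 < ?\<tau> + 2 * real k * of_int n \<and> ?\<tau> + 2 * real k * of_int n < 1"
      using a angle_less(1)[OF assms(1), of 0] angle_less(1)[OF assms(1), of _ 1] unfolding n by auto
  next
    assume "\<exists>n::int. 0 < ?\<tau> + 2 * real k * of_int n \<and> ?\<tau> + 2 * real k * of_int n < 1"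
    then obtain n :: int where n: "0 < ?\<tau> + 2 * real k * of_int n" "?\<tau> + 2 * real k * of_int n < 1" by blast
    have k1: "1 \<le> real k" using assms by simp
    have "Arg (pol k r ?\<tau>) = pi / k * (?\<tau> + 2 * real k * of_int n)"
      by (rule Arg_pol_eqI[OF assms]) (use n k1 in linarith)+
    then show "0 < Arg (pol k r ?\<tau>) \<and> Arg (pol k r ?\<tau>) < pi / k"
      using n angle_less(1)[OF assms(1), of 0] angle_less(1)[OF assms(1), of _ 1] by simp
  qed
  also have "\<dots> \<longleftrightarrow> (\<exists>n::int. of_int j < \<tau> + 2 * real k * of_int n \<and> \<tau> + 2 * real k * of_int n < of_int j + 1)"
    by (intro ex_cong1) auto
  finally show ?thesis .
qed

lemma Qtilde_pol:
  assumes "0 < k" "0 < r" "pol k r \<tau> \<in> Qtilde k j"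
  obtains n :: int where "of_int j \<le> \<tau> + 2 * real k * of_int n" "\<tau> + 2 * real k * of_int n < of_int j + 1"
proof -
  let ?\<tau> = "\<tau> - of_int j"
  have e: "pol k r \<tau> * eunit k (- j) = pol k r ?\<tau>" by (simp add: pol_eunit)
  have a: "0 \<le> Arg (pol k r ?\<tau>) \<and> Arg (pol k r ?\<tau>) < pi / k"
    using assms(3) unfolding Qtilde_def mem_Collect_eq e by simp
  obtain n :: int where n: "Arg (pol k r ?\<tau>) = pi / k * (?\<tau> + 2 * real k * of_int n)"
    using Arg_pol_exists assms by blast
  have "0 \<le> ?\<tau> + 2 * real k * of_int n \<and> ?\<tau> + 2 * real k * of_int n < 1"
    using a angle_less(2)[OF assms(1), of 0] angle_less(1)[OF assms(1), of _ 1] unfolding n by auto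
  then show ?thesis using that[of n] by (simp add: algebra_simps)
qed

lemma Qbar_polI:
  assumes "0 < k" "0 < r" "of_int j \<le> \<tau> + 2 * real k * of_int n" "\<tau> + 2 * real k * of_int n \<le> of_int j + 1"
  shows "pol k r \<tau> \<in> Qbar k j"
proof -
  have c: "continuous_on UNIV (pol k r)"
    unfolding pol_def cis_conv_exp by (intro continuous_intros)
  have "pol k r ` closure {of_int j<..<of_int j + 1} \<subseteq> Qbar k j"
  proof (rule image_closure_subset)
    show "pol k r ` {of_int j<..<of_int j + 1} \<subseteq> Qbar k j"
    proof (intro image_subsetI subsetD[OF closure_subset])
      fix a assume "a \<in> {real_of_int j<..<of_int j + 1}"
      then show "pol k r a \<in> Q k j" using assms by (subst Q_pol) (auto intro!: exI[of _ 0])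
    qed
  qed (use c continuous_on_subset in auto)
  moreover have "pol k r \<tau> = pol k r (\<tau> + 2 * real k * of_int n)"
    using assms by (subst pol_eq_iff) (auto intro!: exI[of _ "- n"])
  moreover have "\<tau> + 2 * real k * of_int n \<in> closure {real_of_int j<..<of_int j + 1}"
    using assms by (subst closure_greaterThanLessThan) auto
  ultimately show ?thesis by auto
qed

lemma Qbar_polD:
  assumes k: "2 \<le> k" and r: "0 < r" and Q: "pol k r \<tau> \<in> Qbar k j"
  obtains n :: int where "of_int j \<le> \<tau> + 2 * real k * of_int n" "\<tau> + 2 * real k * of_int n \<le> of_int j + 1"
proof -
  have k0: "0 < k" using k by simp
  \<comment> \<open>The two closed half planes bounded by the sides of the sector; being closed,
    their intersection contains the closure as well.\<close>
  let ?C = "{z. 0 \<le> Im (z * eunit k (- j))} \<inter> {z. Im (z * eunit k (- j - 1)) \<le> 0}"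
  have Im_pol: "Im (pol k r a) = r * sin (pi / k * a)" for r a by (simp add: pol_def)
  have range: "0 \<le> pi / k * a \<and> pi / k * a \<le> pi" if "0 \<le> a" "a \<le> real k" for a :: real
  proof -
    have "pi * a \<le> pi * k" using that by (intro mult_left_mono) auto
    then show ?thesis using that k0 by (simp add: field_simps)
  qed
  have "Q k j \<subseteq> ?C"
  proof
    fix z assume z: "z \<in> Q k j"
    define \<rho> where "\<rho> = cmod z"
    have "z \<noteq> 0" using z by (simp add: Q_def)
    then have \<rho>: "0 < \<rho>" by (simp add: \<rho>_def)
    have zp: "z = pol k \<rho> (k / pi * Arg z)"
      using rcis_cmod_Arg[of z] k0 by (simp add: pol_def \<rho>_def rcis_def)
    then obtain n :: int where n: "of_int j < k / pi * Arg z + 2 * real k * of_int n"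
       "k / pi * Arg z + 2 * real k * of_int n < of_int j + 1"
      using z Q_pol[OF k0 \<rho>] by metis
    define a where "a = k / pi * Arg z + 2 * real k * of_int n - j"
    have za: "z = pol k \<rho> (a + j)"
      unfolding a_def by (subst zp, subst pol_eq_iff) (use k0 \<rho> in \<open>auto intro!: exI[of _ "- n"]\<close>)
    have k2: "2 \<le> real k" using k by simp
    have a: "0 < a" "a < 1" using n by (auto simp: a_def)
    have "0 \<le> sin (pi / k * a)" "0 \<le> sin (pi / k * (1 - a))"
      using range[of a] range[of "1 - a"] a k2 by (intro sin_ge_zero; simp)+
    moreover have "pi / k * (a - 1) = - (pi / k * (1 - a))" by (metis minus_diff_eq mult_minus_right)
    ultimately have "0 \<le> Im (pol k \<rho> a)" "Im (pol k \<rho> (a - 1)) \<le> 0"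
      unfolding Im_pol using \<rho> by (auto simp: mult_le_0_iff simp del: minus_mult_right)
    then show "z \<in> ?C" unfolding za Int_iff mem_Collect_eq pol_eunit by (simp add: algebra_simps)
  qed
  moreover have "closed ?C" by (intro closed_Int closed_Collect_le continuous_intros)
  ultimately have "pol k r \<tau> \<in> ?C" using Q closure_minimal by blast
  then have im: "0 \<le> Im (pol k r (\<tau> - j))" "Im (pol k r (\<tau> - j - 1)) \<le> 0"
    unfolding Int_iff mem_Collect_eq pol_eunit by (simp_all add: algebra_simps)
  obtain n :: int where n: "Arg (pol k r (\<tau> - j)) = pi / k * (\<tau> - j + 2 * real k * of_int n)"
    using Arg_pol_exists k0 r by blast
  define a where "a = \<tau> - j + 2 * real k * of_int n"
  have "0 \<le> Arg (pol k r (\<tau> - j))" using im(1) Arg_less_0 by blast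
  then have a0: "0 \<le> a" unfolding n a_def[symmetric] using angle_less(2)[OF k0, of 0 a] by simp
  have "Arg (pol k r (\<tau> - j)) \<le> pi / k * k" using Arg_le_pi k0 by simp
  then have ak: "a \<le> k" unfolding n a_def[symmetric] angle_less(2)[OF k0] .
  \<comment> \<open>An angle beyond 1 would put a - 1 strictly between 0 and k, where the second
    half plane is violated.\<close>
  have "a \<le> 1"
  proof (rule ccontr)
    assume "\<not> a \<le> 1"
    then have a1: "0 < a - 1" "a - 1 < k" using ak by auto
    have "pi * (a - 1) < pi * k" using a1 by (intro mult_strict_left_mono) auto
    then have "0 < pi / k * (a - 1)" "pi / k * (a - 1) < pi" using a1 k0 by (simp_all add: field_simps)
    then have "0 < sin (pi / k * (a - 1))" by (rule sin_gt_zero)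
    moreover have "pol k r (\<tau> - j - 1) = pol k r (a - 1)"
      unfolding a_def by (subst pol_eq_iff) (use k0 r in \<open>auto intro!: exI[of _ "- n"]\<close>)
    ultimately show False using im(2) mult_pos_pos[OF r] Im_pol[of r "a - 1"] by (metis not_le)
  qed
  then show ?thesis using that[of n] a0 by (simp add: a_def)
qed

lemma pol_power: "0 < k \<Longrightarrow> pol k r \<tau> ^ k = of_real (r ^ k) * cis (pi * \<tau>)"
  by (simp add: pol_def power_mult_distrib Complex.DeMoivre)

lemma Im_pol_power:
  assumes "0 < k" "0 < r"
  shows "Im (pol k r \<tau> ^ k) = 0 \<longleftrightarrow> \<tau> \<in> \<int>"
proof -
  have "Im (pol k r \<tau> ^ k) = 0 \<longleftrightarrow> sin (pi * \<tau>) = 0"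
    using assms by (simp add: pol_power flip: of_real_power)
  also have "\<dots> \<longleftrightarrow> \<tau> \<in> \<int>"
    by (auto simp: sin_zero_iff_int2 Ints_def mult.commute)
  finally show ?thesis .
qed

lemma neg_real_pol_power:
  assumes "0 < k" "0 < r"
  shows "neg_real (pol k r (of_int n) ^ k) \<longleftrightarrow> odd n"
proof -
  have "cos (pi * of_int n) = (if even n then 1 else -1)" "sin (pi * of_int n) = 0"
    using cos_int_times_real[of n] by (auto simp: mult.commute sin_int_times_real cos_npi_int)
  then show ?thesis using assms by (auto simp: neg_real_def pol_power simp flip: of_real_power)
qed

lemma neg_real_imp_Im: "neg_real z \<Longrightarrow> Im z = 0"
  by (simp add: neg_real_def)

lemma Im_pol_eq_0:
  assumes "0 < k" "0 < r"
  shows "Im (pol k r \<tau>) = 0 \<longleftrightarrow> (\<exists>n::int. \<tau> = real k * of_int n)"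
proof -
  have "Im (pol k r \<tau>) = 0 \<longleftrightarrow> sin (pi / k * \<tau>) = 0" using assms by (simp add: pol_def)
  also have "\<dots> \<longleftrightarrow> (\<exists>n::int. pi / k * \<tau> = of_int n * pi)" by (simp add: sin_zero_iff_int2)
  also have "\<dots> \<longleftrightarrow> (\<exists>n::int. \<tau> = real k * of_int n)"
    using assms by (intro ex_cong1) (auto simp: field_simps)
  finally show ?thesis .
qed

lemma pos_real_pol:
  assumes "0 < k" "0 < r"
  shows "pos_real (pol k r \<tau>) \<longleftrightarrow> (\<exists>n::int. \<tau> = 2 * real k * of_int n)"
proof
  assume "pos_real (pol k r \<tau>)"
  then have "Im (pol k r \<tau>) = 0" "0 < Re (pol k r \<tau>)" by (auto simp: pos_real_def)
  then have "pol k r \<tau> = of_real (Re (pol k r \<tau>))" "0 < Re (pol k r \<tau>)" by (auto simp: complex_eq_iff)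
  then have "pol k r \<tau> = pol k (Re (pol k r \<tau>)) 0" "0 < Re (pol k r \<tau>)" by (auto simp: pol_def)
  then show "\<exists>n::int. \<tau> = 2 * real k * of_int n"
    using pol_eq_iff[of k r "Re (pol k r \<tau>)" \<tau> 0] assms by auto
next
  assume "\<exists>n::int. \<tau> = 2 * real k * of_int n"
  then have "pol k r \<tau> = pol k r 0" using pol_eq_iff[of k r r \<tau> 0] assms by auto
  then show "pos_real (pol k r \<tau>)" using assms by (simp add: pol_def pos_real_def)
qed

subsection \<open>Crossing levels on an abstract curve\<close>

text \<open>The curve meets the circle of radius \<open>exp s\<close> at the angle \<open>\<theta> s\<close> with argument \<open>B s\<close>, both in units
  of \<open>\<pi>/k\<close>; \<open>Z\<close> is the set of logarithmic radii at which the modulus has the prescribed value.\<close>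

locale zero_curve =
  fixes k :: nat and p :: int and t0 :: real and \<theta> B :: "real \<Rightarrow> real" and Z :: "real set"
    and H :: "complex \<Rightarrow> complex"
  assumes k2: "2 \<le> k" and cop: "coprime p (int k)"
    and theta: "0 \<le> \<theta> s" "\<theta> s \<le> 1"
    and mono: "s \<le> s' \<Longrightarrow> B s \<le> B s'"
    and flat: "s < s' \<Longrightarrow> B s = B s' \<Longrightarrow> \<theta> s = \<theta> s' \<and> \<theta> s \<in> {0, 1}"
    and val0: "\<theta> s = 0 \<Longrightarrow> \<exists>n::nat. B s = real k * real n"
    and val1: "\<theta> s = 1 \<Longrightarrow> \<exists>n::nat. B s = of_int p + real k * real n"
    and lev: "a < b \<Longrightarrow> B a \<le> \<mu> \<Longrightarrow> \<mu> \<le> B b \<Longrightarrow> B a \<noteq> B b \<Longrightarrow> \<exists>s\<in>Z. a \<le> s \<and> s \<le> b \<and> B s = \<mu>"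
    and zplus: "H (pol k (exp s) (2 * of_int m + \<theta> s)) = 0 \<longleftrightarrow>
       s \<in> Z \<and> (\<exists>n::int. B s = t0 + 2 * of_int n \<and> [p * m = - n] (mod int k))"
    and zminus: "H (pol k (exp s) (2 * of_int m - \<theta> s)) = 0 \<longleftrightarrow>
       s \<in> Z \<and> (\<exists>n::int. B s = - t0 + 2 * of_int n \<and> [p * m = n] (mod int k))"
    and zform: "H z = 0 \<Longrightarrow> \<exists>s (m::int). z = pol k (exp s) (2 * of_int m + \<theta> s) \<or> z = pol k (exp s) (2 * of_int m - \<theta> s)"
    and order_in: "H z = 0 \<Longrightarrow> cmod z = exp s \<Longrightarrow> 0 < \<theta> s \<Longrightarrow> \<theta> s < 1 \<Longrightarrow> zorder H z = 1"
    and order_bd: "H z = 0 \<Longrightarrow> cmod z = exp s \<Longrightarrow> \<theta> s \<in> {0, 1} \<Longrightarrow>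
       zorder H z = 1 \<and> (\<exists>a>s. B a = B s) \<and> (\<forall>a<s. B a \<noteq> B s) \<or>
       zorder H z = 1 \<and> (\<exists>a<s. B a = B s) \<and> (\<forall>a>s. B a \<noteq> B s) \<or>
       zorder H z = 2 \<and> (\<forall>a. a \<noteq> s \<longrightarrow> B a \<noteq> B s)"
    and start: "\<exists>s0. \<forall>s\<le>s0. s \<notin> Z \<and> B s = (if 0 < p then 0 else of_int p)"
    and growth1: "p = 1 \<Longrightarrow> \<exists>s\<ge>a. \<not> (\<theta> s = 1 \<and> B s = 1)"
    and growth2: "p = - 1 \<Longrightarrow> \<exists>s\<ge>a. \<not> (\<theta> s = 0 \<and> B s = 0)"
begin

abbreviation pls :: "real \<Rightarrow> int \<Rightarrow> complex" where "pls s m \<equiv> pol k (exp s) (2 * of_int m + \<theta> s)"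
abbreviation mns :: "real \<Rightarrow> int \<Rightarrow> complex" where "mns s m \<equiv> pol k (exp s) (2 * of_int m - \<theta> s)"

lemma k0: "0 < k" using k2 by simp

lemma p_cancel: "[p * a = p * b] (mod int k) \<longleftrightarrow> [a = b] (mod int k)"
  using cop by (rule cong_mult_lcancel)

lemma p_solve: "\<exists>m. [p * m = n] (mod int k)"
proof -
  obtain x where "[p * x = 1] (mod int k)" using cong_solve_coprime_int[OF cop] by blast
  then have "[p * x * n = 1 * n] (mod int k)" by (rule cong_scalar_right)
  then show ?thesis by (intro exI[of _ "x * n"]) (simp add: mult.assoc)
qed

lemma cong_kD: "[a = b] (mod int k) \<Longrightarrow> \<exists>N::int. real_of_int a = of_int b + real k * of_int N"
proof -
  assume "[a = b] (mod int k)"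
  then have "[b = a] (mod int k)" by (rule cong_sym)
  then obtain N where "a = b + int k * N" by (auto simp: cong_iff_lin)
  then show ?thesis by (intro exI[of _ N]) simp
qed

lemma cong_kI: "real_of_int a = of_int b + real k * of_int N \<Longrightarrow> [a = b] (mod int k)"
proof -
  assume "real_of_int a = of_int b + real k * of_int N"
  then have "real_of_int a = of_int (b + int k * N)" by simp
  then have "a = b + int k * N" by (simp only: of_int_eq_iff)
  then have "[b = a] (mod int k)" by (auto simp: cong_iff_lin)
  then show ?thesis by (rule cong_sym)
qed

lemma pol_2_cong: "[m = m'] (mod int k) \<Longrightarrow> pol k (exp s) (2 * of_int m + a) = pol k (exp s) (2 * of_int m' + a)"
  using cong_kD[of m m'] by (subst pol_eq_iff) (auto simp: k0 algebra_simps)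

lemma pls_cong: "[m = m'] (mod int k) \<Longrightarrow> pls s m = pls s m'"
  by (rule pol_2_cong)

lemma mns_cong: "[m = m'] (mod int k) \<Longrightarrow> mns s m = mns s m'"
  using pol_2_cong[of m m' s "- \<theta> s"] by simp

definition rad :: "complex \<Rightarrow> real" where "rad z = ln (cmod z)"

lemma rad_pol [simp]: "rad (pol k (exp s) \<tau>) = s"
  by (simp add: rad_def norm_pol)

lemma zero_nz: "H z = 0 \<Longrightarrow> z \<noteq> 0"
  using zform pol_nz by (metis exp_gt_zero)

lemma cmod_rad: "H z = 0 \<Longrightarrow> cmod z = exp (rad z)"
  using zero_nz by (simp add: rad_def)

lemma cmod_less_rad: "H z = 0 \<Longrightarrow> H v = 0 \<Longrightarrow> cmod z < cmod v \<longleftrightarrow> rad z < rad v"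
  and cmod_le_rad: "H z = 0 \<Longrightarrow> H v = 0 \<Longrightarrow> cmod z \<le> cmod v \<longleftrightarrow> rad z \<le> rad v"
  and cmod_eq_rad: "H z = 0 \<Longrightarrow> H v = 0 \<Longrightarrow> cmod z = cmod v \<longleftrightarrow> rad z = rad v"
  by (simp_all add: cmod_rad)

lemma zero_cases:
  assumes "H z = 0"
  obtains (plus) m n where "z = pls (rad z) m" "rad z \<in> Z" "B (rad z) = t0 + 2 * of_int n" "[p * m = - n] (mod int k)"
  | (minus) m n where "z = mns (rad z) m" "rad z \<in> Z" "B (rad z) = - t0 + 2 * of_int n" "[p * m = n] (mod int k)"
proof -
  obtain s m where "z = pls s m \<or> z = mns s m" using zform[OF assms] by blast
  then show ?thesis
  proof
    assume z: "z = pls s m"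
    then show ?thesis using assms zplus[of s m] plus[of m] by auto
  next
    assume z: "z = mns s m"
    then show ?thesis using assms zminus[of s m] minus[of m] by auto
  qed
qed

definition Lev :: "real set" where
  "Lev = {\<mu>. \<exists>n::int. \<mu> = t0 + 2 * of_int n \<or> \<mu> = - t0 + 2 * of_int n}"

lemma zero_Lev: "H z = 0 \<Longrightarrow> rad z \<in> Z \<and> B (rad z) \<in> Lev"
  by (elim zero_cases) (auto simp: Lev_def)

lemma Lev_zero:
  assumes "s \<in> Z" "B s \<in> Lev" obtains z where "H z = 0" "rad z = s"
proof -
  obtain n :: int where "B s = t0 + 2 * of_int n \<or> B s = - t0 + 2 * of_int n"
    using assms(2) by (auto simp: Lev_def)
  then show ?thesis
  proof
    assume "B s = t0 + 2 * of_int n"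
    then show ?thesis using that[of "pls s _"] p_solve[of "- n"] zplus assms(1) rad_pol by metis
  next
    assume "B s = - t0 + 2 * of_int n"
    then show ?thesis using that[of "mns s _"] p_solve[of n] zminus assms(1) rad_pol by metis
  qed
qed

text \<open>On at least one side of a boundary zero \<open>order_bd\<close> makes the argument leave
  its level, so a plateau of \<open>B\<close> has no zero in its interior.\<close>

lemma between:
  assumes "H z = 0" "a < rad z" "rad z < b" "B a = B b"
  shows False
proof -
  have e: "B a = B (rad z)" "B b = B (rad z)"
    using mono[of a "rad z"] mono[of "rad z" b] assms by auto
  have "\<theta> (rad z) \<in> {0, 1}" using flat[OF assms(2)] e by auto
  from order_bd[OF assms(1) cmod_rad[OF assms(1)] this] show False
    using e assms by auto
qed

lemma next_rad: "next_zero H z v \<Longrightarrow> H z = 0 \<and> H v = 0 \<and> rad z < rad v"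
  by (auto simp: next_zero_def cmod_less_rad)

lemma next_no_between: "next_zero H z v \<Longrightarrow> H u = 0 \<Longrightarrow> rad z < rad u \<Longrightarrow> rad u < rad v \<Longrightarrow> False"
  using cmod_less_rad unfolding next_zero_def by blast

text \<open>By \<open>lev\<close> a level strictly in between is attained at a radius in
  \<open>Z\<close>, which carries a zero lying between the two.\<close>

lemma next_no_level:
  assumes "next_zero H z v" "\<mu> \<in> Lev" "B (rad z) < \<mu>" "\<mu> < B (rad v)"
  shows False
proof -
  have r: "rad z < rad v" using next_rad[OF assms(1)] by blast
  obtain s where s: "s \<in> Z" "rad z \<le> s" "s \<le> rad v" "B s = \<mu>"
    using lev[OF r, of \<mu>] assms by auto
  have "rad z \<noteq> s" "s \<noteq> rad v" using s assms by auto
  then have "rad z < s" "s < rad v" using s by auto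
  moreover obtain u where "H u = 0" "rad u = s" using Lev_zero s assms(2) by metis
  ultimately show False using next_no_between[OF assms(1)] by blast
qed

section \<open>Non-integral levels\<close>

lemma bd_int: "\<theta> s \<in> {0, 1} \<Longrightarrow> B s \<in> \<int>"
  using val0[of s] val1[of s] by auto

text \<open>On an edge \<open>B\<close> is an integer, while at a zero it is t0 or -t0 plus an even
  integer.\<close>

lemma inner_of_nonint:
  assumes "t0 \<notin> \<int>" "H z = 0"
  shows "0 < \<theta> (rad z) \<and> \<theta> (rad z) < 1"
proof (rule ccontr)
  assume "\<not> ?thesis"
  then have "\<theta> (rad z) \<in> {0, 1}" using theta[of "rad z"] by auto
  then have i: "B (rad z) \<in> \<int>" by (rule bd_int)
  have "t0 \<in> \<int>"
    using assms(2)
  proof (cases rule: zero_cases)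
    case (plus m n)
    then have "t0 = B (rad z) - of_int (2 * n)" by simp
    then show ?thesis using i by simp
  next
    case (minus m n)
    then have "t0 = of_int (2 * n) - B (rad z)" by simp
    then show ?thesis using i by (metis Ints_diff Ints_of_int)
  qed
  then show False using assms(1) by simp
qed

lemma nonint_simple: "t0 \<notin> \<int> \<Longrightarrow> H z = 0 \<Longrightarrow> zorder H z = 1"
  using inner_of_nonint order_in cmod_rad by blast

lemma nonint_Im_power:
  assumes "t0 \<notin> \<int>" "H z = 0"
  shows "Im (z ^ k) \<noteq> 0"
proof
  assume i: "Im (z ^ k) = 0"
  have t: "0 < \<theta> (rad z) \<and> \<theta> (rad z) < 1" by (rule inner_of_nonint[OF assms])
  have "\<theta> (rad z) \<in> \<int>"
    using assms(2)
  proof (cases rule: zero_cases)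
    case (plus m n)
    then have "2 * of_int m + \<theta> (rad z) \<in> \<int>" using i Im_pol_power[OF k0] by (metis exp_gt_zero)
    then have "2 * of_int m + \<theta> (rad z) - of_int (2 * m) \<in> \<int>" by (intro Ints_diff) auto
    then show ?thesis by simp
  next
    case (minus m n)
    then have "2 * of_int m - \<theta> (rad z) \<in> \<int>" using i Im_pol_power[OF k0] by (metis exp_gt_zero)
    then have "of_int (2 * m) - (2 * of_int m - \<theta> (rad z)) \<in> \<int>" by (intro Ints_diff) auto
    then show ?thesis by simp
  qed
  then obtain N :: int where "\<theta> (rad z) = of_int N" by (auto elim: Ints_cases)
  then have "0 < N" "N < 1" using t by auto
  then show False by simp
qed

text \<open>Equal radii mean equal values of \<open>B\<close>. Within one family this gives the same
  n and thus the same index modulo k; across the families it would make t0 an integer.\<close>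

lemma nonint_distinct_radius:
  assumes "t0 \<notin> \<int>" "H z = 0" "H v = 0" "rad z = rad v"
  shows "z = v"
  using assms(2)
proof (cases rule: zero_cases)
  case (plus m n)
  note z = this
  show ?thesis using assms(3)
  proof (cases rule: zero_cases)
    case (plus m' n')
    then have "n = n'" using z assms(4) by simp
    then have "[p * m = p * m'] (mod int k)" using z(4) plus(4) cong_sym cong_trans by blast
    then have "[m = m'] (mod int k)" by (simp add: p_cancel)
    then show ?thesis using pls_cong z(1) plus(1) assms(4) by metis
  next
    case (minus m' n')
    then have "t0 = of_int (n' - n)" using z assms(4) by simp
    then show ?thesis using assms(1) by simp
  qed
next
  case (minus m n)
  note z = this
  show ?thesis using assms(3)
  proof (cases rule: zero_cases)
    case (minus m' n')
    then have "n = n'" using z assms(4) by simp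
    then have "[p * m = p * m'] (mod int k)" using z(4) minus(4) cong_sym cong_trans by blast
    then have "[m = m'] (mod int k)" by (simp add: p_cancel)
    then show ?thesis using mns_cong z(1) minus(1) assms(4) by metis
  next
    case (plus m' n')
    then have "t0 = of_int (n - n')" using z assms(4) by simp
    then show ?thesis using assms(1) by simp
  qed
qed

lemma next_B_less:
  assumes "next_zero H z v" "0 < \<theta> (rad z)" "\<theta> (rad z) < 1"
  shows "B (rad z) < B (rad v)"
proof -
  have r: "rad z < rad v" using next_rad[OF assms(1)] by blast
  have "B (rad z) \<noteq> B (rad v)" using flat[OF r] assms by auto
  then show ?thesis using mono[of "rad z" "rad v"] r by simp
qed

lemma nonint_next_plus:
  assumes nz: "next_zero H z v" and z: "z = pls (rad z) m" "B (rad z) = t0 + 2 * of_int n"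
    and q: "of_int (2 * q - \<kappa>) < t0" "t0 < of_int (2 * q - \<kappa>) + 1" and t0: "t0 \<notin> \<int>"
  shows "\<exists>l. v = mns (rad v) l \<and> [p * l = n + 2 * q + 1 - \<kappa>] (mod int k)"
proof -
  have zv: "H z = 0" "H v = 0" using next_rad[OF nz] by auto
  have lt: "B (rad z) < B (rad v)" using next_B_less[OF nz] inner_of_nonint[OF t0 zv(1)] by blast
  \<comment> \<open>The two families of levels alternate. This is the level of the other family that
    comes next: its distance 2 (2 q - \<kappa> + 1 - t0) from the present one lies between 0 and
    2.\<close>
  define n' where "n' = n + 2 * q + 1 - \<kappa>"
  have L: "- t0 + 2 * of_int n' \<in> Lev" by (auto simp: Lev_def)
  have g: "B (rad z) < - t0 + 2 * of_int n'" "- t0 + 2 * of_int n' < t0 + 2 * of_int (n + 1)"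
    using z q by (auto simp: n'_def)
  have nl: "\<not> - t0 + 2 * of_int n' < B (rad v)" using next_no_level[OF nz L g(1)] by blast
  show ?thesis using zv(2)
  proof (cases rule: zero_cases)
    case (plus l n1)
    then have "n + 1 \<le> n1" using lt z by simp
    then have "t0 + 2 * of_int (n + 1) \<le> B (rad v)" using plus by simp
    then show ?thesis using g nl by linarith
  next
    case (minus l n1)
    have "n1 \<le> n'" using nl minus by simp
    moreover have "\<not> n1 \<le> n' - 1"
    proof
      assume "n1 \<le> n' - 1"
      then have "real_of_int n1 \<le> real_of_int (n' - 1)" by (simp only: of_int_le_iff)
      then show False using lt minus(3) z q by (simp add: n'_def)
    qed
    ultimately have "n1 = n'" by simp
    then show ?thesis using minus unfolding n'_def by blast
  qed
qed

lemma nonint_next_minus: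
  assumes nz: "next_zero H z v" and z: "z = mns (rad z) m" "B (rad z) = - t0 + 2 * of_int n"
    and q: "of_int (2 * q - \<kappa>) < t0" "t0 < of_int (2 * q - \<kappa>) + 1" and t0: "t0 \<notin> \<int>"
  shows "\<exists>l. v = pls (rad v) l \<and> [p * l = - (n - 2 * q + \<kappa>)] (mod int k)"
proof -
  have zv: "H z = 0" "H v = 0" using next_rad[OF nz] by auto
  have lt: "B (rad z) < B (rad v)" using next_B_less[OF nz] inner_of_nonint[OF t0 zv(1)] by blast
  \<comment> \<open>Here the distance to the next level of the other family is 2 (t0 - 2 q +
    \<kappa>), again between 0 and 2.\<close>
  define n' where "n' = n - 2 * q + \<kappa>"
  have L: "t0 + 2 * of_int n' \<in> Lev" by (auto simp: Lev_def)
  have g: "B (rad z) < t0 + 2 * of_int n'" "t0 + 2 * of_int n' < - t0 + 2 * of_int (n + 1)"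
    using z q by (auto simp: n'_def)
  have nl: "\<not> t0 + 2 * of_int n' < B (rad v)" using next_no_level[OF nz L g(1)] by blast
  show ?thesis using zv(2)
  proof (cases rule: zero_cases)
    case (minus l n1)
    then have "n + 1 \<le> n1" using lt z by simp
    then have "- t0 + 2 * of_int (n + 1) \<le> B (rad v)" using minus by simp
    then show ?thesis using g nl by linarith
  next
    case (plus l n1)
    have "n1 \<le> n'" using nl plus by simp
    moreover have "\<not> n1 \<le> n' - 1"
    proof
      assume "n1 \<le> n' - 1"
      then have "real_of_int n1 \<le> real_of_int (n' - 1)" by (simp only: of_int_le_iff)
      then show False using lt plus(3) z q by (simp add: n'_def)
    qed
    ultimately have "n1 = n'" by simp
    then show ?thesis using plus unfolding n'_def by blast
  qed
qed

lemma pls_Q_D: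
  assumes "pls s m \<in> Q k j"
  obtains N where "2 * m + 2 * int k * N = j" "0 < \<theta> s" "\<theta> s < 1"
proof -
  obtain N :: int where N: "of_int j < 2 * of_int m + \<theta> s + 2 * real k * of_int N"
     "2 * of_int m + \<theta> s + 2 * real k * of_int N < of_int j + 1"
    using assms Q_pol[OF k0] by auto
  have e: "2 * real_of_int m + 2 * real k * of_int N = of_int (2 * m + 2 * int k * N)" by simp
  have "real_of_int (2 * m + 2 * int k * N) < of_int (j + 1)" "real_of_int (j - 1) < of_int (2 * m + 2 * int k * N)"
    using N theta[of s] unfolding e[symmetric] by simp_all
  then have eq: "2 * m + 2 * int k * N = j" unfolding of_int_less_iff by linarith
  have "2 * real_of_int m + 2 * real k * of_int N = of_int (j)" unfolding e eq ..
  then have "0 < \<theta> s" "\<theta> s < 1" using N by simp_all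
  with eq show ?thesis using that by blast
qed

lemma mns_Q_D:
  assumes "mns s m \<in> Q k j"
  obtains N where "2 * m + 2 * int k * N = j + 1" "0 < \<theta> s" "\<theta> s < 1"
proof -
  obtain N :: int where N: "of_int j < 2 * of_int m - \<theta> s + 2 * real k * of_int N"
     "2 * of_int m - \<theta> s + 2 * real k * of_int N < of_int j + 1"
    using assms Q_pol[OF k0] by auto
  have e: "2 * real_of_int m + 2 * real k * of_int N = of_int (2 * m + 2 * int k * N)" by simp
  have "real_of_int (2 * m + 2 * int k * N) < of_int (j + 2)" "real_of_int j < of_int (2 * m + 2 * int k * N)"
    using N theta[of s] unfolding e[symmetric] by simp_all
  then have eq: "2 * m + 2 * int k * N = j + 1" unfolding of_int_less_iff by linarith
  have "2 * real_of_int m + 2 * real k * of_int N = of_int (j + 1)" unfolding e eq ..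
  then have "0 < \<theta> s" "\<theta> s < 1" using N by simp_all
  with eq show ?thesis using that by blast
qed

lemma pls_Q_I: "0 < \<theta> s \<Longrightarrow> \<theta> s < 1 \<Longrightarrow> [m = m'] (mod int k) \<Longrightarrow> pls s m \<in> Q k (2 * m')"
  using Q_pol[OF k0, of "exp s" "2 * of_int m' + \<theta> s" "2 * m'"] pls_cong[of m m' s]
  by (auto intro!: exI[of _ 0])

lemma mns_Q_I: "0 < \<theta> s \<Longrightarrow> \<theta> s < 1 \<Longrightarrow> [m = m'] (mod int k) \<Longrightarrow> mns s m \<in> Q k (2 * m' - 1)"
  using Q_pol[OF k0, of "exp s" "2 * of_int m' - \<theta> s" "2 * m' - 1"] mns_cong[of m m' s]
  by (auto intro!: exI[of _ 0])

lemma half_cong: "2 * m + 2 * int k * N = 2 * m' \<Longrightarrow> [m = m'] (mod int k)"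
  unfolding cong_iff_lin by (rule exI[of _ N]) simp

text \<open>Plus zeros lie in even sectors and minus zeros in odd ones, so \<sigma> tells the family
  of z and the next zero belongs to the other. Adding the congruences for l and m eliminates the
  level number n.\<close>

lemma nonint_next:
  assumes nz: "next_zero H z v" and \<sigma>: "\<sigma> \<in> {0, 1}" and zQ: "z \<in> Q k (2 * m - \<sigma>)"
    and q: "of_int (2 * q - \<kappa>) \<le> t0" "t0 < of_int (2 * q - \<kappa>) + 1" and t0: "t0 \<notin> \<int>"
  shows "\<exists>l. [p * (l + m) = 2 * q + 1 - \<kappa> - \<sigma>] (mod int k) \<and> v \<in> Q k (2 * l - 1 + \<sigma>)"
proof -
  have q': "of_int (2 * q - \<kappa>) < t0" using q(1) t0 by (metis Ints_of_int order_le_less)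
  have zv: "H z = 0" "H v = 0" using next_rad[OF nz] by auto
  note iv = inner_of_nonint[OF t0 zv(2)]
  show ?thesis using zv(1)
  proof (cases rule: zero_cases)
    case (plus m' n)
    obtain l where l: "v = mns (rad v) l" "[p * l = n + 2 * q + 1 - \<kappa>] (mod int k)"
      using nonint_next_plus[OF nz plus(1,3) q' q(2) t0] by blast
    have "pls (rad z) m' \<in> Q k (2 * m - \<sigma>)" using zQ plus(1) by simp
    then obtain N where N: "2 * m' + 2 * int k * N = 2 * m - \<sigma>"
      by (elim pls_Q_D) auto
    have s0: "\<sigma> = 0"
    proof (rule ccontr)
      assume "\<sigma> \<noteq> 0"
      then have "\<sigma> = 1" using \<sigma> by auto
      then have "2 * (m' + int k * N) = 2 * m - 1" using N by (simp add: algebra_simps)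
      then show False by presburger
    qed
    have "[m' = m] (mod int k)" using N s0 by (intro half_cong) auto
    then have "[p * m = - n] (mod int k)" using plus(4) p_cancel cong_sym cong_trans by meson
    from cong_add[OF l(2) this] have "[p * (l + m) = 2 * q + 1 - \<kappa>] (mod int k)"
      by (simp add: algebra_simps)
    moreover have "v \<in> Q k (2 * l - 1)" using mns_Q_I[of "rad v" l l] iv l(1) by simp
    ultimately show ?thesis using s0 by auto
  next
    case (minus m' n)
    obtain l where l: "v = pls (rad v) l" "[p * l = - (n - 2 * q + \<kappa>)] (mod int k)"
      using nonint_next_minus[OF nz minus(1,3) q' q(2) t0] by blast
    have "mns (rad z) m' \<in> Q k (2 * m - \<sigma>)" using zQ minus(1) by simp
    then obtain N where N: "2 * m' + 2 * int k * N = 2 * m - \<sigma> + 1"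
      by (elim mns_Q_D) auto
    have s0: "\<sigma> = 1"
    proof (rule ccontr)
      assume "\<sigma> \<noteq> 1"
      then have "\<sigma> = 0" using \<sigma> by auto
      then have "2 * (m' + int k * N) = 2 * m + 1" using N by (simp add: algebra_simps)
      then show False by presburger
    qed
    have "[m' = m] (mod int k)" using N s0 by (intro half_cong) auto
    then have "[p * m = n] (mod int k)" using minus(4) p_cancel cong_sym cong_trans by meson
    from cong_add[OF l(2) this] have "[p * (l + m) = 2 * q + 1 - \<kappa> - 1] (mod int k)"
      by (simp add: algebra_simps)
    moreover have "v \<in> Q k (2 * l)" using pls_Q_I[of "rad v" l l] iv l(1) by simp
    ultimately show ?thesis using s0 by auto
  qed
qed

end

subsection \<open>Integral levels\<close>

context zero_curve begin

text \<open>The level t0 + 2 n is also -t0 + 2 (n + \<tau>) when t0 = \<tau>. The plus zero of index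
  m is thereby paired with the minus zero of index -m - S.\<close>

lemma cong_neg_solve:
  assumes "[p * m = - n] (mod int k)" "[p * S = - \<tau>] (mod int k)"
  shows "[p * (- m - S) = n + \<tau>] (mod int k)"
proof -
  have "[- (p * m) - p * S = - (- n) - (- \<tau>)] (mod int k)"
    by (intro cong_diff assms cong_minus_minus_iff[THEN iffD2])
  then show ?thesis by (simp add: algebra_simps)
qed

lemma cong_neg_solve':
  assumes "[p * m = n] (mod int k)" "[p * S = - \<tau>] (mod int k)"
  shows "[p * (- m - S) = - (n - \<tau>)] (mod int k)"
  using cong_neg_solve[of m "- n" S \<tau>] assms by simp

end

text \<open>The situation in which \<alpha>^k is real. \<open>S\<close> is the s of the theorem:
  \<open>star\<close> reflects in the line at angle -S, and the congruence makes this reflection a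
  symmetry of the zero set.\<close>

locale zero_curve_int = zero_curve +
  fixes \<tau> S :: int
  assumes t0: "t0 = of_int \<tau>" and S: "[p * S = - \<tau>] (mod int k)"
begin

definition star :: "complex \<Rightarrow> complex" where "star z = cnj z * eunit k (- 2 * S)"

lemma star_pls: "star (pls s m) = mns s (- m - S)"
  and star_mns: "star (mns s m) = pls s (- m - S)"
  unfolding star_def cnj_pol pol_eunit by (rule arg_cong[where f = "pol k (exp s)"], simp)+

lemma zero_pair:
  assumes "H z = 0"
  obtains m n where "rad z \<in> Z" "B (rad z) = t0 + 2 * of_int n" "[p * m = - n] (mod int k)"
    "z = pls (rad z) m \<or> z = mns (rad z) (- m - S)"
  using assms
proof (cases rule: zero_cases)
  case (plus m n)
  then show ?thesis using that by blast
next
  case (minus m n)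
  have m: "z = mns (rad z) (- (- m - S) - S)" using minus(1) by simp
  have "B (rad z) = t0 + 2 * of_int (n - \<tau>)" using minus by (simp add: t0)
  then show ?thesis using that[of "n - \<tau>" "- m - S"] minus cong_neg_solve'[OF minus(4) S] m by blast
qed

lemma pair_zero:
  assumes "s \<in> Z" "B s = t0 + 2 * of_int n" "[p * m = - n] (mod int k)"
  shows "H (pls s m) = 0" "H (mns s (- m - S)) = 0"
proof -
  show "H (pls s m) = 0" using assms zplus by blast
  have "B s = - t0 + 2 * of_int (n + \<tau>)" using assms t0 by simp
  then show "H (mns s (- m - S)) = 0" using assms(1) cong_neg_solve[OF assms(3) S] zminus by blast
qed

lemma pair_unique:
  assumes "H z = 0" "B (rad z) = t0 + 2 * of_int n" "[p * m = - n] (mod int k)"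
  shows "z = pls (rad z) m \<or> z = mns (rad z) (- m - S)"
  using assms(1)
proof (cases rule: zero_pair)
  case (1 m' n')
  then have "n' = n" using assms(2) by simp
  then have "[p * m' = p * m] (mod int k)" using 1 assms(3) cong_sym cong_trans by blast
  then have c: "[m' = m] (mod int k)" by (simp add: p_cancel)
  then have "[- m' - S = - m - S] (mod int k)"
    by (intro cong_diff cong_refl) (simp add: cong_minus_minus_iff)
  then show ?thesis using 1(4) pls_cong[OF c] mns_cong by metis
qed

lemma zeros_of_radius:
  assumes "H z = 0"
  shows "{v. H v = 0 \<and> cmod v = cmod z} = {z, star z}"
proof -
  obtain m n where mn: "rad z \<in> Z" "B (rad z) = t0 + 2 * of_int n" "[p * m = - n] (mod int k)"
    "z = pls (rad z) m \<or> z = mns (rad z) (- m - S)"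
    using zero_pair[OF assms] by blast
  define s where "s = rad z"
  have ss: "star (pls s m) = mns s (- m - S)" "star (mns s (- m - S)) = pls s m"
    using star_pls[of s m] star_mns[of s "- m - S"] by simp_all
  have "{v. H v = 0 \<and> cmod v = cmod z} = {pls s m, mns s (- m - S)}"
  proof (intro set_eqI iffI)
    fix v assume "v \<in> {v. H v = 0 \<and> cmod v = cmod z}"
    then have v: "H v = 0" "rad v = s" using assms by (auto simp: cmod_eq_rad s_def)
    then show "v \<in> {pls s m, mns s (- m - S)}"
      using pair_unique[OF v(1), of n m] mn by (auto simp: s_def)
  next
    fix v assume v: "v \<in> {pls s m, mns s (- m - S)}"
    then have "H v = 0" using pair_zero[OF mn(1-3)] by (auto simp: s_def)
    moreover have "rad v = s" using v by auto
    ultimately show "v \<in> {v. H v = 0 \<and> cmod v = cmod z}" using assms by (simp add: cmod_eq_rad s_def)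
  qed
  also have "\<dots> = {z, star z}" using mn(4) ss unfolding s_def[symmetric] by auto
  finally show ?thesis .
qed

lemma star_zero:
  assumes "H z = 0" shows "H (star z) = 0 \<and> rad (star z) = rad z"
proof -
  have "star z \<in> {v. H v = 0 \<and> cmod v = cmod z}" using zeros_of_radius[OF assms] by simp
  then show ?thesis by (simp add: rad_def)
qed

lemma fixed_imp_boundary:
  assumes "H z = 0" "z = star z"
  shows "\<theta> (rad z) \<in> {0, 1}"
proof -
  obtain m n where "z = pls (rad z) m \<or> z = mns (rad z) (- m - S)"
    using zero_pair[OF assms(1)] by blast
  then have "pls (rad z) m = mns (rad z) (- m - S)"
    using star_pls[of "rad z" m] star_mns[of "rad z" "- m - S"] assms(2) by auto
  then obtain N :: int where "2 * of_int m + \<theta> (rad z) = 2 * of_int (- m - S) - \<theta> (rad z) + 2 * real k * of_int N"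
    using pol_eq_iff[OF k0] by auto
  then have "\<theta> (rad z) = of_int (- 2 * m - S + int k * N)" by simp
  then obtain M :: int where M: "\<theta> (rad z) = of_int M" by blast
  then have "M = 0 \<or> M = 1" using theta[of "rad z"] by auto
  then show ?thesis using M by auto
qed

text \<open>On the edge e the level satisfies \<tau> + 2 n = p e + k a. Together with the
  congruences for m and S this yields p (2 m + S + e) = 0 modulo k; cancelling p shows that the plus
  and the minus form have the same angle.\<close>

lemma boundary_imp_fixed:
  assumes "H z = 0" "\<theta> (rad z) \<in> {0, 1}"
  shows "z = star z"
    and "B (rad z) = t0 + 2 * of_int n \<Longrightarrow> [p * m = - n] (mod int k) \<Longrightarrow> z = pls (rad z) m"
proof -
  have key: "pls (rad z) m = mns (rad z) (- m - S)"
    if "B (rad z) = t0 + 2 * of_int n" "[p * m = - n] (mod int k)" for m n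
  proof -
    obtain e :: int where e: "\<theta> (rad z) = of_int e" "e \<in> {0, 1}" using assms(2) by force
    have "\<exists>a::nat. B (rad z) = of_int p * \<theta> (rad z) + real k * real a"
      using assms(2) val0[of "rad z"] val1[of "rad z"] by auto
    then obtain a :: nat where "B (rad z) = of_int p * \<theta> (rad z) + real k * real a" by blast
    then have "of_int (\<tau> + 2 * n) = real_of_int (p * e + int k * int a)"
      using that(1) e t0 by simp
    then have Be: "\<tau> + 2 * n = p * e + int k * int a" by (simp only: of_int_eq_iff)
    have "[p * (2 * m + S + e) = 0] (mod int k)"
    proof -
      have "[p * m + p * m + p * S + p * e = - n + - n + - \<tau> + p * e] (mod int k)"
        by (intro cong_add that S cong_refl)
      also have "- n + - n + - \<tau> + p * e = - (int k * int a)" using Be by simp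
      also have "[- (int k * int a) = 0] (mod int k)" by (simp add: cong_0_iff)
      finally show ?thesis by (simp add: algebra_simps)
    qed
    then have "[2 * m + S + e = 0] (mod int k)" using p_cancel[of "2 * m + S + e" 0] by simp
    then obtain N :: int where "real_of_int (2 * m + S + e) = of_int 0 + real k * of_int N"
      using cong_kD by blast
    then show ?thesis
      by (subst pol_eq_iff) (auto simp: k0 e intro!: exI[of _ N])
  qed
  obtain m' n' where mn: "B (rad z) = t0 + 2 * of_int n'" "[p * m' = - n'] (mod int k)"
    "z = pls (rad z) m' \<or> z = mns (rad z) (- m' - S)"
    using zero_pair[OF assms(1)] by blast
  then show "z = star z" using key[OF mn(1,2)] star_pls[of "rad z" m'] star_mns[of "rad z" "- m' - S"] by auto
  assume a: "B (rad z) = t0 + 2 * of_int n" "[p * m = - n] (mod int k)"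
  show "z = pls (rad z) m" using pair_unique[OF assms(1) a] key[OF a] by auto
qed

text \<open>No level can be skipped, but neighbouring zeros may share one, as the two ends of a
  plateau.\<close>

lemma next_B:
  assumes nz: "next_zero H z v" and z: "B (rad z) = t0 + 2 * of_int n" and v: "B (rad v) = t0 + 2 * of_int n'"
  shows "n' = n \<or> n' = n + 1"
proof -
  have "rad z < rad v" using next_rad[OF nz] by blast
  then have "n \<le> n'" using mono[of "rad z" "rad v"] z v by simp
  moreover have "\<not> n + 1 < n'"
  proof
    assume "n + 1 < n'"
    moreover have "t0 + 2 * of_int (n + 1) \<in> Lev" unfolding Lev_def by blast
    ultimately show False using next_no_level[OF nz, of "t0 + 2 * of_int (n + 1)"] z v by simp
  qed
  ultimately show ?thesis by linarith
qed

lemma pair_Q: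
  assumes "z = pls s m' \<or> z = mns s (- m' - S)" "z \<in> Q k (2 * m) \<union> Q k (- 2 * S - 2 * m - 1)"
  shows "0 < \<theta> s \<and> \<theta> s < 1 \<and> [m' = m] (mod int k)"
proof -
  \<comment> \<open>Plus zeros can lie only in even sectors and minus zeros only in odd ones, so
    parity rules out the mixed cases below.\<close>
  have par: "2 * a + 2 * int k * N \<noteq> 2 * b + 1" for a b N
  proof -
    have "even (2 * a + 2 * int k * N)" "odd (2 * b + 1)" by auto
    then show ?thesis by metis
  qed
  from assms(1) show ?thesis
  proof
    assume z: "z = pls s m'"
    from assms(2) show ?thesis
    proof
      assume "z \<in> Q k (2 * m)"
      then show ?thesis unfolding z by (elim pls_Q_D) (auto intro: half_cong)
    next
      assume "z \<in> Q k (- 2 * S - 2 * m - 1)"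
      then show ?thesis unfolding z
      proof (elim pls_Q_D)
        fix N assume "2 * m' + 2 * int k * N = - 2 * S - 2 * m - 1"
        then have "2 * m' + 2 * int k * N = 2 * (- S - m - 1) + 1" by simp
        then show ?thesis using par by blast
      qed
    qed
  next
    assume z: "z = mns s (- m' - S)"
    from assms(2) show ?thesis
    proof
      assume "z \<in> Q k (2 * m)"
      then show ?thesis unfolding z
      proof (elim mns_Q_D)
        fix N assume "2 * (- m' - S) + 2 * int k * N = 2 * m + 1"
        then show ?thesis using par by blast
      qed
    next
      assume "z \<in> Q k (- 2 * S - 2 * m - 1)"
      then show ?thesis unfolding z
      proof (elim mns_Q_D)
        fix N assume a: "2 * (- m' - S) + 2 * int k * N = - 2 * S - 2 * m - 1 + 1" "0 < \<theta> s" "\<theta> s < 1"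
        then have "2 * m' + 2 * int k * (- N) = 2 * m" by simp
        then show ?thesis using a half_cong by blast
      qed
    qed
  qed
qed

lemma pair_Qbar:
  assumes "z = pls s m' \<or> z = mns s (- m' - S)" "[m' = m] (mod int k)"
  shows "z \<in> Qbar k (2 * m) \<union> Qbar k (- 2 * S - 2 * m - 1)"
proof -
  have "pls s m \<in> Qbar k (2 * m)"
    using theta[of s] by (intro Qbar_polI[where n = 0]) (auto simp: k0)
  moreover have "mns s (- m - S) \<in> Qbar k (- 2 * S - 2 * m - 1)"
    using theta[of s] by (intro Qbar_polI[where n = 0]) (auto simp: k0)
  moreover have "[- m' - S = - m - S] (mod int k)"
    using assms(2) by (intro cong_diff cong_refl) (simp add: cong_minus_minus_iff)
  ultimately show ?thesis using assms(1) pls_cong[OF assms(2)] mns_cong by (metis UnI1 UnI2)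
qed

text \<open>The next level raises n by one and so lowers the product of p with the index by one
  modulo k; l is the index with this property.\<close>

lemma next_Qbar:
  assumes nz: "next_zero H z v" and z: "B (rad z) = t0 + 2 * of_int n" "[p * m' = - n] (mod int k)"
    and ne: "B (rad z) \<noteq> B (rad v)" and m: "[m' = m] (mod int k)" and l: "[p * (m - l) = 1] (mod int k)"
  shows "v \<in> Qbar k (2 * l) \<union> Qbar k (- 2 * S - 2 * l - 1)"
proof -
  have v: "H v = 0" using next_rad[OF nz] by blast
  obtain m1 n1 where v1: "B (rad v) = t0 + 2 * of_int n1" "[p * m1 = - n1] (mod int k)"
    "v = pls (rad v) m1 \<or> v = mns (rad v) (- m1 - S)"
    using zero_pair[OF v] by blast
  have n1: "n1 = n + 1" using next_B[OF nz z(1) v1(1)] ne z(1) v1(1) by auto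
  have "[p * m = - n] (mod int k)" using z(2) m p_cancel cong_sym cong_trans by meson
  then have "[p * m - p * (m - l) = - n - 1] (mod int k)" by (rule cong_diff[OF _ l])
  then have "[p * l = - n - 1] (mod int k)" by (simp add: right_diff_distrib)
  moreover have "- n1 = - n - 1" by (simp add: n1)
  ultimately have "[p * l = - n1] (mod int k)" by simp
  then have "[m1 = l] (mod int k)" using v1(2) p_cancel cong_sym cong_trans by meson
  then show ?thesis using pair_Qbar[OF v1(3)] by blast
qed

lemma inner_zero:
  assumes z: "H z = 0" and l: "[p * (m - l) = 1] (mod int k)"
    and zQ: "z \<in> Q k (2 * m) \<union> Q k (- 2 * S - 2 * m - 1)"
  shows "z \<noteq> star z \<and> zorder H z = 1 \<and> zorder H (star z) = 1 \<and>
    (\<forall>v. next_zero H z v \<longrightarrow> v \<in> Qbar k (2 * l) \<union> Qbar k (- 2 * S - 2 * l - 1))"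
proof -
  obtain m' n where mn: "B (rad z) = t0 + 2 * of_int n" "[p * m' = - n] (mod int k)"
    "z = pls (rad z) m' \<or> z = mns (rad z) (- m' - S)"
    using zero_pair[OF z] by blast
  have q: "0 < \<theta> (rad z)" "\<theta> (rad z) < 1" "[m' = m] (mod int k)" using pair_Q[OF mn(3) zQ] by auto
  have "z \<noteq> star z" using fixed_imp_boundary[OF z] q by auto
  moreover have "zorder H z = 1" using order_in z cmod_rad q by blast
  moreover have "zorder H (star z) = 1" using order_in star_zero[OF z] cmod_rad q by metis
  moreover have "v \<in> Qbar k (2 * l) \<union> Qbar k (- 2 * S - 2 * l - 1)" if nz: "next_zero H z v" for v
    using next_Qbar[OF nz mn(1,2) _ q(3) l] next_B_less[OF nz q(1,2)] by simp
  ultimately show ?thesis by blast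
qed

text \<open>The first zero lies on a ray of integral angle, hence so does the second. Parity of 2 m
  + e then gives the same edge e, so the indices, and with them the levels, agree modulo k.\<close>

lemma Arg_eq_cong:
  assumes z: "H z = 0" "B (rad z) = t0 + 2 * of_int n" "\<theta> (rad z) \<in> {0, 1}"
    and v: "H v = 0" "B (rad v) = t0 + 2 * of_int n'" and A: "Arg z = Arg v"
  shows "[n = n'] (mod int k)"
proof -
  obtain m where m: "[p * m = - n] (mod int k)" using p_solve by blast
  obtain m' where m': "[p * m' = - n'] (mod int k)" using p_solve by blast
  have zp: "z = pls (rad z) m" by (rule boundary_imp_fixed(2)[OF z(1,3,2) m])
  obtain e :: int where e: "\<theta> (rad z) = of_int e" "e \<in> {0, 1}" using z(3) by force
  have "\<theta> (rad v) \<in> {0, 1}"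
  proof -
    have "\<exists>M::int. \<theta> (rad v) = of_int M"
      using pair_unique[OF v(1,2) m']
    proof
      assume "v = pls (rad v) m'"
      then obtain N :: int where "2 * of_int m + \<theta> (rad z) = 2 * of_int m' + \<theta> (rad v) + 2 * real k * of_int N"
        using A zp Arg_pol_eq_iff[OF k0, of "exp (rad z)" "exp (rad v)"] by (metis exp_gt_zero)
      then have "\<theta> (rad v) = of_int (2 * m + e - 2 * m' - 2 * int k * N)" using e by simp
      then show ?thesis by blast
    next
      assume "v = mns (rad v) (- m' - S)"
      then obtain N :: int where "2 * of_int m + \<theta> (rad z) = 2 * of_int (- m' - S) - \<theta> (rad v) + 2 * real k * of_int N"
        using A zp Arg_pol_eq_iff[OF k0, of "exp (rad z)" "exp (rad v)"] by (metis exp_gt_zero)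
      then have "\<theta> (rad v) = of_int (2 * (- m' - S) - 2 * m - e + 2 * int k * N)" using e by simp
      then show ?thesis by blast
    qed
    then obtain M :: int where M: "\<theta> (rad v) = of_int M" by blast
    then have "M = 0 \<or> M = 1" using theta[of "rad v"] by auto
    then show ?thesis using M by auto
  qed
  then obtain e' :: int where e': "\<theta> (rad v) = of_int e'" "e' \<in> {0, 1}" by force
  have vp: "v = pls (rad v) m'" by (rule boundary_imp_fixed(2)[OF v(1) _ v(2) m']) fact
  then obtain N :: int where N: "2 * of_int m + \<theta> (rad z) = 2 * of_int m' + \<theta> (rad v) + 2 * real k * of_int N"
    using A zp Arg_pol_eq_iff[OF k0, of "exp (rad z)" "exp (rad v)"] by (metis exp_gt_zero)
  then have "real_of_int (2 * m + e) = of_int (2 * m' + e' + 2 * (int k * N))" using e e' by simp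
  then have i: "2 * m + e = 2 * m' + e' + 2 * (int k * N)" by (simp only: of_int_eq_iff)
  have "e = e'"
  proof (rule ccontr)
    assume "e \<noteq> e'"
    then have "e = e' + 1 \<or> e' = e + 1" using e e' by auto
    then show False using i by presburger
  qed
  then have "m' = m + int k * (- N)" using i by simp
  then have "[m = m'] (mod int k)" unfolding cong_iff_lin by blast
  then have "[p * m = p * m'] (mod int k)" by (simp add: p_cancel)
  then have "[- n = - n'] (mod int k)" using m m' cong_sym cong_trans by meson
  then show ?thesis by (simp add: cong_minus_minus_iff)
qed

text \<open>Consecutive level numbers differ by at most 1, and for k >= 2 a difference of exactly 1
  is not 0 modulo k.\<close>

lemma next_Arg:
  assumes nz: "next_zero H z v" and b: "\<theta> (rad z) \<in> {0, 1} \<or> \<theta> (rad v) \<in> {0, 1}"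
  shows "Arg z = Arg v \<longleftrightarrow> B (rad z) = B (rad v)"
proof -
  have zv: "H z = 0" "H v = 0" "rad z < rad v" using next_rad[OF nz] by auto
  obtain n m where n: "B (rad z) = t0 + 2 * of_int n" "[p * m = - n] (mod int k)" using zero_pair[OF zv(1)] by blast
  obtain n' where n': "B (rad v) = t0 + 2 * of_int n'" using zero_pair[OF zv(2)] by blast
  show ?thesis
  proof
    assume A: "Arg z = Arg v"
    have "[n = n'] (mod int k)"
      using b Arg_eq_cong[OF zv(1) n(1) _ zv(2) n' A] Arg_eq_cong[OF zv(2) n' _ zv(1) n(1) A[symmetric]]
        cong_sym by blast
    moreover have "\<not> [n = n + 1] (mod int k)"
    proof
      assume "[n = n + 1] (mod int k)"
      then have "int k dvd 1" by (simp add: cong_iff_dvd_diff)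
      then show False using k2 by simp
    qed
    ultimately have "n = n'" using next_B[OF nz n(1) n'] by auto
    then show "B (rad z) = B (rad v)" using n n' by simp
  next
    assume eq: "B (rad z) = B (rad v)"
    then have nn: "n' = n" using n(1) n' by simp
    have f: "\<theta> (rad z) = \<theta> (rad v)" "\<theta> (rad z) \<in> {0, 1}" using flat[OF zv(3) eq] by auto
    have "z = pls (rad z) m" by (rule boundary_imp_fixed(2)[OF zv(1) f(2) n])
    moreover have "v = pls (rad v) m"
      by (rule boundary_imp_fixed(2)[OF zv(2) _ n'[unfolded nn] n(2)]) (use f in simp)
    moreover have "Arg (pls (rad z) m) = Arg (pls (rad v) m)"
      using f by (subst Arg_pol_eq_iff[OF k0]) (auto intro!: exI[of _ 0])
    ultimately show "Arg z = Arg v" by simp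
  qed
qed

text \<open>The two zeros are the ends of a plateau. By \<open>order_bd\<close> both are simple and
  the argument leaves the level on the outer sides.\<close>

lemma next_same_Arg:
  assumes nz: "next_zero H z v" and f: "z = star z" and A: "Arg z = Arg v"
  shows "zorder H z = 1 \<and> zorder H v = 1 \<and> (\<forall>u. next_zero H u z \<longrightarrow> Arg u \<noteq> Arg z)
    \<and> (\<forall>u. next_zero H v u \<longrightarrow> Arg u \<noteq> Arg v)"
proof -
  have zv: "H z = 0" "H v = 0" "rad z < rad v" using next_rad[OF nz] by auto
  have bz: "\<theta> (rad z) \<in> {0, 1}" by (rule fixed_imp_boundary[OF zv(1) f])
  have eq: "B (rad z) = B (rad v)" using next_Arg[OF nz] bz A by blast
  have bv: "\<theta> (rad v) \<in> {0, 1}" using flat[OF zv(3) eq] by auto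
  have "\<exists>a>rad z. B a = B (rad z)" "\<exists>a<rad v. B a = B (rad v)" using eq zv(3) by metis+
  then have z: "zorder H z = 1" "\<forall>a<rad z. B a \<noteq> B (rad z)"
    and v: "zorder H v = 1" "\<forall>a>rad v. B a \<noteq> B (rad v)"
    using order_bd[OF zv(1) cmod_rad[OF zv(1)] bz] order_bd[OF zv(2) cmod_rad[OF zv(2)] bv] by auto
  have "Arg u \<noteq> Arg z" if "next_zero H u z" for u
    using next_Arg[OF that] bz z(2) next_rad[OF that] by auto
  moreover have "Arg u \<noteq> Arg v" if "next_zero H v u" for u
    using next_Arg[OF that] bv v(2) next_rad[OF that] by auto
  ultimately show ?thesis using z v by blast
qed

text \<open>A plateau to the right of z would by \<open>lev\<close> continue to a radius in
  \<open>Z\<close> beyond rad z, where a further zero would precede v; the same happens to the left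
  of v.\<close>

lemma no_zero_between_level:
  assumes nz: "next_zero H z v" and "B (rad z) < B (rad v)"
  shows "a > rad z \<Longrightarrow> B a \<noteq> B (rad z)" "a < rad v \<Longrightarrow> B a \<noteq> B (rad v)"
proof -
  have zv: "H z = 0" "H v = 0" "rad z < rad v" using next_rad[OF nz] by auto
  have imp: False if "s \<in> Z" "rad z < s" "s < rad v" "B s = B (rad z) \<or> B s = B (rad v)" for s
  proof -
    have "B s \<in> Lev" using that(4) zero_Lev[OF zv(1)] zero_Lev[OF zv(2)] by auto
    with Lev_zero[OF that(1)] obtain u where u: "H u = 0" "rad u = s" by metis
    show False by (rule next_no_between[OF nz u(1)]) (use u that in simp_all)
  qed
  show "B a \<noteq> B (rad z)" if a: "a > rad z"
  proof
    assume e: "B a = B (rad z)"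
    have av: "a < rad v" using mono[of "rad v" a] assms(2) e by linarith
    obtain s where "s \<in> Z" "a \<le> s" "s \<le> rad v" "B s = B (rad z)"
      using lev[OF av, of "B (rad z)"] e assms(2) by auto
    moreover from this have "s \<noteq> rad v" using assms(2) by auto
    ultimately show False using imp[of s] a by auto
  qed
  show "B a \<noteq> B (rad v)" if a: "a < rad v"
  proof
    assume e: "B a = B (rad v)"
    have az: "rad z < a" using mono[of a "rad z"] assms(2) e by linarith
    obtain s where "s \<in> Z" "rad z \<le> s" "s \<le> a" "B s = B (rad v)"
      using lev[OF az, of "B (rad v)"] e assms(2) by auto
    moreover from this have "s \<noteq> rad z" using assms(2) by auto
    ultimately show False using imp[of s] a by auto
  qed
qed

lemma fixed_Qbar:
  assumes "pls s m' \<in> Qbar k (2 * m)" "\<theta> s \<in> {0, 1}"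
  shows "[m' = m] (mod int k)"
proof -
  obtain e :: int where e: "\<theta> s = of_int e" "e \<in> {0, 1}" using assms(2) by force
  obtain N :: int where N: "of_int (2 * m) \<le> 2 * of_int m' + \<theta> s + 2 * real k * of_int N"
    "2 * of_int m' + \<theta> s + 2 * real k * of_int N \<le> of_int (2 * m) + 1"
    using Qbar_polD[OF k2 _ assms(1)] by auto
  have "real_of_int (2 * m) \<le> of_int (2 * m' + e + 2 * int k * N)"
    "real_of_int (2 * m' + e + 2 * int k * N) \<le> of_int (2 * m + 1)"
    using N e by simp_all
  then have i: "2 * m \<le> 2 * m' + e + 2 * int k * N" "2 * m' + e + 2 * int k * N \<le> 2 * m + 1"
    unfolding of_int_le_iff by auto
  \<comment> \<open>Both 2 m' + e and the ends of the sector are integers; since e is 0 or 1, parity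
    leaves one possibility.\<close>
  have "2 * (m' + int k * N) = 2 * m"
  proof (cases "e = 0")
    case True
    then have "2 * (m' + int k * N) = 2 * m \<or> 2 * (m' + int k * N) = 2 * m + 1" using i by (simp add: algebra_simps) linarith
    then show ?thesis by presburger
  next
    case False
    then have "e = 1" using e by auto
    then have "2 * (m' + int k * N) = 2 * m \<or> 2 * (m' + int k * N) + 1 = 2 * m" using i by (simp add: algebra_simps) linarith
    then show ?thesis by presburger
  qed
  then show ?thesis by (intro half_cong[of _ N]) (simp add: algebra_simps)
qed

text \<open>To the right of z the curve leaves the level at once. By \<open>order_bd\<close> the
  zero is then either simple with a plateau on its left, which leads to a preceding zero of the same
  argument if there is a preceding zero, or double without a plateau.\<close>

lemma next_distinct_Arg:
  assumes nz: "next_zero H z v" and f: "z = star z" and A: "Arg z \<noteq> Arg v"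
  shows "zorder H z \<in> {1, 2} \<and>
    (\<forall>u. next_zero H u z \<longrightarrow> (zorder H z = 1 \<longleftrightarrow> Arg z = Arg u) \<and> (zorder H z = 2 \<longleftrightarrow> Arg z \<noteq> Arg u)) \<and>
    (\<forall>m l. [p * (m - l) = 1] (mod int k) \<and> z \<in> Qbar k (2 * m) \<inter> Qbar k (- 2 * S - 2 * m - 1) \<longrightarrow>
       v \<in> Qbar k (2 * l) \<union> Qbar k (- 2 * S - 2 * l - 1))"
proof (intro conjI allI impI)
  have zv: "H z = 0" "H v = 0" "rad z < rad v" using next_rad[OF nz] by auto
  have bz: "\<theta> (rad z) \<in> {0, 1}" by (rule fixed_imp_boundary[OF zv(1) f])
  have ne: "B (rad z) \<noteq> B (rad v)" using next_Arg[OF nz] bz A by blast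
  then have lt: "B (rad z) < B (rad v)" using mono[of "rad z" "rad v"] zv by simp
  note ob = order_bd[OF zv(1) cmod_rad[OF zv(1)] bz]
  show o12: "zorder H z \<in> {1, 2}" using ob by auto
  have right: "\<forall>a>rad z. B a \<noteq> B (rad z)" using no_zero_between_level(1)[OF nz lt] by blast
  have o1: "zorder H z = 1 \<longleftrightarrow> Arg z = Arg u" if u: "next_zero H u z" for u
  proof -
    have ru: "rad u < rad z" using next_rad[OF u] by blast
    have AB: "Arg u = Arg z \<longleftrightarrow> B (rad u) = B (rad z)" using next_Arg[OF u] bz by blast
    show ?thesis
    proof
      assume "zorder H z = 1"
      then have "\<exists>a<rad z. B a = B (rad z)" using ob right by auto
      then have "\<not> B (rad u) < B (rad z)" using no_zero_between_level(2)[OF u] by blast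
      then show "Arg z = Arg u" using AB mono[of "rad u" "rad z"] ru by simp
    next
      assume "Arg z = Arg u"
      then have "B (rad u) = B (rad z)" using AB by simp
      then show "zorder H z = 1" using ob ru by auto
    qed
  qed
  fix u assume u: "next_zero H u z"
  show "zorder H z = 1 \<longleftrightarrow> Arg z = Arg u" by (rule o1[OF u])
  show "zorder H z = 2 \<longleftrightarrow> Arg z \<noteq> Arg u" using o1[OF u] o12 by auto
next
  have zv: "H z = 0" "H v = 0" "rad z < rad v" using next_rad[OF nz] by auto
  have bz: "\<theta> (rad z) \<in> {0, 1}" by (rule fixed_imp_boundary[OF zv(1) f])
  have ne: "B (rad z) \<noteq> B (rad v)" using next_Arg[OF nz] bz A by blast
  fix m l assume a: "[p * (m - l) = 1] (mod int k) \<and> z \<in> Qbar k (2 * m) \<inter> Qbar k (- 2 * S - 2 * m - 1)"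
  obtain m' n where mn: "B (rad z) = t0 + 2 * of_int n" "[p * m' = - n] (mod int k)"
    using zero_pair[OF zv(1)] by blast
  have "z = pls (rad z) m'" by (rule boundary_imp_fixed(2)[OF zv(1) bz mn])
  then have "[m' = m] (mod int k)" using fixed_Qbar[of "rad z" m' m] a bz by simp
  then show "v \<in> Qbar k (2 * l) \<union> Qbar k (- 2 * S - 2 * l - 1)"
    using next_Qbar[OF nz mn ne] a by blast
qed

lemma order_le_2:
  assumes "H z = 0" "z = star z" shows "zorder H z \<le> 2"
  using order_bd[OF assms(1) cmod_rad[OF assms(1)] fixed_imp_boundary[OF assms]] by auto

end

subsection \<open>The first zeros\<close>

context zero_curve begin

text \<open>The argument of F along the curve near the origin, where |F| is too small if p > 0 and
  too large if p < 0.\<close>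

definition b0 :: real where "b0 = (if 0 < p then 0 else of_int p)"

lemma start_below: "\<exists>a<s. B a = b0"
proof -
  obtain s0 where "\<And>s. s \<le> s0 \<Longrightarrow> B s = b0" using start unfolding b0_def by blast
  then show ?thesis by (intro exI[of _ "min s0 (s - 1)"]) auto
qed

lemma B_ge: "b0 \<le> B s"
proof -
  obtain a where "a < s" "B a = b0" using start_below by blast
  then show ?thesis using mono[of a s] by simp
qed

text \<open>The radius supplied by \<open>lev\<close> need not be the smallest. If a zero precedes
  it, this zero has the same level, and nothing can precede it in turn by
  \<open>between\<close>.\<close>

lemma first_level:
  assumes \<mu>: "\<mu> \<in> Lev" "b0 \<le> \<mu>" "\<And>\<nu>. \<nu> \<in> Lev \<Longrightarrow> b0 \<le> \<nu> \<Longrightarrow> \<mu> \<le> \<nu>" and ex: "\<exists>z. H z = 0"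
  obtains s where "s \<in> Z" "B s = \<mu>" "\<And>v. H v = 0 \<Longrightarrow> s \<le> rad v"
proof -
  have low: "\<mu> \<le> B (rad v)" if "H v = 0" for v
    using \<mu>(3) zero_Lev[OF that] B_ge by blast
  obtain z where z: "H z = 0" using ex by blast
  obtain a where a: "a < rad z" "B a = b0" using start_below by blast
  have "\<exists>s\<in>Z. B s = \<mu>"
  proof (cases "B (rad z) = \<mu>")
    case True
    then show ?thesis using zero_Lev[OF z] by blast
  next
    case False
    then have "\<mu> < B (rad z)" using low[OF z] by simp
    then show ?thesis using lev[OF a(1), of \<mu>] a(2) \<mu>(2) by force
  qed
  then obtain s where s: "s \<in> Z" "B s = \<mu>" by blast
  show ?thesis
  proof (cases "\<exists>v. H v = 0 \<and> rad v < s")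
    case False
    then show ?thesis using that[OF s] not_le by blast
  next
    case True
    then obtain v where v: "H v = 0" "rad v < s" by blast
    have Bv: "B (rad v) = \<mu>" using low[OF v(1)] mono[of "rad v" s] v(2) s(2) by simp
    have "rad v \<le> rad u" if u: "H u = 0" for u
    proof (rule ccontr)
      assume "\<not> rad v \<le> rad u"
      then have lt: "rad u < rad v" by simp
      then have "B (rad u) = B s" using low[OF u] mono[of "rad u" "rad v"] Bv s by simp
      then show False using between[OF v(1) lt v(2)] by blast
    qed
    then show ?thesis using that[of "rad v"] zero_Lev[OF v(1)] Bv by blast
  qed
qed

text \<open>The neighbours belong to different families, so equal arguments would make the sum of
  their two angles an even integer; but it lies strictly between 0 and 2.\<close>

lemma nonint_next_Arg:
  assumes nz: "next_zero H z v"
    and q: "of_int (2 * q - \<kappa>) \<le> t0" "t0 < of_int (2 * q - \<kappa>) + 1" and t0: "t0 \<notin> \<int>"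
  shows "Arg v \<noteq> Arg z"
proof
  assume A: "Arg v = Arg z"
  have q': "of_int (2 * q - \<kappa>) < t0" using q(1) t0 by (metis Ints_of_int order_le_less)
  have zv: "H z = 0" "H v = 0" using next_rad[OF nz] by auto
  note i = inner_of_nonint[OF t0 zv(1)] inner_of_nonint[OF t0 zv(2)]
  have ev: "\<exists>M::int. \<theta> (rad z) + \<theta> (rad v) = 2 * of_int M"
    using zv(1)
  proof (cases rule: zero_cases)
    case (plus m n)
    obtain l where "v = mns (rad v) l" using nonint_next_plus[OF nz plus(1,3) q' q(2) t0] by blast
    then obtain N :: int where "2 * of_int l - \<theta> (rad v) = 2 * of_int m + \<theta> (rad z) + 2 * real k * of_int N"
      using A plus(1) Arg_pol_eq_iff[OF k0, of "exp (rad v)" "exp (rad z)"] by (metis exp_gt_zero)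
    then have "\<theta> (rad z) + \<theta> (rad v) = 2 * of_int (l - m - int k * N)" by simp
    then show ?thesis by blast
  next
    case (minus m n)
    obtain l where "v = pls (rad v) l" using nonint_next_minus[OF nz minus(1,3) q' q(2) t0] by blast
    then obtain N :: int where "2 * of_int l + \<theta> (rad v) = 2 * of_int m - \<theta> (rad z) + 2 * real k * of_int N"
      using A minus(1) Arg_pol_eq_iff[OF k0, of "exp (rad v)" "exp (rad z)"] by (metis exp_gt_zero)
    then have "\<theta> (rad z) + \<theta> (rad v) = 2 * of_int (m - l + int k * N)" by simp
    then show ?thesis by blast
  qed
  then obtain M :: int where "\<theta> (rad z) + \<theta> (rad v) = 2 * of_int M" by blast
  then have "0 < M" "M < 1" using i by auto
  then show False by simp
qed

lemma nonint_first:
  assumes \<mu>: "\<mu> \<in> Lev" "b0 \<le> \<mu>" "\<And>\<nu>. \<nu> \<in> Lev \<Longrightarrow> b0 \<le> \<nu> \<Longrightarrow> \<mu> \<le> \<nu>" and ex: "\<exists>z. H z = 0"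
    and q: "of_int (2 * q - \<kappa>) \<le> t0" "t0 < of_int (2 * q - \<kappa>) + 1" and t0: "t0 \<notin> \<int>"
  obtains z where "simple_separate_first_zero H z" "H z = 0" "B (rad z) = \<mu>"
proof -
  obtain s where s: "s \<in> Z" "B s = \<mu>" "\<And>v. H v = 0 \<Longrightarrow> s \<le> rad v"
    using first_level[OF \<mu> ex] by metis
  obtain z where z: "H z = 0" "rad z = s" using Lev_zero s \<mu>(1) by metis
  have "cmod z < cmod v" if "H v = 0" "v \<noteq> z" for v
  proof -
    have "rad z \<noteq> rad v" using nonint_distinct_radius[OF t0 z(1) that(1)] that(2) by blast
    then show ?thesis using s(3)[OF that(1)] z that(1) by (simp add: cmod_less_rad)
  qed
  then have "simple_separate_first_zero H z"
    unfolding simple_separate_first_zero_def using z nonint_simple[OF t0 z(1)] nonint_next_Arg[OF _ q t0] by blast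
  then show ?thesis using that z s by simp
qed

lemma nonint_first_plus:
  assumes "t0 + 2 * of_int n \<ge> b0" "\<And>\<nu>. \<nu> \<in> Lev \<Longrightarrow> b0 \<le> \<nu> \<Longrightarrow> t0 + 2 * of_int n \<le> \<nu>" "\<exists>z. H z = 0"
    and q: "of_int (2 * q - \<kappa>) \<le> t0" "t0 < of_int (2 * q - \<kappa>) + 1" and t0: "t0 \<notin> \<int>"
    and m: "[p * m = - n] (mod int k)"
  shows "\<exists>z. simple_separate_first_zero H z \<and> z \<in> Q k (2 * m)"
proof -
  have L: "t0 + 2 * of_int n \<in> Lev" by (auto simp: Lev_def)
  obtain z where z: "simple_separate_first_zero H z" "H z = 0" "B (rad z) = t0 + 2 * of_int n"
    using nonint_first[OF L assms(1-3) q t0] by metis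
  have i: "0 < \<theta> (rad z)" "\<theta> (rad z) < 1" using inner_of_nonint[OF t0 z(2)] by auto
  have "H (pls (rad z) m) = 0" using zero_Lev[OF z(2)] z(3) m zplus by blast
  then have "z = pls (rad z) m" by (intro nonint_distinct_radius[OF t0 z(2)]) auto
  moreover have "pls (rad z) m \<in> Q k (2 * m)" by (rule pls_Q_I[OF i]) simp
  ultimately show ?thesis using z(1) by metis
qed

lemma nonint_first_minus:
  assumes "- t0 + 2 * of_int n \<ge> b0" "\<And>\<nu>. \<nu> \<in> Lev \<Longrightarrow> b0 \<le> \<nu> \<Longrightarrow> - t0 + 2 * of_int n \<le> \<nu>" "\<exists>z. H z = 0"
    and q: "of_int (2 * q - \<kappa>) \<le> t0" "t0 < of_int (2 * q - \<kappa>) + 1" and t0: "t0 \<notin> \<int>"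
    and m: "[p * m = n] (mod int k)"
  shows "\<exists>z. simple_separate_first_zero H z \<and> z \<in> Q k (2 * m - 1)"
proof -
  have L: "- t0 + 2 * of_int n \<in> Lev" by (auto simp: Lev_def)
  obtain z where z: "simple_separate_first_zero H z" "H z = 0" "B (rad z) = - t0 + 2 * of_int n"
    using nonint_first[OF L assms(1-3) q t0] by metis
  have i: "0 < \<theta> (rad z)" "\<theta> (rad z) < 1" using inner_of_nonint[OF t0 z(2)] by auto
  have "H (mns (rad z) m) = 0" using zero_Lev[OF z(2)] z(3) m zminus by blast
  then have "z = mns (rad z) m" by (intro nonint_distinct_radius[OF t0 z(2)]) auto
  moreover have "mns (rad z) m \<in> Q k (2 * m - 1)" by (rule mns_Q_I[OF i]) simp
  ultimately show ?thesis using z(1) by metis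
qed

end

context zero_curve_int begin

lemma Lev_int: "\<nu> \<in> Lev \<longleftrightarrow> (\<exists>n::int. \<nu> = t0 + 2 * of_int n)"
proof -
  have "- t0 + 2 * of_int n = t0 + 2 * of_int (n - \<tau>)" for n by (simp add: t0)
  then show ?thesis unfolding Lev_def by blast
qed

lemma p_nz: "p \<noteq> 0"
  using cop k2 by auto

text \<open>The starting value is itself a level. The curve keeps it from the origin up to the zero,
  hence runs along an edge there; since this plateau is on the left, \<open>order_bd\<close> makes
  the zero simple and lets the argument leave its level on the right.\<close>

lemma first_boundary:
  assumes b: "b0 = t0 + 2 * of_int n" and m: "[p * m = - n] (mod int k)" and ex: "\<exists>z. H z = 0"
  shows "\<exists>s. simple_separate_first_zero H (pls s m) \<and> \<theta> s = (if 0 < p then 0 else 1)"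
proof -
  have L: "b0 \<in> Lev" using b Lev_int by blast
  obtain s where s: "s \<in> Z" "B s = b0" "\<And>v. H v = 0 \<Longrightarrow> s \<le> rad v"
    using first_level[OF L order_refl _ ex] by metis
  define z where "z = pls s m"
  have Hz: "H z = 0" unfolding z_def using zplus s b m by auto
  have rz: "rad z = s" by (simp add: z_def)
  obtain a where a: "a < s" "B a = b0" using start_below by blast
  have bd: "\<theta> s \<in> {0, 1}" using flat[OF a(1)] a(2) s(2) by auto
  have "\<exists>a<s. B a = B s" using a s by auto
  then have o: "zorder H z = 1" "\<forall>a>s. B a \<noteq> B s"
    using order_bd[OF Hz cmod_rad[OF Hz]] rz bd by auto
  have "cmod z < cmod v" if v: "H v = 0" "v \<noteq> z" for v
  proof -
    have "rad z \<noteq> rad v"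
    proof
      assume e: "rad z = rad v"
      have "v = pls (rad v) m"
        by (rule boundary_imp_fixed(2)[OF v(1) _ _ m]) (use e rz bd s b in auto)
      then show False using v(2) e rz by (simp add: z_def)
    qed
    then show ?thesis using s(3)[OF v(1)] rz Hz v(1) by (simp add: cmod_less_rad)
  qed
  moreover have "Arg v \<noteq> Arg z" if "next_zero H z v" for v
    using next_Arg[OF that] o(2) rz bd next_rad[OF that] by auto
  ultimately have "simple_separate_first_zero H z"
    unfolding simple_separate_first_zero_def using Hz o(1) by blast
  moreover have "\<theta> s = (if 0 < p then 0 else 1)"
  proof (cases "0 < p")
    case True
    then have "B s = 0" using s(2) by (simp add: b0_def)
    have "\<theta> s \<noteq> 1"
    proof
      assume "\<theta> s = 1"
      then obtain n :: nat where "B s = of_int p + real k * real n" using val1 by blast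
      moreover have "0 < of_int p + real k * real n" using True by (simp add: add_pos_nonneg)
      ultimately show False using \<open>B s = 0\<close> by simp
    qed
    then show ?thesis using bd True by auto
  next
    case False
    then have "B s < 0" using s(2) p_nz by (simp add: b0_def)
    have "\<theta> s \<noteq> 0"
    proof
      assume "\<theta> s = 0"
      then obtain n :: nat where "B s = real k * real n" using val0 by blast
      then show False using \<open>B s < 0\<close> by (simp add: mult_less_0_iff)
    qed
    then show ?thesis using bd False by auto
  qed
  ultimately show ?thesis unfolding z_def by blast
qed

text \<open>The zeros of smallest radius are a pair exchanged by \<open>star\<close>; both are
  simple and equally far from the origin, so they may be listed in either order.\<close>

lemma first_two_inner:
  assumes s: "s \<in> Z" "B s = t0 + 2 * of_int n" "\<And>v. H v = 0 \<Longrightarrow> s \<le> rad v"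
    and m: "[p * m = - n] (mod int k)" "[p * m' = n + \<tau>] (mod int k)" and i: "0 < \<theta> s" "\<theta> s < 1"
  shows "first_two_zeros H a b \<longleftrightarrow> {a, b} = {pls s m, mns s m'} \<and> a \<noteq> b"
proof -
  have "[p * m' = p * (- m - S)] (mod int k)" using cong_neg_solve[OF m(1) S] m(2) cong_sym cong_trans by blast
  then have c: "[m' = - m - S] (mod int k)" by (simp add: p_cancel)
  define P where "P = pls s m"
  define M where "M = mns s m'"
  have Mq: "M = mns s (- m - S)" unfolding M_def by (rule mns_cong[OF c])
  have H: "H P = 0" "H M = 0" using pair_zero[OF s(1,2) m(1)] by (auto simp: P_def Mq)
  have r: "rad P = s" "rad M = s" by (simp_all add: P_def M_def)
  have st: "star P = M" "star M = P" unfolding P_def Mq star_pls star_mns by simp_all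
  have ne: "P \<noteq> M" using fixed_imp_boundary[OF H(1)] st r i by auto
  have o: "zorder H P = 1" "zorder H M = 1" using order_in H cmod_rad r i by metis+
  have rs: "v \<in> {P, M}" if "H v = 0" "rad v = s" for v
  proof -
    have "cmod v = cmod P" using that r cmod_eq_rad[OF that(1) H(1)] by simp
    then have "v \<in> {P, star P}" using that(1) zeros_of_radius[OF H(1)] by blast
    then show ?thesis by (simp only: st)
  qed
  have min: "cmod P \<le> cmod v" "cmod M \<le> cmod v" if "H v = 0" for v
    using s(3)[OF that] r cmod_le_rad[OF H(1) that] cmod_le_rad[OF H(2) that] by simp_all
  have eq: "cmod P = cmod M" using r cmod_eq_rad[OF H] by simp
  have "first_two_zeros H a b \<longleftrightarrow> {a, b} = {P, M} \<and> a \<noteq> b"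
  proof
    assume f: "first_two_zeros H a b"
    then have ab: "H a = 0" "H b = 0" "\<And>z. H z = 0 \<Longrightarrow> cmod a \<le> cmod z" by (auto simp: first_two_zeros_def)
    have "cmod a \<le> cmod P" using ab(3)[OF H(1)] .
    then have "rad a \<le> s" using cmod_le_rad[OF ab(1) H(1)] r by simp
    then have "rad a = s" using s(3)[OF ab(1)] by simp
    then have a: "a \<in> {P, M}" by (rule rs[OF ab(1)])
    have "a \<noteq> b" using f a o by (auto simp: first_two_zeros_def)
    then have "\<forall>z. H z = 0 \<and> z \<noteq> a \<longrightarrow> cmod b \<le> cmod z" using f by (simp add: first_two_zeros_def)
    then have "cmod b \<le> cmod P" using a H ne eq by auto
    then have "rad b \<le> s" using cmod_le_rad[OF ab(2) H(1)] r by simp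
    then have "rad b = s" using s(3)[OF ab(2)] by simp
    then have "b \<in> {P, M}" by (rule rs[OF ab(2)])
    then show "{a, b} = {P, M} \<and> a \<noteq> b" using a \<open>a \<noteq> b\<close> by auto
  next
    assume "{a, b} = {P, M} \<and> a \<noteq> b"
    then have "a = P \<and> b = M \<or> a = M \<and> b = P" by (auto simp: doubleton_eq_iff)
    then show "first_two_zeros H a b"
      using H ne o min eq by (auto simp: first_two_zeros_def)
  qed
  then show ?thesis by (simp add: P_def M_def)
qed

text \<open>By parity b0 is no level, so b0 + 1 comes first. On an edge \<open>B\<close> is k n or p
  + k n with n >= 0; as k >= 2, the value b0 + 1 occurs there only for p = 1 (top) and p = -1
  (bottom). In these cases the first zero is double, or it begins a plateau whose other end is the
  second zero.\<close>

lemma first_two: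
  assumes b: "b0 + 1 = t0 + 2 * of_int n" and m: "[p * m = - n] (mod int k)" "[p * m' = n + \<tau>] (mod int k)"
    and ex: "\<exists>z. H z = 0"
  shows "\<exists>s. 0 < \<theta> s \<and> \<theta> s < 1 \<and> (\<forall>a b. first_two_zeros H a b \<longleftrightarrow> {a, b} = {pls s m, mns s m'} \<and> a \<noteq> b) \<or>
     (\<exists>s2. (p = 1 \<and> \<theta> s = 1 \<and> \<theta> s2 = 1 \<or> p = - 1 \<and> \<theta> s = 0 \<and> \<theta> s2 = 0) \<and>
       (\<forall>a b. first_two_zeros H a b \<longleftrightarrow> a = pls s m \<and> b = pls s2 m))"
proof -
  have L: "b0 + 1 \<in> Lev" using b Lev_int by blast
  have min: "b0 + 1 \<le> \<nu>" if n': "\<nu> \<in> Lev" "b0 \<le> \<nu>" for \<nu>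
  proof -
    obtain n' where n': "\<nu> = t0 + 2 * of_int n'" using n'(1) Lev_int by blast
    then have "real_of_int (2 * n - 1) \<le> of_int (2 * n')" using that(2) b by simp
    then have "n \<le> n'" unfolding of_int_le_iff by linarith
    then show ?thesis using n' b by simp
  qed
  have b01: "b0 \<le> b0 + 1" by simp
  obtain s where s: "s \<in> Z" "B s = b0 + 1" "\<And>v. H v = 0 \<Longrightarrow> s \<le> rad v"
    using first_level[OF L b01 min ex] by metis
  show ?thesis
  proof (cases "0 < \<theta> s \<and> \<theta> s < 1")
    case True
    then show ?thesis using first_two_inner[OF s(1) s(2)[unfolded b] s(3) m] by blast
  next
    case False
    then have bd: "\<theta> s \<in> {0, 1}" using theta[of s] by auto
    have pc: "p = 1 \<and> \<theta> s = 1 \<and> B s = 1 \<or> p = - 1 \<and> \<theta> s = 0 \<and> B s = 0"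
    proof (cases "0 < p")
      case True
      have B1: "B s = 1" using s(2) True by (simp add: b0_def)
      have "\<theta> s \<noteq> 0"
      proof
        assume "\<theta> s = 0"
        then obtain n :: nat where "1 = real k * real n" using val0 B1 by metis
        then have "1 = k * n" by (metis of_nat_1 of_nat_eq_iff of_nat_mult)
        then show False using k2 by simp
      qed
      then have t1: "\<theta> s = 1" using bd by auto
      then obtain n :: nat where "1 = of_int p + real k * real n" using val1 B1 by metis
      moreover have "0 \<le> real k * real n" by simp
      ultimately have "p \<le> 1" by linarith
      then show ?thesis using True t1 B1 by simp
    next
      case False
      then have p: "p < 0" using p_nz by simp
      have B1: "B s = of_int p + 1" using s(2) False by (simp add: b0_def)
      have "\<theta> s \<noteq> 1"
      proof
        assume "\<theta> s = 1"
        then obtain n :: nat where "of_int p + 1 = of_int p + real k * real n" using val1 B1 by metis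
        then have "1 = k * n" by (metis add_left_cancel of_nat_1 of_nat_eq_iff of_nat_mult)
        then show False using k2 by simp
      qed
      then have t1: "\<theta> s = 0" using bd by auto
      then obtain n :: nat where "of_int p + 1 = real k * real n" using val0 B1 by metis
      moreover have "0 \<le> real k * real n" by simp
      ultimately have "0 \<le> real_of_int (p + 1)" by simp
      then have "p = - 1" using p unfolding of_int_0_le_iff by linarith
      then show ?thesis using t1 B1 by simp
    qed
    define z where "z = pls s m"
    have Bs: "B s = t0 + 2 * of_int n" using s(2) b by simp
    have Hz: "H z = 0" unfolding z_def using zplus s(1) Bs m(1) by auto
    have rz: "rad z = s" by (simp add: z_def)
    have uniq: "v = pls (rad v) m" if "H v = 0" "B (rad v) = B s" "\<theta> (rad v) \<in> {0, 1}" for v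
      using boundary_imp_fixed(2)[OF that(1,3) _ m(1)] that(2) Bs by simp
    have min: "cmod z \<le> cmod v" if "H v = 0" for v
      using s(3)[OF that] that Hz rz by (simp add: cmod_le_rad)
    \<comment> \<open>A plateau to the left would, since \<open>B\<close> starts at the lower value
      b0, contain an earlier radius of \<open>Z\<close> and thus an earlier zero.\<close>
    have left: "B a \<noteq> B s" if "a < s" for a
    proof
      assume e: "B a = B s"
      obtain a0 where a0: "a0 < a" "B a0 = b0" using start_below by blast
      obtain s' where s': "s' \<in> Z" "a0 \<le> s'" "s' \<le> a" "B s' = B s"
        using lev[OF a0(1), of "B s"] a0 e s(2) by auto
      then obtain u where "H u = 0" "rad u = s'" using Lev_zero L s(2) by metis
      then show False using s(3)[of u] s' that by simp
    qed
    have first: "a = z" if "H a = 0" "\<And>v. H v = 0 \<Longrightarrow> cmod a \<le> cmod v" for a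
    proof -
      have "rad a \<le> s" using that(2)[OF Hz] cmod_le_rad[OF that(1) Hz] rz by simp
      then have ra: "rad a = s" using s(3)[OF that(1)] by simp
      then show ?thesis using uniq[OF that(1)] bd by (simp add: z_def)
    qed
    from order_bd[OF Hz cmod_rad[OF Hz], unfolded rz, OF bd] left
    consider "zorder H z = 1" "\<exists>a>s. B a = B s" | "zorder H z = 2" by blast
    then show ?thesis
    proof cases
      case 2
      have "first_two_zeros H a b \<longleftrightarrow> a = z \<and> b = z" for a b
      proof
        assume f: "first_two_zeros H a b"
        then have a: "a = z" by (intro first) (auto simp: first_two_zeros_def)
        have "a = b"
        proof (rule ccontr)
          assume ne: "a \<noteq> b"
          then have "\<not> cmod a < cmod b" using f 2 a by (auto simp: first_two_zeros_def)
          then have "cmod b \<le> cmod v" if "H v = 0" for v using min[OF that] a by simp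
          moreover have "H b = 0" using f by (simp add: first_two_zeros_def)
          ultimately have "b = z" by (rule first[rotated])
          then show False using ne a by simp
        qed
        then show "a = z \<and> b = z" using a by simp
      next
        assume "a = z \<and> b = z"
        then show "first_two_zeros H a b" using Hz min 2 by (auto simp: first_two_zeros_def)
      qed
      then show ?thesis using pc unfolding z_def by blast
    next
      case 1
      then obtain a where a: "a > s" "B a = B s" by blast
      \<comment> \<open>The growth assumptions make the plateau end, so that a second zero
        exists.\<close>
      have "\<exists>c\<ge>a. B c \<noteq> B s"
      proof (rule ccontr)
        assume n: "\<not> ?thesis"
        have st: "\<theta> c = \<theta> s \<and> B c = B s" if "a \<le> c" for c
          using flat[of s c] n that a by auto
        obtain c where "a \<le> c" "\<not> (\<theta> c = \<theta> s \<and> B c = B s)"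
          using pc growth1[of a] growth2[of a] by auto
        then show False using st by blast
      qed
      then obtain c where c: "a \<le> c" "B c \<noteq> B s" by blast
      then have "a < c" using a by (cases "a = c") auto
      then obtain s2 where s2: "s2 \<in> Z" "a \<le> s2" "s2 \<le> c" "B s2 = B s"
        using lev[of a c "B s"] a c(2) mono[of a c] by auto
      define y where "y = pls s2 m"
      have ss2: "s < s2" using s2 a by simp
      have t2: "\<theta> s2 = \<theta> s" using flat[OF ss2] s2 by auto
      have Hy: "H y = 0" unfolding y_def using zplus s2 Bs m(1) by auto
      have ry: "rad y = s2" by (simp add: y_def)
      have zy: "z \<noteq> y" using rz ry ss2 by auto
      have gap: "s2 \<le> rad v" if v: "H v = 0" "v \<noteq> z" for v
      proof (rule ccontr)
        assume n: "\<not> s2 \<le> rad v"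
        have "rad v \<noteq> s"
        proof
          assume "rad v = s"
          then show False using uniq[OF v(1)] bd v(2) by (simp add: z_def)
        qed
        then have "s < rad v" using s(3)[OF v(1)] by simp
        then show False using between[OF v(1), of s s2] n s2 by simp
      qed
      have "first_two_zeros H a b \<longleftrightarrow> a = z \<and> b = y" for a b
      proof
        assume f: "first_two_zeros H a b"
        then have a: "a = z" by (intro first) (auto simp: first_two_zeros_def)
        have ne: "a \<noteq> b" using f 1 a by (auto simp: first_two_zeros_def)
        have Hb: "H b = 0" using f by (simp add: first_two_zeros_def)
        have "cmod b \<le> cmod y" using f ne a Hy zy by (auto simp: first_two_zeros_def)
        then have "rad b \<le> s2" using cmod_le_rad[OF Hb Hy] ry by simp
        then have rb: "rad b = s2" using gap[OF Hb] ne a by auto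
        have "b = pls (rad b) m" by (rule uniq[OF Hb]) (use rb s2 t2 bd in auto)
        then show "a = z \<and> b = y" using a rb by (simp add: y_def)
      next
        assume ab: "a = z \<and> b = y"
        have "cmod y \<le> cmod v" if "H v = 0" "v \<noteq> z" for v
          using gap[OF that] that Hy ry by (simp add: cmod_le_rad)
        then show "first_two_zeros H a b" using ab Hz Hy zy min 1 by (auto simp: first_two_zeros_def)
      qed
      then show ?thesis using pc t2 unfolding z_def y_def by (intro exI[of _ s] disjI2 exI[of _ s2]) auto
    qed
  qed
qed

end

subsection \<open>Level values attained by the quotient\<close>

context summable_weights begin

lemma gprod_real_ge:
  assumes "0 \<le> r"
  shows "1 + r * x n \<le> cmod (gprod x (of_real r))"
proof (rule tendsto_lowerbound)
  show "(\<lambda>N. cmod (\<Prod>i<N. 1 + of_real r * of_real (x i))) \<longlonglongrightarrow> cmod (gprod x (of_real r))"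
    by (intro tendsto_norm gprod_LIMSEQ)
  show "\<forall>\<^sub>F N in sequentially. 1 + r * x n \<le> cmod (\<Prod>i<N. 1 + of_real r * of_real (x i))"
    using eventually_gt_at_top[of n]
  proof eventually_elim
    case (elim N)
    have nn: "0 \<le> r * x i" for i using assms nonneg by simp
    have "(\<Prod>i<N. 1 + of_real r * complex_of_real (x i)) = of_real (\<Prod>i<N. 1 + r * x i)" by simp
    then have "cmod (\<Prod>i<N. 1 + of_real r * complex_of_real (x i)) = (\<Prod>i<N. 1 + r * x i)"
      using nn by (simp only: norm_of_real) (simp add: prod_nonneg add_nonneg_nonneg)
    also have "\<dots> = (1 + r * x n) * (\<Prod>i\<in>{..<N} - {n}. 1 + r * x i)"
      using elim by (subst prod.remove[of _ n]) auto
    also have "\<dots> \<ge> (1 + r * x n) * 1"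
      using nn by (intro mult_left_mono prod_ge_1) auto
    finally show ?case by simp
  qed
qed simp

text \<open>Every weight is bounded by the sum of all of them, so a single radius serves all
  factors.\<close>

lemma eventually_no_large: "\<exists>s0. \<forall>s\<le>s0. {n. 1 < x n * exp (c * s)} = {}" if "0 < c" for c :: real
proof -
  define M where "M = suminf x"
  have M: "x n \<le> M" for n
    using sum_le_suminf[OF summable, of "{n}"] nonneg by (simp add: M_def)
  have "((\<lambda>s. M * exp (c * s)) \<longlongrightarrow> M * 0) at_bot"
    by (intro tendsto_intros filterlim_compose[OF exp_at_bot] filterlim_tendsto_pos_mult_at_bot[OF tendsto_const that] filterlim_ident)
  then have "\<forall>\<^sub>F s in at_bot. M * exp (c * s) < 1" by (rule order_tendstoD(2)) simp
  then obtain s0 where s0: "\<And>s. s \<le> s0 \<Longrightarrow> M * exp (c * s) < 1" by (auto simp: eventually_at_bot_linorder)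
  have "x n * exp (c * s) < 1" if "s \<le> s0" for n s
  proof -
    have "x n * exp (c * s) \<le> M * exp (c * s)" by (rule mult_right_mono[OF M]) simp
    then show ?thesis using s0[OF that] by linarith
  qed
  then show ?thesis by (intro exI[of _ s0]) (auto simp: not_less less_imp_le)
qed

lemma zero_of_no_large:
  assumes "\<And>s. a \<le> s \<Longrightarrow> {n. 1 < x n * exp (c * s)} = {}" "0 < c"
  shows "x n = 0"
proof (rule ccontr)
  assume "x n \<noteq> 0"
  then have x: "0 < x n" using nonneg[of n] by simp
  have "filterlim (\<lambda>s. x n * exp (c * s)) at_top at_top"
    by (intro filterlim_tendsto_pos_mult_at_top[OF tendsto_const x] filterlim_compose[OF exp_at_top]
        filterlim_tendsto_pos_mult_at_top[OF tendsto_const assms(2)] filterlim_ident)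
  then have "\<forall>\<^sub>F s in at_top. 1 < x n * exp (c * s)" by (simp add: filterlim_at_top_dense)
  then have "\<forall>\<^sub>F s in at_top. a \<le> s \<and> 1 < x n * exp (c * s)" by (intro eventually_conj eventually_ge_at_top)
  then obtain s where "a \<le> s" "1 < x n * exp (c * s)" by (auto simp: eventually_at_top_linorder)
  then show False using assms(1)[of s] by blast
qed

lemma gprod_zero_weights: "(\<And>n. x n = 0) \<Longrightarrow> gprod x z = 1"
  by (simp add: gprod_def)

end

context product_quotient begin

text \<open>Off \<open>Z\<close> the modulus differs strictly from \<rho>, so the curve stays on the
  same edge nearby. There the values of \<open>B\<close> differ by multiples of k, and by continuity
  \<open>B\<close> cannot change.\<close>

lemma B_locally_const:
  assumes "s \<notin> Z"
  shows "\<forall>\<^sub>F a in nhds s. B a = B s"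
proof -
  have cB: "(B \<longlongrightarrow> B s) (nhds s)"
    using continuous_B by (simp add: continuous_on_eq_continuous_at isCont_def tendsto_nhds_iff)
  have near: "\<forall>\<^sub>F a in nhds s. dist (B a) (B s) < 1" using cB by (rule tendstoD) simp
  have cD: "((\<lambda>a. Dn (Complex a t)) \<longlongrightarrow> Dn (Complex s t)) (nhds s)" for t
  proof -
    have "continuous_on UNIV (\<lambda>a. Complex a t)" unfolding Complex_eq by (intro continuous_intros)
    then have "continuous_on UNIV (\<lambda>a. Dn (Complex a t))"
      by (rule continuous_on_compose2[OF Dn_continuous[of UNIV]]) auto
    then show ?thesis by (simp add: continuous_on_eq_continuous_at isCont_def tendsto_nhds_iff)
  qed
  have int: "n = m" if "\<bar>real k * (real n - real m)\<bar> < 1" for n m :: nat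
  proof -
    have "\<bar>real n - real m\<bar> \<le> real k * \<bar>real n - real m\<bar>"
      using k2 mult_right_mono[of 1 "real k" "\<bar>real n - real m\<bar>"] by simp
    then have "\<bar>real n - real m\<bar> < 1" using that by (simp add: abs_mult)
    then show ?thesis by linarith
  qed
  have "R (cu s) \<noteq> ln \<rho>" using assms Z_R by blast
  then consider "R (cu s) < ln \<rho>" | "ln \<rho> < R (cu s)" by linarith
  then show ?thesis
  proof cases
    case 1
    then have T: "T s = 0" by (rule neg_T)
    then have "Dn (Complex s 0) < 0" using Dn_sgn(1)[OF reg_cu, of s] 1 by simp
    then have "\<forall>\<^sub>F a in nhds s. Dn (Complex a 0) < 0" using order_tendstoD(2)[OF cD] by blast
    then show ?thesis using near
    proof eventually_elim
      case (elim a)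
      have "T a = 0" using elim by (intro T_eqI) (simp add: root_def strip_def less_imp_le)
      then show ?case using elim(2) int B_T_0[OF T] B_T_0[of a]
        by (metis dist_real_def right_diff_distrib)
    qed
  next
    case 2
    then have T: "T s = w" by (rule pos_T)
    then have "0 < Dn (Complex s w)" using Dn_sgn(3)[OF reg_cu, of s] 2 by simp
    then have "\<forall>\<^sub>F a in nhds s. 0 < Dn (Complex a w)" using order_tendstoD(1)[OF cD] by blast
    then show ?thesis using near
    proof eventually_elim
      case (elim a)
      have "T a = w" using elim by (intro T_eqI) (simp add: root_def strip_def less_imp_le)
      then have Ba: "B a = of_int p + real k * real (card {n. 1 < x n * exp (real k * a)})" by (rule B_T_w)
      have "B a - B s = real k * (real (card {n. 1 < x n * exp (real k * a)}) - real (card {n. 1 < x n * exp (real k * s)}))"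
        unfolding Ba B_T_w[OF T] by (simp add: right_diff_distrib)
      then show ?case using elim(2) int Ba B_T_w[OF T] by (metis dist_real_def)
    qed
  qed
qed

text \<open>Take the first parameter at which the value is attained, or the last one if it is
  already the value at a. \<open>B\<close> is not locally constant at that point, so the point
  belongs to \<open>Z\<close>.\<close>

lemma B_level:
  assumes "a < b" "B a \<le> \<mu>" "\<mu> \<le> B b" "B a \<noteq> B b"
  shows "\<exists>s\<in>Z. a \<le> s \<and> s \<le> b \<and> B s = \<mu>"
proof -
  define S where "S = {s \<in> {a..b}. B s = \<mu>}"
  have "\<exists>s\<ge>a. s \<le> b \<and> B s = \<mu>"
    using assms continuous_B by (intro IVT') (auto intro: continuous_on_subset)
  then have ne: "S \<noteq> {}" by (auto simp: S_def)
  have "closed {s. B s = \<mu>}"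
    using continuous_B by (intro closed_Collect_eq continuous_on_const)
  moreover have "S = {a..b} \<inter> {s. B s = \<mu>}" by (auto simp: S_def)
  ultimately have comp: "compact S" by (simp add: compact_Int_closed)
  show ?thesis
  proof (cases "B a < \<mu>")
    case True
    obtain s where s: "s \<in> S" "\<And>u. u \<in> S \<Longrightarrow> s \<le> u" using compact_attains_inf[OF comp ne] by blast
    have as: "a < s" "s \<le> b" "B s = \<mu>" using s(1) True by (auto simp: S_def less_le)
    have "s \<in> Z"
    proof (rule ccontr)
      assume "s \<notin> Z"
      then have "\<forall>\<^sub>F u in at_left s. B u = B s"
        using B_locally_const[of s] by (simp add: eventually_nhds_conv_at eventually_at_split)
      moreover have "\<forall>\<^sub>F u in at_left s. u \<in> {a<..<s}" by (rule eventually_at_left_real[OF as(1)])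
      ultimately have "\<forall>\<^sub>F u in at_left s. B u = B s \<and> u \<in> {a<..<s}" by (rule eventually_conj)
      then obtain u where "B u = B s" "a < u" "u < s"
        using eventually_happens'[of "at_left s"] by fastforce
      then show False using s(2)[of u] as by (simp add: S_def)
    qed
    then show ?thesis using as by (intro bexI[of _ s]) auto
  next
    case False
    then have eq: "B a = \<mu>" "\<mu> < B b" using assms by auto
    obtain s where s: "s \<in> S" "\<And>u. u \<in> S \<Longrightarrow> u \<le> s" using compact_attains_sup[OF comp ne] by blast
    have as: "a \<le> s" "s < b" "B s = \<mu>" using s(1) eq by (auto simp: S_def less_le)
    have "s \<in> Z"
    proof (rule ccontr)
      assume "s \<notin> Z"
      then have "\<forall>\<^sub>F u in at_right s. B u = B s"
        using B_locally_const[of s] by (simp add: eventually_nhds_conv_at eventually_at_split)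
      moreover have "\<forall>\<^sub>F u in at_right s. u \<in> {s<..<b}" by (rule eventually_at_right_real[OF as(2)])
      ultimately have "\<forall>\<^sub>F u in at_right s. B u = B s \<and> u \<in> {s<..<b}" by (rule eventually_conj)
      then obtain u where "B u = B s" "s < u" "u < b"
        using eventually_happens'[of "at_right s"] by fastforce
      then show False using s(2)[of u] as by (simp add: S_def)
    qed
    then show ?thesis using as by (intro bexI[of _ s]) auto
  qed
qed

lemma gprod_tendsto_1:
  "((\<lambda>s. cmod (gprod x (exp (of_nat k * Complex s t)))) \<longlongrightarrow> 1) at_bot"
  "((\<lambda>s. cmod (gprod y (- exp (of_nat k * Complex s t)))) \<longlongrightarrow> 1) at_bot"
proof -
  have "((\<lambda>s. exp (real k * s)) \<longlongrightarrow> 0) at_bot"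
    by (intro filterlim_compose[OF exp_at_bot] filterlim_tendsto_pos_mult_at_bot[OF tendsto_const k_pos] filterlim_ident)
  moreover have "cmod (exp (of_nat k * Complex s t)) = exp (real k * s)" for s by simp
  ultimately have "((\<lambda>s. cmod (exp (of_nat k * Complex s t))) \<longlongrightarrow> 0) at_bot" by (simp only:)
  then have e: "((\<lambda>s. exp (of_nat k * Complex s t)) \<longlongrightarrow> 0) at_bot"
    by (rule tendsto_norm_zero_cancel)
  have c: "isCont (gprod x) 0" "isCont (gprod y) 0"
    using holomorphic_on_imp_continuous_on[OF X.gprod_holomorphic[of UNIV]]
      holomorphic_on_imp_continuous_on[OF Y.gprod_holomorphic[of UNIV]]
    unfolding continuous_on_eq_continuous_at[OF open_UNIV] by blast+
  show "((\<lambda>s. cmod (gprod x (exp (of_nat k * Complex s t)))) \<longlongrightarrow> 1) at_bot"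
    using tendsto_norm[OF isCont_tendsto_compose[OF c(1) e]] by simp
  have "((\<lambda>s. - exp (of_nat k * Complex s t)) \<longlongrightarrow> 0) at_bot" using tendsto_minus[OF e] by simp
  from tendsto_norm[OF isCont_tendsto_compose[OF c(2) this]]
  show "((\<lambda>s. cmod (gprod y (- exp (of_nat k * Complex s t)))) \<longlongrightarrow> 1) at_bot" by simp
qed

lemma B_start: "\<exists>s0. \<forall>s\<le>s0. s \<notin> Z \<and> B s = (if 0 < p then 0 else of_int p)"
proof (cases "0 < p")
  case True
  then have pos: "0 < real_of_int p" by simp
  have "((\<lambda>s. exp (real_of_int p * s)) \<longlongrightarrow> 0) at_bot"
    by (intro filterlim_compose[OF exp_at_bot] filterlim_tendsto_pos_mult_at_bot[OF tendsto_const pos] filterlim_ident)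
  then have "((\<lambda>s. Dn (Complex s 0)) \<longlongrightarrow> 0 * 1 - \<rho> * 1) at_bot"
    unfolding Dn_def complex.sel by (intro tendsto_intros gprod_tendsto_1)
  then have "\<forall>\<^sub>F s in at_bot. Dn (Complex s 0) < 0" by (rule order_tendstoD(2)) (simp add: \<rho>_pos)
  then obtain s1 where s1: "\<And>s. s \<le> s1 \<Longrightarrow> Dn (Complex s 0) < 0" by (auto simp: eventually_at_bot_linorder)
  obtain s2 where s2: "\<And>s. s \<le> s2 \<Longrightarrow> {n. 1 < y n * exp (real k * s)} = {}"
    using Y.eventually_no_large[OF k_pos] by blast
  have "s \<notin> Z \<and> B s = 0" if "s \<le> min s1 s2" for s
  proof -
    have D: "Dn (Complex s 0) < 0" using s1 that by simp
    then have T: "T s = 0" by (intro T_eqI) (simp add: root_def strip_def less_imp_le)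
    then have "B s = 0" using B_T_0[OF T] s2 that by simp
    then show ?thesis using D T by (simp add: Z_def)
  qed
  then show ?thesis using True by (intro exI[of _ "min s1 s2"]) auto
next
  case False
  then have p: "p < 0" using p_nz by simp
  then have pos: "0 < real_of_int (- p)" by simp
  have "((\<lambda>s. exp (real_of_int (- p) * s)) \<longlongrightarrow> 0) at_bot"
    by (intro filterlim_compose[OF exp_at_bot] filterlim_tendsto_pos_mult_at_bot[OF tendsto_const pos] filterlim_ident)
  \<comment> \<open>This is \<open>Dn\<close> multiplied by exp (-p s): both terms now have finite
    limits, whereas for p < 0 the first term of \<open>Dn\<close> itself is unbounded.\<close>
  then have "((\<lambda>s. cmod (gprod x (exp (of_nat k * Complex s w))) - \<rho> * exp (of_int (- p) * s) * cmod (gprod y (- exp (of_nat k * Complex s w))))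
     \<longlongrightarrow> 1 - \<rho> * 0 * 1) at_bot"
    by (intro tendsto_intros gprod_tendsto_1)
  then have "\<forall>\<^sub>F s in at_bot. 0 < cmod (gprod x (exp (of_nat k * Complex s w))) - \<rho> * exp (of_int (- p) * s) * cmod (gprod y (- exp (of_nat k * Complex s w)))"
    by (rule order_tendstoD(1)) simp
  then obtain s1 where s1: "\<And>s. s \<le> s1 \<Longrightarrow> 0 < cmod (gprod x (exp (of_nat k * Complex s w))) - \<rho> * exp (of_int (- p) * s) * cmod (gprod y (- exp (of_nat k * Complex s w)))"
    by (auto simp: eventually_at_bot_linorder)
  obtain s2 where s2: "\<And>s. s \<le> s2 \<Longrightarrow> {n. 1 < x n * exp (real k * s)} = {}"
    using X.eventually_no_large[OF k_pos] by blast
  have "s \<notin> Z \<and> B s = of_int p" if "s \<le> min s1 s2" for s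
  proof -
    have "Dn (Complex s w) = exp (of_int p * s) * (cmod (gprod x (exp (of_nat k * Complex s w))) - \<rho> * exp (of_int (- p) * s) * cmod (gprod y (- exp (of_nat k * Complex s w))))"
      by (simp add: Dn_def algebra_simps exp_minus)
    also have "\<dots> > 0" using s1 that by (intro mult_pos_pos) auto
    finally have D: "0 < Dn (Complex s w)" .
    then have T: "T s = w" by (intro T_eqI) (simp add: root_def strip_def less_imp_le)
    then have "B s = of_int p" using B_T_w[OF T] s2 that by simp
    then show ?thesis using D T by (simp add: Z_def)
  qed
  then show ?thesis using False by (intro exI[of _ "min s1 s2"]) auto
qed

lemma exp_growth:
  assumes "0 < c"
  shows "\<exists>s\<ge>a. d * exp s < c * exp (real k * s)"
proof -
  have "filterlim (\<lambda>s. c * exp s) at_top at_top"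
    by (intro filterlim_tendsto_pos_mult_at_top[OF tendsto_const assms] exp_at_top)
  then have "\<forall>\<^sub>F s in at_top. d < c * exp s" by (simp add: filterlim_at_top_dense)
  then have "\<forall>\<^sub>F s in at_top. a \<le> s \<and> 0 \<le> s \<and> d < c * exp s" by (intro eventually_conj eventually_ge_at_top)
  then obtain s where s: "a \<le> s" "0 \<le> s" "d < c * exp s" by (auto simp: eventually_at_top_linorder)
  have "d * exp s < c * exp s * exp s" using s by simp
  also have "\<dots> = c * exp (2 * s)" by (simp add: exp_double power2_eq_square)
  also have "\<dots> \<le> c * exp (real k * s)" using assms s k2 by (intro mult_left_mono) (auto intro: mult_right_mono)
  finally show ?thesis using s by blast
qed

text \<open>An endless plateau on the top edge would exclude every zero of the quotient, so all x n
  vanish and some y n is positive. The denominator then grows at least like exp (k s), which for k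
  >= 2 outruns the numerator exp s, so the curve cannot stay on the edge.\<close>

lemma B_growth_w:
  assumes "p = 1"
  shows "\<exists>s\<ge>a. \<not> (T s = w \<and> B s = 1)"
proof (rule ccontr)
  assume "\<not> ?thesis"
  then have A: "T s = w" "B s = 1" if "a \<le> s" for s using that by auto
  have "{n. 1 < x n * exp (real k * s)} = {}" if "a \<le> s" for s
    using B_T_w[OF A(1)[OF that]] A[OF that] Im_psi_w(2)[OF reg_cu, of s] assms k_pos by auto
  then have x0: "x n = 0" for n using X.zero_of_no_large[OF _ k_pos] by blast
  then obtain n where "y n \<noteq> 0" using nontrivial by blast
  then have yn: "0 < y n" using Y.nonneg[of n] by simp
  obtain s where s: "a \<le> s" "1 * exp s < \<rho> * y n * exp (real k * s)"
    using exp_growth[of "\<rho> * y n" a 1] \<rho>_pos yn by auto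
  have e: "exp (of_nat k * Complex s w) = of_real (- exp (real k * s))"
    by (simp add: complex_eq_iff Re_exp Im_exp kw)
  have "\<rho> * (1 + exp (real k * s) * y n) \<le> \<rho> * cmod (gprod y (- exp (of_nat k * Complex s w)))"
    unfolding e using Y.gprod_real_ge[of "exp (real k * s)" n] \<rho>_pos by (intro mult_left_mono) auto
  moreover have "real_of_int p = 1" using assms by simp
  then have "Dn (Complex s w) = exp s - \<rho> * cmod (gprod y (- exp (of_nat k * Complex s w)))"
    by (simp only: Dn_def X.gprod_zero_weights[OF x0]) simp
  ultimately have "Dn (Complex s w) < 0"
    using s(2) \<rho>_pos by (simp add: algebra_simps)
  moreover have "root (Complex s w)" using root_cu[of s] A(1)[OF s(1)] by simp
  ultimately show False by (auto simp: root_def)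
qed

text \<open>The same with the roles exchanged: all y n vanish, and exp (-s) times the numerator
  outgrows \<rho>.\<close>

lemma B_growth_0:
  assumes "p = - 1"
  shows "\<exists>s\<ge>a. \<not> (T s = 0 \<and> B s = 0)"
proof (rule ccontr)
  assume "\<not> ?thesis"
  then have A: "T s = 0" "B s = 0" if "a \<le> s" for s using that by auto
  have "{n. 1 < y n * exp (real k * s)} = {}" if "a \<le> s" for s
    using B_T_0[OF A(1)[OF that]] A[OF that] Im_psi_0(2)[OF reg_cu, of s] assms k_pos by auto
  then have y0: "y n = 0" for n using Y.zero_of_no_large[OF _ k_pos] by blast
  then obtain n where "x n \<noteq> 0" using nontrivial by blast
  then have xn: "0 < x n" using X.nonneg[of n] by simp
  obtain s where s: "a \<le> s" "\<rho> * exp s < x n * exp (real k * s)"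
    using exp_growth[of "x n" a \<rho>] xn by auto
  have e: "exp (of_nat k * Complex s 0) = of_real (exp (real k * s))"
    by (simp add: complex_eq_iff Re_exp Im_exp)
  have "exp (- s) * (\<rho> * exp s) < exp (- s) * (x n * exp (real k * s))"
    using s(2) by (intro mult_strict_left_mono) auto
  also have "\<dots> \<le> exp (- s) * cmod (gprod x (exp (of_nat k * Complex s 0)))"
    unfolding e using X.gprod_real_ge[of "exp (real k * s)" n] by (intro mult_left_mono) (auto simp: mult.commute)
  also have "exp (- s) * (\<rho> * exp s) = \<rho>" by (simp add: exp_minus)
  finally have "\<rho> < exp (- s) * cmod (gprod x (exp (of_nat k * Complex s 0)))" .
  moreover have "real_of_int p = - 1" using assms by simp
  then have "Dn (Complex s 0) = exp (- s) * cmod (gprod x (exp (of_nat k * Complex s 0))) - \<rho>"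
    by (simp only: Dn_def Y.gprod_zero_weights[OF y0]) simp
  ultimately have "0 < Dn (Complex s 0)" by simp
  moreover have "root (Complex s 0)" using root_cu[of s] A(1)[OF s(1)] by simp
  ultimately show False using w_nz by (auto simp: root_def)
qed

section \<open>Symmetries of the quotient\<close>

lemma Fn_cnj: "Fn (cnj z) = cnj (Fn z)"
proof -
  have "gprod y (- (cnj z ^ k)) = cnj (gprod y (- (z ^ k)))"
    using Y.gprod_cnj[of "- (z ^ k)"] by simp
  moreover have "gprod x (cnj z ^ k) = cnj (gprod x (z ^ k))"
    using X.gprod_cnj[of "z ^ k"] by simp
  ultimately show ?thesis by (simp add: Fn_def)
qed

lemma rot_power: "(z * cis (w * (2 * of_int m))) ^ k = z ^ k"
proof -
  have "cis (w * (2 * of_int m)) ^ k = cis (real k * w * (2 * of_int m))"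
    by (simp add: Complex.DeMoivre mult.assoc)
  also have "\<dots> = cis 0"
    unfolding kw cis_eq_iff by (intro exI[of _ m]) simp
  finally show ?thesis by (simp add: power_mult_distrib)
qed

lemma Fn_rot: "Fn (z * cis (w * (2 * of_int m))) = Fn z * cis (w * (2 * of_int (p * m)))"
  unfolding Fn_def rot_power
  by (simp add: power_int_mult_distrib cis_power_int mult_ac)

end

text \<open>\<open>H\<close> enters only through its zero set and a local factorisation of Fn minus
  the level, which treats H_1 and H_2 alike. The clause on the denominator keeps poles of the
  quotient, where division yields a default value, out of the zero set.\<close>

locale quotient_level = product_quotient +
  fixes t0 :: real and H :: "complex \<Rightarrow> complex"
  assumes cop: "coprime p (int k)"
    and H_zero: "H z = 0 \<longleftrightarrow> z \<noteq> 0 \<and> gprod y (- (z ^ k)) \<noteq> 0 \<and> Fn z = pol k \<rho> t0"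
    and H_order: "H z = 0 \<Longrightarrow> \<exists>N G. 0 < N \<and> zorder H z = int N \<and> isCont G z \<and> G z \<noteq> 0 \<and>
       (\<forall>\<^sub>F v in nhds z. Fn v - pol k \<rho> t0 = G v * (v - z) ^ N)"
begin

definition \<theta> :: "real \<Rightarrow> real" where "\<theta> s = T s / w"

lemma T_theta: "T s = w * \<theta> s"
  by (simp add: \<theta>_def)

lemma theta_cases: "\<theta> s = 0 \<longleftrightarrow> T s = 0" "\<theta> s = 1 \<longleftrightarrow> T s = w" "0 < \<theta> s \<longleftrightarrow> 0 < T s" "\<theta> s < 1 \<longleftrightarrow> T s < w"
proof -
  have "\<not> w < 0" using w_pos by linarith
  then show "\<theta> s = 0 \<longleftrightarrow> T s = 0" "\<theta> s = 1 \<longleftrightarrow> T s = w" "0 < \<theta> s \<longleftrightarrow> 0 < T s" "\<theta> s < 1 \<longleftrightarrow> T s < w"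
    unfolding T_theta by (simp_all add: zero_less_mult_iff)
qed

lemma k_gt_0: "0 < k" using k2 by simp

lemma pol_plus: "pol k (exp s) (2 * of_int m + t / w) = exp (Complex s t) * cis (w * (2 * of_int m))"
proof -
  have "pi / real k * (2 * of_int m + t / w) = t + w * (2 * of_int m)"
    using w_nz unfolding w_def[symmetric] by (simp add: distrib_left)
  then show ?thesis by (simp add: pol_def exp_eq_polar cis_mult)
qed

lemma pol_minus: "pol k (exp s) (2 * of_int m - t / w) = cnj (exp (Complex s t)) * cis (w * (2 * of_int m))"
proof -
  have "pi / real k * (2 * of_int m - t / w) = - t + w * (2 * of_int m)"
    using w_nz unfolding w_def[symmetric] by (simp add: right_diff_distrib)
  then show ?thesis by (simp add: pol_def exp_eq_polar cis_mult cis_cnj)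
qed

lemma gprod_y_plus: "gprod y (- ((exp u * cis (w * (2 * of_int m))) ^ k)) = gprod y (- exp (of_nat k * u))"
  unfolding rot_power by (simp add: exp_of_nat_mult)

lemma gprod_y_minus: "gprod y (- ((cnj (exp u) * cis (w * (2 * of_int m))) ^ k)) = cnj (gprod y (- exp (of_nat k * u)))"
  unfolding rot_power using Y.gprod_cnj[of "- exp (of_nat k * u)"] by (simp add: exp_of_nat_mult)

lemma norm_Fn_exp: "cmod (Fn (exp u)) = exp (of_int p * Re u) * cmod (gprod x (exp (of_nat k * u))) / cmod (gprod y (- exp (of_nat k * u)))"
  by (simp add: Fn_exp norm_mult norm_divide)

lemma norm_level: "cmod (pol k \<rho> t0) = \<rho>"
  by (rule norm_pol[OF \<rho>_pos])

lemma root_of_norm: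
  assumes "0 \<le> t" "t \<le> w" "gprod y (- exp (of_nat k * Complex s t)) \<noteq> 0" "cmod (Fn (exp (Complex s t))) = \<rho>"
  shows "T s = t"
proof (rule T_eqI)
  have "Dn (Complex s t) = 0" using assms(3,4) unfolding norm_Fn_exp by (simp add: Dn_def field_simps)
  then show "root (Complex s t)" using assms by (simp add: root_def strip_def)
qed

lemma zero_form:
  assumes "H z = 0"
  shows "\<exists>s (m::int). z = pol k (exp s) (2 * of_int m + \<theta> s) \<or> z = pol k (exp s) (2 * of_int m - \<theta> s)"
proof -
  have z: "z \<noteq> 0" "gprod y (- (z ^ k)) \<noteq> 0" "Fn z = pol k \<rho> t0" using assms H_zero by auto
  define s where "s = ln (cmod z)"
  \<comment> \<open>The nearest even multiple of \<open>w\<close> leaves an angle of absolute value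
    at most \<open>w\<close>; conjugation takes care of a negative remainder.\<close>
  define m where "m = round (Arg z / (2 * w))"
  define t where "t = \<bar>Arg z - w * (2 * of_int m)\<bar>"
  have es: "exp s = cmod z" using z(1) by (simp add: s_def)
  have "\<bar>of_int m - Arg z / (2 * w)\<bar> \<le> 1 / 2" unfolding m_def by (rule of_int_round_abs_le)
  then have "2 * w * \<bar>of_int m - Arg z / (2 * w)\<bar> \<le> 2 * w * (1 / 2)" by (intro mult_left_mono) (auto intro: less_imp_le)
  moreover have "2 * w * \<bar>of_int m - Arg z / (2 * w)\<bar> = \<bar>2 * w * (of_int m - Arg z / (2 * w))\<bar>"
    by (simp add: abs_mult abs_of_pos[OF w_pos])
  moreover have "2 * w * (of_int m - Arg z / (2 * w)) = - (Arg z - w * (2 * of_int m))"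
    using w_nz by (simp add: field_simps)
  ultimately have t: "0 \<le> t" "t \<le> w" unfolding t_def by auto
  have zpol: "z = of_real (exp s) * cis (Arg z)" using rcis_cmod_Arg[of z] es by (simp add: rcis_def)
  have "z = pol k (exp s) (2 * of_int m + t / w) \<or> z = pol k (exp s) (2 * of_int m - t / w)"
  proof (cases "0 \<le> Arg z - w * (2 * of_int m)")
    case True
    then have "Arg z = t + w * (2 * of_int m)" by (simp add: t_def)
    then have "z = exp (Complex s t) * cis (w * (2 * of_int m))"
      using zpol by (simp add: exp_eq_polar cis_mult mult.assoc)
    then show ?thesis unfolding pol_plus by simp
  next
    case False
    then have "Arg z = - t + w * (2 * of_int m)" by (simp add: t_def)
    then have "z = cnj (exp (Complex s t)) * cis (w * (2 * of_int m))"
      using zpol by (simp add: exp_eq_polar cis_mult cis_cnj mult.assoc)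
    then show ?thesis unfolding pol_minus by simp
  qed
  moreover have "T s = t"
  proof (rule root_of_norm[OF t])
    have zz: "z = exp (Complex s t) * cis (w * (2 * of_int m)) \<or> z = cnj (exp (Complex s t)) * cis (w * (2 * of_int m))"
      using calculation unfolding pol_plus pol_minus .
    then show "gprod y (- exp (of_nat k * Complex s t)) \<noteq> 0"
      using z(2) gprod_y_plus gprod_y_minus by (metis complex_cnj_zero)
    have "cmod (Fn z) = cmod (Fn (exp (Complex s t)))"
      using zz by (auto simp: Fn_rot Fn_cnj norm_mult)
    then show "cmod (Fn (exp (Complex s t))) = \<rho>" using z(3) norm_level by simp
  qed
  ultimately show ?thesis unfolding \<theta>_def by blast
qed

lemma Fn_cu: "Fn (exp (cu s)) = pol k (exp (R (cu s))) (B s)"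
proof -
  have "pi / real k * B s = Im (psi (cu s))" unfolding B_def w_def[symmetric] by simp
  then show ?thesis
    by (simp add: exp_psi[OF reg_cu, symmetric] pol_def exp_eq_polar[of "psi (cu s)"] R_def)
qed

lemma pol_rot: "pol k r b * cis (w * a) = pol k r (b + a)"
  by (simp add: pol_def w_def mult.assoc cis_mult distrib_left add_divide_distrib)

lemma exp_R_level: "exp (R (cu s)) = \<rho> \<longleftrightarrow> s \<in> Z"
  using \<rho>_pos Z_R by (metis exp_ln ln_exp)

lemma zero_plus:
  "H (pol k (exp s) (2 * of_int m + \<theta> s)) = 0 \<longleftrightarrow>
       s \<in> Z \<and> (\<exists>n::int. B s = t0 + 2 * of_int n \<and> [p * m = - n] (mod int k))"
proof -
  let ?z = "exp (cu s) * cis (w * (2 * of_int m))"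
  have "H ?z = 0 \<longleftrightarrow> Fn ?z = pol k \<rho> t0"
    unfolding H_zero gprod_y_plus using reg_cu[of s] by (simp add: reg_iff)
  also have "Fn ?z = pol k (exp (R (cu s))) (B s + 2 * of_int (p * m))"
    unfolding Fn_rot Fn_cu by (rule pol_rot)
  also have "\<dots> = pol k \<rho> t0 \<longleftrightarrow> s \<in> Z \<and> (\<exists>N::int. B s + 2 * of_int (p * m) = t0 + 2 * real k * of_int N)"
    using \<rho>_pos by (subst pol_eq_iff[OF k_gt_0]) (auto simp: exp_R_level)
  also have "(\<exists>N::int. B s + 2 * of_int (p * m) = t0 + 2 * real k * of_int N) \<longleftrightarrow>
     (\<exists>n::int. B s = t0 + 2 * of_int n \<and> [p * m = - n] (mod int k))"
  proof
    assume "\<exists>N::int. B s + 2 * of_int (p * m) = t0 + 2 * real k * of_int N"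
    then obtain N :: int where N: "B s + 2 * of_int (p * m) = t0 + 2 * real k * of_int N" by blast
    have "B s = t0 + 2 * of_int (int k * N - p * m)" using N by simp
    moreover have "[p * m = - (int k * N - p * m)] (mod int k)"
      unfolding cong_iff_lin by (rule exI[of _ "- N"]) simp
    ultimately show "\<exists>n::int. B s = t0 + 2 * of_int n \<and> [p * m = - n] (mod int k)" by blast
  next
    assume "\<exists>n::int. B s = t0 + 2 * of_int n \<and> [p * m = - n] (mod int k)"
    then obtain n N where n: "B s = t0 + 2 * of_int n" "- n = p * m + int k * N" unfolding cong_iff_lin by blast
    have "n = - p * m + int k * (- N)" using n(2) by simp
    then show "\<exists>N::int. B s + 2 * of_int (p * m) = t0 + 2 * real k * of_int N"
      using n(1) by (intro exI[of _ "- N"]) simp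
  qed
  finally show ?thesis by (simp only: \<theta>_def pol_plus)
qed

lemma zero_minus:
  "H (pol k (exp s) (2 * of_int m - \<theta> s)) = 0 \<longleftrightarrow>
       s \<in> Z \<and> (\<exists>n::int. B s = - t0 + 2 * of_int n \<and> [p * m = n] (mod int k))"
proof -
  let ?z = "cnj (exp (cu s)) * cis (w * (2 * of_int m))"
  have "H ?z = 0 \<longleftrightarrow> Fn ?z = pol k \<rho> t0"
    unfolding H_zero gprod_y_minus using reg_cu[of s] by (simp add: reg_iff)
  also have "Fn ?z = pol k (exp (R (cu s))) (- B s + 2 * of_int (p * m))"
    unfolding Fn_rot Fn_cnj Fn_cu cnj_pol by (rule pol_rot)
  also have "\<dots> = pol k \<rho> t0 \<longleftrightarrow> s \<in> Z \<and> (\<exists>N::int. - B s + 2 * of_int (p * m) = t0 + 2 * real k * of_int N)"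
    using \<rho>_pos by (subst pol_eq_iff[OF k_gt_0]) (auto simp: exp_R_level)
  also have "(\<exists>N::int. - B s + 2 * of_int (p * m) = t0 + 2 * real k * of_int N) \<longleftrightarrow>
     (\<exists>n::int. B s = - t0 + 2 * of_int n \<and> [p * m = n] (mod int k))"
  proof
    assume "\<exists>N::int. - B s + 2 * of_int (p * m) = t0 + 2 * real k * of_int N"
    then obtain N :: int where N: "- B s + 2 * of_int (p * m) = t0 + 2 * real k * of_int N" by blast
    have "B s = - t0 + 2 * of_int (p * m - int k * N)" using N by simp
    moreover have "[p * m = p * m - int k * N] (mod int k)"
      unfolding cong_iff_lin by (rule exI[of _ "- N"]) simp
    ultimately show "\<exists>n::int. B s = - t0 + 2 * of_int n \<and> [p * m = n] (mod int k)" by blast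
  next
    assume "\<exists>n::int. B s = - t0 + 2 * of_int n \<and> [p * m = n] (mod int k)"
    then obtain n N where n: "B s = - t0 + 2 * of_int n" "n = p * m + int k * N" unfolding cong_iff_lin by blast
    then show "\<exists>N::int. - B s + 2 * of_int (p * m) = t0 + 2 * real k * of_int N"
      by (intro exI[of _ "- N"]) simp
  qed
  finally show ?thesis by (simp only: \<theta>_def pol_minus)
qed

lemma zero_expansion:
  assumes "H z = 0" "cmod z = exp s"
  obtains N c where "expansion s N c" "zorder H z = int N" "s \<in> Z"
proof -
  obtain N G where NG: "0 < N" "zorder H z = int N" "isCont G z" "G z \<noteq> 0"
    "\<forall>\<^sub>F v in nhds z. Fn v - pol k \<rho> t0 = G v * (v - z) ^ N"
    using H_order[OF assms(1)] by blast
  have z: "z \<noteq> 0" "Fn z = pol k \<rho> t0" using assms(1) H_zero by auto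
  have b: "pol k \<rho> t0 \<noteq> 0" by (rule pol_nz[OF \<rho>_pos])
  obtain s' and m :: int where "z = pol k (exp s') (2 * of_int m + \<theta> s') \<or> z = pol k (exp s') (2 * of_int m - \<theta> s')"
    using zero_form[OF assms(1)] by blast
  moreover from this have "cmod z = exp s'" using norm_pol[of "exp s'" k] by auto
  ultimately have zs: "z = pol k (exp s) (2 * of_int m + \<theta> s) \<or> z = pol k (exp s) (2 * of_int m - \<theta> s)"
    using assms(2) by simp
  then have sZ: "s \<in> Z" using assms(1) zero_plus zero_minus by blast
  from zs have "\<exists>c. expansion s N c"
  proof
    assume "z = pol k (exp s) (2 * of_int m + \<theta> s)"
    then have zp: "z = exp (cu s) * cis (w * (2 * of_int m))" by (simp only: \<theta>_def pol_plus)
    show ?thesis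
    proof (rule expansionI[OF NG(1) b NG(3,4) z(1) NG(5), where cj = "\<lambda>z. z"])
      fix h assume r: "reg (cu s + h)"
      have "z * exp h = exp (cu s + h) * cis (w * (2 * of_int m))" unfolding zp exp_add by (simp only: mult_ac)
      then have "Fn (z * exp h) = exp (psi (cu s + h)) * cis (w * (2 * of_int (p * m)))"
        by (simp only: Fn_rot exp_psi[OF r])
      also have "\<dots> = exp (psi (cu s)) * cis (w * (2 * of_int (p * m))) * exp (psi (cu s + h) - psi (cu s))"
        by (simp add: exp_diff)
      also have "exp (psi (cu s)) * cis (w * (2 * of_int (p * m))) = pol k \<rho> t0"
        using z(2) unfolding zp Fn_rot exp_psi[OF reg_cu] .
      finally show "Fn (z * exp h) = pol k \<rho> t0 * exp (psi (cu s + h) - psi (cu s))" .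
    qed simp
  next
    assume "z = pol k (exp s) (2 * of_int m - \<theta> s)"
    then have zp: "z = cnj (exp (cu s)) * cis (w * (2 * of_int m))" by (simp only: \<theta>_def pol_minus)
    show ?thesis
    proof (rule expansionI[OF NG(1) b NG(3,4) z(1) NG(5), where cj = cnj])
      fix h assume r: "reg (cu s + h)"
      have "z * exp (cnj h) = cnj (exp (cu s + h)) * cis (w * (2 * of_int m))"
        unfolding zp exp_add complex_cnj_mult exp_cnj by (simp only: mult_ac)
      then have "Fn (z * exp (cnj h)) = cnj (exp (psi (cu s + h))) * cis (w * (2 * of_int (p * m)))"
        by (simp only: Fn_rot Fn_cnj exp_psi[OF r])
      also have "\<dots> = cnj (exp (psi (cu s))) * cis (w * (2 * of_int (p * m))) * cnj (exp (psi (cu s + h) - psi (cu s)))"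
        by (simp add: exp_diff)
      also have "cnj (exp (psi (cu s))) * cis (w * (2 * of_int (p * m))) = pol k \<rho> t0"
        using z(2) unfolding zp Fn_rot Fn_cnj exp_psi[OF reg_cu] .
      finally show "Fn (z * exp (cnj h)) = pol k \<rho> t0 * cnj (exp (psi (cu s + h) - psi (cu s)))" .
    qed simp
  qed
  then show ?thesis using that NG(2) sZ by blast
qed

sublocale zc: zero_curve k p t0 \<theta> B Z H
proof
  show "2 \<le> k" by (rule k2)
  show "coprime p (int k)" by (rule cop)
  show "0 \<le> \<theta> s" "\<theta> s \<le> 1" for s using T_range[of s] by (simp_all add: \<theta>_def less_imp_le)
  show "s \<le> s' \<Longrightarrow> B s \<le> B s'" for s s' by (rule mono_B)
  show "s < s' \<Longrightarrow> B s = B s' \<Longrightarrow> \<theta> s = \<theta> s' \<and> \<theta> s \<in> {0, 1}" for s s'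
    using B_step(2)[of s s'] by (auto simp: \<theta>_def)
  show "\<theta> s = 0 \<Longrightarrow> \<exists>n::nat. B s = real k * real n" for s
    using B_T_0[of s] by (auto simp: theta_cases)
  show "\<theta> s = 1 \<Longrightarrow> \<exists>n::nat. B s = of_int p + real k * real n" for s
    using B_T_w[of s] by (auto simp: theta_cases)
  show "a < b \<Longrightarrow> B a \<le> \<mu> \<Longrightarrow> \<mu> \<le> B b \<Longrightarrow> B a \<noteq> B b \<Longrightarrow> \<exists>s\<in>Z. a \<le> s \<and> s \<le> b \<and> B s = \<mu>" for a b \<mu>
    by (rule B_level)
  show "H z = 0 \<Longrightarrow> cmod z = exp s \<Longrightarrow> 0 < \<theta> s \<Longrightarrow> \<theta> s < 1 \<Longrightarrow> zorder H z = 1" for z s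
    using zero_expansion[of z s] expansion_inner by (metis of_nat_1 theta_cases(3,4))
  show "H z = 0 \<Longrightarrow> cmod z = exp s \<Longrightarrow> \<theta> s \<in> {0, 1} \<Longrightarrow>
       zorder H z = 1 \<and> (\<exists>a>s. B a = B s) \<and> (\<forall>a<s. B a \<noteq> B s) \<or>
       zorder H z = 1 \<and> (\<exists>a<s. B a = B s) \<and> (\<forall>a>s. B a \<noteq> B s) \<or>
       zorder H z = 2 \<and> (\<forall>a. a \<noteq> s \<longrightarrow> B a \<noteq> B s)" for z s
  proof -
    assume a: "H z = 0" "cmod z = exp s" "\<theta> s \<in> {0, 1}"
    obtain N c where N: "expansion s N c" "zorder H z = int N" "s \<in> Z" using zero_expansion[OF a(1,2)] by blast
    have T: "T s \<in> {0, w}" using a(3) theta_cases by auto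
    show ?thesis using expansion_boundary_B[OF N(1) T N(3)] N(2) by auto
  qed
  show "p = 1 \<Longrightarrow> \<exists>s\<ge>a. \<not> (\<theta> s = 1 \<and> B s = 1)" for a
    unfolding theta_cases by (rule B_growth_w)
  show "p = - 1 \<Longrightarrow> \<exists>s\<ge>a. \<not> (\<theta> s = 0 \<and> B s = 0)" for a
    unfolding theta_cases by (rule B_growth_0)
qed (rule zero_plus zero_minus zero_form B_start; assumption?)+

end

subsection \<open>The zeros in terms of the level\<close>

context zero_curve begin

lemma Q_cong:
  assumes "[a = b] (mod int k)" shows "Q k (2 * a) = Q k (2 * b)"
proof -
  obtain N :: int where "real_of_int a = of_int b + real k * of_int N" using cong_kD[OF assms] by blast
  then have "eunit k (- (2 * a)) = eunit k (- (2 * b))"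
    unfolding eunit_cis cis_eq_iff using k0 by (intro exI[of _ "- N"]) (simp add: field_simps)
  then show ?thesis by (simp add: Q_def)
qed

lemma b0_int: "b0 = of_int (if 0 < p then 0 else p)"
  by (simp add: b0_def)

lemma zeros_nonreal:
  assumes \<rho>: "0 < \<rho>" and q: "of_int (2 * q - \<kappa>) \<le> t0" "t0 < of_int (2 * q - \<kappa>) + 1"
    and I: "Im (pol k \<rho> t0 ^ k) \<noteq> 0"
  shows "(\<forall>z. H z = 0 \<longrightarrow> zorder H z = 1 \<and> Im (z ^ k) \<noteq> 0) \<and>
          (\<forall>z w. H z = 0 \<and> H w = 0 \<and> z \<noteq> w \<longrightarrow> cmod z \<noteq> cmod w) \<and>
          (\<forall>z w. \<forall>m \<sigma> :: int. next_zero H z w \<and> \<sigma> \<in> {0, 1} \<and> z \<in> Q k (2 * m - \<sigma>) \<longrightarrow>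
             (\<exists>l :: int. [p * (l + m) = 2 * q + 1 - \<kappa> - \<sigma>] (mod int k) \<and>
                w \<in> Q k (2 * l - 1 + \<sigma>)))"
proof -
  have t0: "t0 \<notin> \<int>" using I Im_pol_power[OF k0 \<rho>] by blast
  have "cmod z \<noteq> cmod v" if "H z = 0" "H v = 0" "z \<noteq> v" for z v
    using nonint_distinct_radius[OF t0 that(1,2)] that cmod_eq_rad[OF that(1,2)] by blast
  then show ?thesis using nonint_simple[OF t0] nonint_Im_power[OF t0] nonint_next[OF _ _ _ q t0] by blast
qed

text \<open>The condition on s says that t0 + p s is a multiple of k, which is the congruence
  required of S.\<close>

lemma int_curve:
  assumes \<rho>: "0 < \<rho>" and "t0 = of_int \<tau>" and "Im (pol k \<rho> t0 * eunit k (p * s)) = 0"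
  shows "zero_curve_int k p t0 \<theta> B Z H \<tau> s"
proof
  show "t0 = of_int \<tau>" by fact
  obtain n :: int where "t0 + of_int (p * s) = real k * of_int n"
    using assms(3) Im_pol_eq_0[OF k0 \<rho>] by (auto simp: pol_eunit)
  then have "real_of_int (p * s) = of_int (- \<tau>) + real k * of_int n" using assms(2) by simp
  then show "[p * s = - \<tau>] (mod int k)" by (rule cong_kI)
qed

lemma zeros_real:
  assumes \<rho>: "0 < \<rho>" and I: "Im (pol k \<rho> t0 ^ k) = 0" and s: "Im (pol k \<rho> t0 * eunit k (p * s)) = 0"
  shows "let star = (\<lambda>z. cnj z * eunit k (- 2 * s)) in
              (\<forall>z. H z = 0 \<longrightarrow> {w. H w = 0 \<and> cmod w = cmod z} = {z, star z}) \<and>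
              (\<forall>z. \<forall>m l :: int. H z = 0 \<and> [p * (m - l) = 1] (mod int k) \<and>
                 z \<in> Q k (2 * m) \<union> Q k (- 2 * s - 2 * m - 1) \<longrightarrow>
                   z \<noteq> star z \<and> zorder H z = 1 \<and> zorder H (star z) = 1 \<and>
                   (\<forall>w. next_zero H z w \<longrightarrow>
                      w \<in> Qbar k (2 * l) \<union> Qbar k (- 2 * s - 2 * l - 1))) \<and>
              (\<forall>z w. next_zero H z w \<and> z = star z \<and> Arg z = Arg w \<longrightarrow>
                 zorder H z = 1 \<and> zorder H w = 1 \<and>
                 (\<forall>v. next_zero H v z \<longrightarrow> Arg v \<noteq> Arg z) \<and>
                 (\<forall>v. next_zero H w v \<longrightarrow> Arg v \<noteq> Arg w)) \<and>
              (\<forall>z w. next_zero H z w \<and> z = star z \<and> Arg z \<noteq> Arg w \<longrightarrow>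
                 zorder H z \<in> {1, 2} \<and>
                 (\<forall>v. next_zero H v z \<longrightarrow>
                    (zorder H z = 1 \<longleftrightarrow> Arg z = Arg v) \<and>
                    (zorder H z = 2 \<longleftrightarrow> Arg z \<noteq> Arg v)) \<and>
                 (\<forall>m l :: int. [p * (m - l) = 1] (mod int k) \<and>
                    z \<in> Qbar k (2 * m) \<inter> Qbar k (- 2 * s - 2 * m - 1) \<longrightarrow>
                      w \<in> Qbar k (2 * l) \<union> Qbar k (- 2 * s - 2 * l - 1))) \<and>
              (\<forall>z. H z = 0 \<and> z = star z \<and> \<not> (\<exists>w. next_zero H z w) \<longrightarrow> zorder H z \<le> 2)"
proof -
  obtain \<tau> :: int where \<tau>: "t0 = of_int \<tau>" using I Im_pol_power[OF k0 \<rho>] by (auto elim: Ints_cases)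
  interpret zi: zero_curve_int k p t0 \<theta> B Z H \<tau> s by (rule int_curve[OF \<rho> \<tau> s])
  have st: "(\<lambda>z. cnj z * eunit k (- 2 * s)) = zi.star" by (simp add: zi.star_def fun_eq_iff)
  show ?thesis
    unfolding Let_def st
    by (intro conjI; intro allI impI; (elim conjE)?;
        rule zi.zeros_of_radius zi.inner_zero zi.next_same_Arg zi.next_distinct_Arg zi.order_le_2)
qed

text \<open>Levels of the same family differ by even integers. A level of the other family adds up
  with this one to an even integer greater than 2 b0, hence at least 2 b0 + 2, and so lies above b0
  + 1.\<close>

lemma plus_first:
  assumes d: "b0 < t0 + 2 * of_int n" "t0 + 2 * of_int n < b0 + 1" and \<nu>: "\<nu> \<in> Lev" "b0 \<le> \<nu>"
  shows "t0 + 2 * of_int n \<le> \<nu>"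
proof -
  obtain b :: int where b: "b0 = of_int b" using b0_int by blast
  obtain n' :: int where "\<nu> = t0 + 2 * of_int n' \<or> \<nu> = - t0 + 2 * of_int n'" using \<nu>(1) by (auto simp: Lev_def)
  then show ?thesis
  proof
    assume n': "\<nu> = t0 + 2 * of_int n'"
    then have "real_of_int (2 * n) < of_int (2 * n' + 1)" using d \<nu> by simp
    then have "n \<le> n'" unfolding of_int_less_iff by linarith
    then show ?thesis using n' by simp
  next
    assume n': "\<nu> = - t0 + 2 * of_int n'"
    then have "real_of_int (b - n - n') < 0" using d \<nu> b by simp
    then have "b - n - n' \<le> - 1" by simp
    then have "real_of_int (b - n - n') \<le> - 1" by (metis of_int_le_iff of_int_minus of_int_1)
    then show ?thesis using n' d b by simp
  qed
qed

lemma minus_first: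
  assumes d: "b0 < - t0 + 2 * of_int n" "- t0 + 2 * of_int n < b0 + 1" and \<nu>: "\<nu> \<in> Lev" "b0 \<le> \<nu>"
  shows "- t0 + 2 * of_int n \<le> \<nu>"
proof -
  obtain b :: int where b: "b0 = of_int b" using b0_int by blast
  obtain n' :: int where "\<nu> = t0 + 2 * of_int n' \<or> \<nu> = - t0 + 2 * of_int n'" using \<nu>(1) by (auto simp: Lev_def)
  then show ?thesis
  proof
    assume n': "\<nu> = - t0 + 2 * of_int n'"
    then have "real_of_int (2 * n) < of_int (2 * n' + 1)" using d \<nu> by simp
    then have "n \<le> n'" unfolding of_int_less_iff by linarith
    then show ?thesis using n' by simp
  next
    assume n': "\<nu> = t0 + 2 * of_int n'"
    then have "real_of_int (b - n - n') < 0" using d \<nu> b by simp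
    then have "b - n - n' \<le> - 1" by simp
    then have "real_of_int (b - n - n') \<le> - 1" by (metis of_int_le_iff of_int_minus of_int_1)
    then show ?thesis using n' d b by simp
  qed
qed

lemma nonint_of_strict: "of_int a < t0 \<Longrightarrow> t0 < of_int a + 1 \<Longrightarrow> t0 \<notin> \<int>"
proof
  assume a: "of_int a < t0" "t0 < of_int a + 1" "t0 \<in> \<int>"
  then obtain b :: int where "t0 = of_int b" by (auto elim: Ints_cases)
  then have "real_of_int a < of_int b" "real_of_int b < of_int (a + 1)" using a by simp_all
  then show False unfolding of_int_less_iff by linarith
qed

lemma small_multiple:
  assumes "\<bar>2 * real k * of_int n\<bar> < 1" shows "n = 0"
proof (rule ccontr)
  assume "n \<noteq> 0"
  then have "1 \<le> \<bar>real_of_int n\<bar>" by simp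
  then have "1 * 1 \<le> 2 * real k * \<bar>real_of_int n\<bar>" using k2 by (intro mult_mono) auto
  then show False using assms by (simp add: abs_mult)
qed

lemma level_in_Q:
  assumes \<rho>: "0 < \<rho>" and q: "of_int j \<le> t0" "t0 < of_int j + 1" and Q: "pol k \<rho> t0 \<in> Q k j"
  shows "of_int j < t0"
proof -
  obtain n :: int where n: "of_int j < t0 + 2 * real k * of_int n" "t0 + 2 * real k * of_int n < of_int j + 1"
    using Q Q_pol[OF k0 \<rho>] by blast
  then have "\<bar>2 * real k * of_int n\<bar> < 1" using q by linarith
  then have "n = 0" by (rule small_multiple)
  then show ?thesis using n by simp
qed

lemma level_pos_real:
  assumes \<rho>: "0 < \<rho>" and q: "of_int j \<le> t0" "t0 < of_int j + 1" and P: "pos_real (pol k \<rho> t0 * eunit k (- j))"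
  shows "t0 = of_int j"
proof -
  obtain n :: int where n: "t0 + of_int (- j) = 2 * real k * of_int n"
    using P pos_real_pol[OF k0 \<rho>] by (auto simp: pol_eunit)
  then have "\<bar>2 * real k * of_int n\<bar> < 1" using q by linarith
  then have "n = 0" by (rule small_multiple)
  then show ?thesis using n by simp
qed

lemma int_level:
  assumes "of_int j \<le> t0" "t0 < of_int j + 1" "t0 = of_int \<tau>" shows "\<tau> = j"
proof -
  have "real_of_int j \<le> of_int \<tau>" "real_of_int \<tau> < of_int (j + 1)" using assms by simp_all
  then show ?thesis unfolding of_int_le_iff of_int_less_iff by linarith
qed

lemma pos_real_pol_0: "0 < r \<Longrightarrow> [a = b] (mod int k) \<Longrightarrow> pos_real (pol k r (2 * of_int a - 2 * of_int b))"
proof -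
  assume r: "0 < r" and "[a = b] (mod int k)"
  then obtain N :: int where "real_of_int a = of_int b + real k * of_int N" using cong_kD by blast
  then have "2 * real_of_int a - 2 * of_int b = 2 * real k * of_int N" by simp
  then show ?thesis using pos_real_pol[OF k0 r] by blast
qed

lemma pls_ne_mns:
  assumes "0 < \<theta> s" "\<theta> s < 1" shows "pls s a \<noteq> mns s b"
proof
  assume "pls s a = mns s b"
  then obtain N :: int where "2 * of_int a + \<theta> s = 2 * of_int b - \<theta> s + 2 * real k * of_int N"
    using pol_eq_iff[OF k0] by auto
  then have "\<theta> s = of_int (b - a + int k * N)" by simp
  then have "0 < b - a + int k * N" "b - a + int k * N < 1" using assms by linarith+
  then show False by linarith
qed

section \<open>First zeros in the sectors of the theorem\<close>

lemma first_zero_pos: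
  assumes \<rho>: "0 < \<rho>" and q: "of_int (2 * q - \<kappa>) \<le> t0" "t0 < of_int (2 * q - \<kappa>) + 1" and \<kappa>: "\<kappa> \<in> {0, 1}"
    and ppos: "0 < p" and ex: "\<exists>z. H z = 0" and m: "[p * m = q] (mod int k)"
    and nn: "\<not> neg_real (pol k \<rho> t0 ^ k)"
  defines "\<alpha> \<equiv> pol k \<rho> t0"
  shows "\<exists>z. simple_separate_first_zero H z \<and>
                  (\<alpha> \<in> Q k (2 * q - \<kappa>) \<longrightarrow> z \<in> Q k (2 * m - \<kappa>)) \<and>
                  (pos_real (\<alpha> * eunit k (- 2 * q)) \<longrightarrow> pos_real (z * eunit k (- 2 * m)))"
proof (cases "t0 \<in> \<int>")
  case False
  have b0: "b0 = 0" using ppos by (simp add: b0_def)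
  from False have qs: "of_int (2 * q - \<kappa>) < t0" using q by (metis Ints_of_int order_le_less)
  have np: "\<not> pos_real (\<alpha> * eunit k (- 2 * q))"
  proof
    assume "pos_real (\<alpha> * eunit k (- 2 * q))"
    then obtain n :: int where "t0 + of_int (- 2 * q) = 2 * real k * of_int n"
      using pos_real_pol[OF k0 \<rho>] unfolding \<alpha>_def pol_eunit by blast
    then have "t0 = of_int (2 * q + 2 * int k * n)" by simp
    then show False using False by simp
  qed
  show ?thesis
  proof (cases "\<kappa> = 0")
    case True
    have d: "b0 < t0 + 2 * of_int (- q)" "t0 + 2 * of_int (- q) < b0 + 1" using qs q True b0 by simp_all
    have "\<exists>z. simple_separate_first_zero H z \<and> z \<in> Q k (2 * m)"
      by (rule nonint_first_plus[OF less_imp_le[OF d(1)] plus_first[OF d] ex q False]) (use m in auto)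
    then show ?thesis using np True by auto
  next
    case F: False
    then have k1: "\<kappa> = 1" using \<kappa> by auto
    have d: "b0 < - t0 + 2 * of_int q" "- t0 + 2 * of_int q < b0 + 1" using qs q k1 b0 by simp_all
    have "\<exists>z. simple_separate_first_zero H z \<and> z \<in> Q k (2 * m - 1)"
      by (rule nonint_first_minus[OF less_imp_le[OF d(1)] minus_first[OF d] ex q False m])
    then show ?thesis using np k1 by auto
  qed
next
  case True
  then obtain \<tau> :: int where \<tau>: "t0 = of_int \<tau>" by (auto elim: Ints_cases)
  have b0: "b0 = 0" using ppos by (simp add: b0_def)
  have "\<tau> = 2 * q - \<kappa>" by (rule int_level[OF q \<tau>])
  \<comment> \<open>An odd \<tau> would make \<alpha>^k negative. With \<tau> = 2 q - \<kappa> this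
    leaves \<kappa> = 0, and the starting value 0 is the level with n = -q.\<close>
  moreover have "even \<tau>" using nn neg_real_pol_power[OF k0 \<rho>] unfolding \<tau> by blast
  ultimately have k0': "\<kappa> = 0" "\<tau> = 2 * q" using \<kappa> by auto
  obtain S where S: "[p * S = - \<tau>] (mod int k)" using p_solve by blast
  interpret zi: zero_curve_int k p t0 \<theta> B Z H \<tau> S by unfold_locales (fact \<tau> S)+
  have "\<exists>s. simple_separate_first_zero H (pls s m) \<and> \<theta> s = (if 0 < p then 0 else 1)"
    by (rule zi.first_boundary[of "- q"]) (use b0 \<tau> k0' m ex in auto)
  then obtain s where s: "simple_separate_first_zero H (pls s m)" "\<theta> s = 0" using ppos by auto
  have "\<alpha> \<notin> Q k (2 * q - \<kappa>)" using level_in_Q[OF \<rho> q] \<tau> k0' unfolding \<alpha>_def by auto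
  moreover have "pos_real (pls s m * eunit k (- 2 * m))"
    using s(2) pos_real_pol_0[of "exp s" m m] by (simp add: pol_eunit)
  ultimately show ?thesis using s(1) by blast
qed

lemma first_two_zeros_pos:
  assumes \<rho>: "0 < \<rho>" and q: "of_int (2 * q - \<kappa>) \<le> t0" "t0 < of_int (2 * q - \<kappa>) + 1" and \<kappa>: "\<kappa> \<in> {0, 1}"
    and ppos: "0 < p" and ex: "\<exists>z. H z = 0" and m: "[p * m = q] (mod int k)"
    and ng: "neg_real (pol k \<rho> t0 ^ k)"
  defines "\<alpha> \<equiv> pol k \<rho> t0"
  shows "(\<exists>a b. first_two_zeros H a b) \<and>
               (\<forall>a b. first_two_zeros H a b \<longrightarrow>
                  (Arg a = Arg b \<and> p = 1 \<and>
                     pos_real (a * eunit k (- 2 * m + 1)) \<and> pos_real (b * eunit k (- 2 * m + 1))) \<or>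
                  (a \<noteq> b \<and> cmod a = cmod b \<and>
                     (\<forall>m' s :: int. [p * m' = q - 1] (mod int k) \<and>
                        Im (\<alpha> * eunit k (p * s)) = 0 \<longrightarrow>
                          Q k (2 * m') = Q k (- 2 * m - 2 * s) \<and>
                          (a \<in> Q k (2 * m - 1) \<and> b \<in> Q k (2 * m') \<or>
                           b \<in> Q k (2 * m - 1) \<and> a \<in> Q k (2 * m')))))"
proof -
  have "Im (\<alpha> ^ k) = 0" using ng unfolding \<alpha>_def by (rule neg_real_imp_Im)
  then obtain \<tau> :: int where \<tau>: "t0 = of_int \<tau>"
    using Im_pol_power[OF k0 \<rho>] unfolding \<alpha>_def by (auto elim: Ints_cases)
  have "\<tau> = 2 * q - \<kappa>" by (rule int_level[OF q \<tau>])
  moreover have "odd \<tau>" using ng neg_real_pol_power[OF k0 \<rho>] unfolding \<tau> by blast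
  ultimately have k1: "\<kappa> = 1" "\<tau> = 2 * q - 1" using \<kappa> by auto
  obtain S where S: "[p * S = - \<tau>] (mod int k)" using p_solve by blast
  interpret zi: zero_curve_int k p t0 \<theta> B Z H \<tau> S by unfold_locales (fact \<tau> S)+
  \<comment> \<open>The first level is 1 = t0 + 2 (1 - q), so n = 1 - q: the plus zero has index m1,
    and its partner has index m because n + \<tau> = q.\<close>
  obtain m1 where m1: "[p * m1 = q - 1] (mod int k)" using p_solve by blast
  have "\<exists>s. 0 < \<theta> s \<and> \<theta> s < 1 \<and> (\<forall>a b. first_two_zeros H a b \<longleftrightarrow> {a, b} = {pls s m1, mns s m} \<and> a \<noteq> b) \<or>
     (\<exists>s2. (p = 1 \<and> \<theta> s = 1 \<and> \<theta> s2 = 1 \<or> p = - 1 \<and> \<theta> s = 0 \<and> \<theta> s2 = 0) \<and>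
       (\<forall>a b. first_two_zeros H a b \<longleftrightarrow> a = pls s m1 \<and> b = pls s2 m1))"
    by (rule zi.first_two[of "1 - q"]) (use ppos \<tau> k1 m1 m ex in \<open>auto simp: b0_def\<close>)
  then obtain s where s: "0 < \<theta> s \<and> \<theta> s < 1 \<and> (\<forall>a b. first_two_zeros H a b \<longleftrightarrow> {a, b} = {pls s m1, mns s m} \<and> a \<noteq> b) \<or>
     (\<exists>s2. (p = 1 \<and> \<theta> s = 1 \<and> \<theta> s2 = 1) \<and>
       (\<forall>a b. first_two_zeros H a b \<longleftrightarrow> a = pls s m1 \<and> b = pls s2 m1))"
    using ppos by auto
  from s show ?thesis
  proof
    assume a: "0 < \<theta> s \<and> \<theta> s < 1 \<and> (\<forall>a b. first_two_zeros H a b \<longleftrightarrow> {a, b} = {pls s m1, mns s m} \<and> a \<noteq> b)"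
    have M: "mns s m \<in> Q k (2 * m - 1)" using a by (intro mns_Q_I) auto
    have P: "pls s m1 \<in> Q k (2 * m')" if "[p * m' = q - 1] (mod int k)" for m'
    proof (rule pls_Q_I)
      have "[p * m1 = p * m'] (mod int k)" using m1 that cong_sym cong_trans by blast
      then show "[m1 = m'] (mod int k)" by (simp add: p_cancel)
    qed (use a in auto)
    have Qe: "Q k (2 * m') = Q k (- 2 * m - 2 * s')"
      if m': "[p * m' = q - 1] (mod int k)" and s': "Im (\<alpha> * eunit k (p * s')) = 0" for m' s'
    proof -
      interpret zi': zero_curve_int k p t0 \<theta> B Z H \<tau> s'
        by (rule int_curve[OF \<rho> \<tau>]) (use s' in \<open>simp add: \<alpha>_def\<close>)
      have "[p * (- m - s') = - (q - \<tau>)] (mod int k)" by (rule cong_neg_solve'[OF m zi'.S])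
      then have "[p * (- m - s') = q - 1] (mod int k)" by (simp add: k1)
      then have "[p * m' = p * (- m - s')] (mod int k)" using m' cong_sym cong_trans by blast
      then have "[m' = - m - s'] (mod int k)" by (simp add: p_cancel)
      then have "Q k (2 * m') = Q k (2 * (- m - s'))" by (rule Q_cong)
      then show ?thesis by (simp add: algebra_simps)
    qed
    have "pls s m1 \<noteq> mns s m" using a by (intro pls_ne_mns) auto
    then have ex2: "first_two_zeros H (pls s m1) (mns s m)" using a by blast
    have "a \<noteq> b \<and> cmod a = cmod b \<and> (a = pls s m1 \<and> b = mns s m \<or> a = mns s m \<and> b = pls s m1)"
      if "first_two_zeros H a b" for a b
      using that a norm_pol[of "exp s" k] by (auto simp: doubleton_eq_iff)
    then show ?thesis using ex2 M P Qe by blast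
  next
    assume "\<exists>s2. (p = 1 \<and> \<theta> s = 1 \<and> \<theta> s2 = 1) \<and> (\<forall>a b. first_two_zeros H a b \<longleftrightarrow> a = pls s m1 \<and> b = pls s2 m1)"
    then obtain s2 where s2: "p = 1" "\<theta> s = 1" "\<theta> s2 = 1" "\<And>a b. first_two_zeros H a b \<longleftrightarrow> a = pls s m1 \<and> b = pls s2 m1"
      by blast
    \<comment> \<open>For p = 1 the index m1 is m - 1 modulo k, so on the top edge the angle 2 m1 +
      1 is that of the ray at 2 m - 1.\<close>
    have "[m1 + 1 = q - 1 + 1] (mod int k)" using m1 s2(1) by (intro cong_add cong_refl) simp
    then have mq: "[m1 + 1 = q] (mod int k)" by simp
    have "[m = q] (mod int k)" using m s2(1) by simp
    then have c: "[m1 + 1 = m] (mod int k)" by (rule cong_trans[OF mq cong_sym])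
    have "pos_real (pls r m1 * eunit k (- 2 * m + 1))" if "\<theta> r = 1" for r
      using pos_real_pol_0[OF _ c, of "exp r"] that unfolding pol_eunit by (simp add: algebra_simps)
    moreover have "Arg (pls s m1) = Arg (pls s2 m1)"
      using s2 by (subst Arg_pol_eq_iff[OF k0]) (auto intro!: exI[of _ 0])
    ultimately show ?thesis using s2 by auto
  qed
qed

text \<open>The curve starts at p. With h the ceiling of p / 2, one has p = 2 h - \<kappa> for
  \<sigma> = 0 and p = 2 h - (1 - \<kappa>) for \<sigma> = 1. Hence t0 + 2 (h - q), respectively -t0
  + 2 (h + q), is the level between p and p + 1.\<close>

lemma first_zero_neg_nonreal:
  assumes \<rho>: "0 < \<rho>" and q: "of_int (2 * q - \<kappa>) \<le> t0" "t0 < of_int (2 * q - \<kappa>) + 1" and \<kappa>: "\<kappa> \<in> {0, 1}"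
    and pneg: "p < 0" and ex: "\<exists>z. H z = 0" and Q: "pol k \<rho> t0 \<in> Q k (2 * q - \<kappa>)"
    and \<sigma>: "int \<sigma> = (if even p then \<kappa> else 1 - \<kappa>)"
    and m: "[p * m = q - (- 1) ^ \<sigma> * \<lceil>real_of_int p / 2\<rceil>] (mod int k)"
  shows "\<exists>z. simple_separate_first_zero H z \<and> z \<in> Q k (2 * m - int \<sigma>)"
proof -
  have qs: "of_int (2 * q - \<kappa>) < t0" by (rule level_in_Q[OF \<rho> q Q])
  have t0: "t0 \<notin> \<int>" by (rule nonint_of_strict[OF qs q(2)])
  have b0: "b0 = of_int p" using pneg by (simp add: b0_def)
  define h where "h = \<lceil>real_of_int p / 2\<rceil>"
  have h: "p = (if even p then 2 * h else 2 * h - 1)"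
  proof (cases "even p")
    case True
    then obtain c where "p = 2 * c" by blast
    then show ?thesis by (simp add: h_def)
  next
    case False
    then obtain c where c: "p = 2 * c + 1" by (elim oddE)
    have "h = c + 1" unfolding h_def by (rule ceiling_unique) (simp_all add: c field_simps)
    then show ?thesis using c False by simp
  qed
  have \<sigma>01: "\<sigma> = 0 \<or> \<sigma> = 1" using \<sigma> \<kappa> by (auto split: if_splits)
  then show ?thesis
  proof
    assume s0: "\<sigma> = 0"
    have pr: "real_of_int p = 2 * of_int h - of_int \<kappa>"
    proof -
      have "p = 2 * h - \<kappa>" using h \<sigma> s0 by (auto split: if_splits)
      then show ?thesis by simp
    qed
    have d: "b0 < t0 + 2 * of_int (h - q)" "t0 + 2 * of_int (h - q) < b0 + 1"
      using qs q b0 pr by simp_all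
    have mm: "[p * m = - (h - q)] (mod int k)" using m s0 by (simp add: h_def)
    have "\<exists>z. simple_separate_first_zero H z \<and> z \<in> Q k (2 * m)"
      by (rule nonint_first_plus[OF less_imp_le[OF d(1)] plus_first[OF d] ex q t0 mm])
    then show ?thesis using s0 by simp
  next
    assume s1: "\<sigma> = 1"
    have pr: "real_of_int p = 2 * of_int h - (1 - of_int \<kappa>)"
    proof -
      have "p = 2 * h - (1 - \<kappa>)" using h \<sigma> s1 by (auto split: if_splits)
      then show ?thesis by simp
    qed
    have d: "b0 < - t0 + 2 * of_int (h + q)" "- t0 + 2 * of_int (h + q) < b0 + 1"
      using qs q b0 pr by simp_all
    have mm: "[p * m = h + q] (mod int k)" using m s1 by (simp add: h_def add.commute)
    have "\<exists>z. simple_separate_first_zero H z \<and> z \<in> Q k (2 * m - 1)"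
      by (rule nonint_first_minus[OF less_imp_le[OF d(1)] minus_first[OF d] ex q t0 mm])
    then show ?thesis using s1 by simp
  qed
qed

lemma first_zero_neg_real:
  assumes \<rho>: "0 < \<rho>" and q: "of_int (2 * q - \<kappa>) \<le> t0" "t0 < of_int (2 * q - \<kappa>) + 1" and \<kappa>: "\<kappa> \<in> {0, 1}"
    and pneg: "p < 0" and ex: "\<exists>z. H z = 0" and P: "pos_real (pol k \<rho> t0 * eunit k (- 2 * q + \<kappa>))"
    and par: "even p \<longleftrightarrow> even \<kappa>" and m: "[p * m = q + \<lceil>real_of_int (p - 1) / 2\<rceil>] (mod int k)"
  shows "\<exists>z. simple_separate_first_zero H z \<and> pos_real (z * eunit k (- 2 * m + 1))"
proof -
  have t: "t0 = of_int (2 * q - \<kappa>)" using level_pos_real[OF \<rho> q] P by simp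
  obtain S where S: "[p * S = - (2 * q - \<kappa>)] (mod int k)" using p_solve by blast
  interpret zi: zero_curve_int k p t0 \<theta> B Z H "2 * q - \<kappa>" S by unfold_locales (fact t S)+
  have "even (p - \<kappa>)" using par by simp
  then obtain c where c: "p = 2 * c + \<kappa>" by (metis diff_add_cancel evenE)
  have ceil: "\<lceil>real_of_int (p - 1) / 2\<rceil> = c"
    by (rule ceiling_unique) (use \<kappa> in \<open>auto simp: c field_simps\<close>)
  have "[p * m - p = q + c - p] (mod int k)" using m unfolding ceil by (intro cong_diff cong_refl)
  \<comment> \<open>For p < 0 the first zero lies on the top edge; its index is therefore m - 1, and
    2 (m - 1) + 1 is the angle 2 m - 1 of the claim.\<close>
  then have mm: "[p * (m - 1) = - (c + \<kappa> - q)] (mod int k)" using c by (simp add: algebra_simps)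
  have "\<exists>s. simple_separate_first_zero H (pls s (m - 1)) \<and> \<theta> s = (if 0 < p then 0 else 1)"
  proof (rule zi.first_boundary[OF _ mm ex])
    have "b0 = of_int p" using pneg by (simp add: b0_def)
    moreover have "real_of_int p = 2 * of_int c + of_int \<kappa>" by (simp add: c)
    ultimately show "b0 = t0 + 2 * of_int (c + \<kappa> - q)" unfolding t by simp
  qed
  then obtain s where s: "simple_separate_first_zero H (pls s (m - 1))" "\<theta> s = 1" using pneg by auto
  have "pos_real (pls s (m - 1) * eunit k (- 2 * m + 1))"
    using pos_real_pol_0[of "exp s" m m] s(2) by (simp add: pol_eunit)
  then show ?thesis using s(1) by blast
qed

lemma first_two_zeros_neg:
  assumes \<rho>: "0 < \<rho>" and q: "of_int (2 * q - \<kappa>) \<le> t0" "t0 < of_int (2 * q - \<kappa>) + 1" and \<kappa>: "\<kappa> \<in> {0, 1}"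
    and pneg: "p < 0" and ex: "\<exists>z. H z = 0" and P: "pos_real (pol k \<rho> t0 * eunit k (- 2 * q + \<kappa>))"
    and par: "even p \<longleftrightarrow> odd \<kappa>" and m: "[p * m = q - \<lceil>real_of_int (p + 1) / 2\<rceil>] (mod int k)"
  shows "(\<exists>a b. first_two_zeros H a b) \<and>
                (\<forall>a b. first_two_zeros H a b \<longrightarrow>
                   (Arg a = Arg b \<and> p = - 1 \<and>
                      pos_real (a * eunit k (- 2 * m)) \<and> pos_real (b * eunit k (- 2 * m))) \<or>
                   (a \<noteq> b \<and> cmod a = cmod b \<and>
                      (\<forall>s :: int. Im (pol k \<rho> t0 * eunit k (p * s)) = 0 \<longrightarrow>
                         a \<in> Q k (2 * m) \<and> b \<in> Q k (- 2 * s - 2 * m - 1) \<or>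
                         b \<in> Q k (2 * m) \<and> a \<in> Q k (- 2 * s - 2 * m - 1))))"
proof -
  have t: "t0 = of_int (2 * q - \<kappa>)" using level_pos_real[OF \<rho> q] P by simp
  obtain S where S: "[p * S = - (2 * q - \<kappa>)] (mod int k)" using p_solve by blast
  interpret zi: zero_curve_int k p t0 \<theta> B Z H "2 * q - \<kappa>" S by unfold_locales (fact t S)+
  have "even (p + 1 + \<kappa>)" using par by simp
  then obtain c where c: "p + 1 + \<kappa> = 2 * c" by blast
  then have pc: "p = 2 * c - 1 - \<kappa>" by simp
  have ceil: "\<lceil>real_of_int (p + 1) / 2\<rceil> = c"
    by (rule ceiling_unique) (use \<kappa> in \<open>auto simp: pc field_simps\<close>)
  have mm: "[p * m = - (c - q)] (mod int k)" using m unfolding ceil by simp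
  \<comment> \<open>The first level is p + 1 = 2 c - \<kappa> = t0 + 2 (c - q), so n = c - q, and
    the partner has an index belonging to n + \<tau> with \<tau> = 2 q - \<kappa>.\<close>
  obtain m2 where m2: "[p * m2 = c - q + (2 * q - \<kappa>)] (mod int k)" using p_solve by blast
  have "\<exists>s. 0 < \<theta> s \<and> \<theta> s < 1 \<and> (\<forall>a b. first_two_zeros H a b \<longleftrightarrow> {a, b} = {pls s m, mns s m2} \<and> a \<noteq> b) \<or>
     (\<exists>s2. (p = 1 \<and> \<theta> s = 1 \<and> \<theta> s2 = 1 \<or> p = - 1 \<and> \<theta> s = 0 \<and> \<theta> s2 = 0) \<and>
       (\<forall>a b. first_two_zeros H a b \<longleftrightarrow> a = pls s m \<and> b = pls s2 m))"
  proof (rule zi.first_two[OF _ mm m2 ex])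
    have "b0 = of_int p" using pneg by (simp add: b0_def)
    moreover have "real_of_int p = 2 * of_int c - 1 - of_int \<kappa>" by (simp add: pc)
    ultimately show "b0 + 1 = t0 + 2 * of_int (c - q)" unfolding t by simp
  qed
  then obtain s where "0 < \<theta> s \<and> \<theta> s < 1 \<and> (\<forall>a b. first_two_zeros H a b \<longleftrightarrow> {a, b} = {pls s m, mns s m2} \<and> a \<noteq> b) \<or>
     (\<exists>s2. (p = - 1 \<and> \<theta> s = 0 \<and> \<theta> s2 = 0) \<and>
       (\<forall>a b. first_two_zeros H a b \<longleftrightarrow> a = pls s m \<and> b = pls s2 m))"
    using pneg by auto
  then show ?thesis
  proof
    assume a: "0 < \<theta> s \<and> \<theta> s < 1 \<and> (\<forall>a b. first_two_zeros H a b \<longleftrightarrow> {a, b} = {pls s m, mns s m2} \<and> a \<noteq> b)"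
    have P: "pls s m \<in> Q k (2 * m)" using a by (intro pls_Q_I) auto
    have M: "mns s m2 \<in> Q k (- 2 * s' - 2 * m - 1)" if s': "Im (pol k \<rho> t0 * eunit k (p * s')) = 0" for s'
    proof -
      interpret zi': zero_curve_int k p t0 \<theta> B Z H "2 * q - \<kappa>" s' by (rule int_curve[OF \<rho> t s'])
      have "[p * (- m - s') = c - q + (2 * q - \<kappa>)] (mod int k)" by (rule cong_neg_solve[OF mm zi'.S])
      then have "[p * m2 = p * (- m - s')] (mod int k)" using m2 cong_sym cong_trans by blast
      then have "[m2 = - m - s'] (mod int k)" by (simp add: p_cancel)
      then have "mns s m2 \<in> Q k (2 * (- m - s') - 1)" using a by (intro mns_Q_I) auto
      moreover have "2 * (- m - s') - 1 = - 2 * s' - 2 * m - 1" by simp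
      ultimately show ?thesis by (simp only:)
    qed
    have "pls s m \<noteq> mns s m2" using a by (intro pls_ne_mns) auto
    then have ex2: "first_two_zeros H (pls s m) (mns s m2)" using a by blast
    have "a \<noteq> b \<and> cmod a = cmod b \<and> (a = pls s m \<and> b = mns s m2 \<or> a = mns s m2 \<and> b = pls s m)"
      if "first_two_zeros H a b" for a b
      using that a norm_pol[of "exp s" k] by (auto simp: doubleton_eq_iff)
    then show ?thesis using ex2 P M by blast
  next
    assume "\<exists>s2. (p = - 1 \<and> \<theta> s = 0 \<and> \<theta> s2 = 0) \<and> (\<forall>a b. first_two_zeros H a b \<longleftrightarrow> a = pls s m \<and> b = pls s2 m)"
    then obtain s2 where s2: "p = - 1" "\<theta> s = 0" "\<theta> s2 = 0" "\<And>a b. first_two_zeros H a b \<longleftrightarrow> a = pls s m \<and> b = pls s2 m"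
      by blast
    have "pos_real (pls r m * eunit k (- 2 * m))" if "\<theta> r = 0" for r
      using pos_real_pol_0[of "exp r" m m] that by (simp add: pol_eunit)
    moreover have "Arg (pls s m) = Arg (pls s2 m)"
      using s2 by (subst Arg_pol_eq_iff[OF k0]) (auto intro!: exI[of _ 0])
    ultimately show ?thesis using s2 by auto
  qed
qed

end

subsection \<open>Reduction to products\<close>

lemma genus0_neg_gprod:
  assumes "genus0_neg f"
  obtains c x where "c \<noteq> 0" "summable_weights x" "\<And>z. f z = c * gprod x z"
proof -
  obtain c N a where f: "c \<noteq> 0" "\<forall>\<nu>\<in>N. 0 < a \<nu>" "(\<lambda>\<nu>. 1 / a \<nu>) summable_on N"
    "\<And>z. f z = c * (\<Prod>\<nu>. if \<nu> \<in> N then 1 + z / of_real (a \<nu>) else 1)"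
    using assms unfolding genus0_neg_def by blast
  define x where "x \<nu> = (if \<nu> \<in> N then 1 / a \<nu> else 0)" for \<nu>
  have "x summable_on UNIV"
    using f(3) by (subst summable_on_cong_neutral[where T = N and g = "\<lambda>\<nu>. 1 / a \<nu>"]) (auto simp: x_def)
  then have "summable_weights x"
    using f(2) by unfold_locales (auto simp: x_def less_imp_le intro: summable_on_imp_summable)
  moreover have "f z = c * gprod x z" for z
  proof -
    have "(\<lambda>\<nu>. if \<nu> \<in> N then 1 + z / of_real (a \<nu>) else 1) = (\<lambda>\<nu>. 1 + z * of_real (x \<nu>))"
      by (auto simp: x_def fun_eq_iff)
    then show ?thesis by (simp add: f(4) gprod_def)
  qed
  ultimately show ?thesis using that f(1) by blast
qed

text \<open>Near z the difference \<Phi> - \<alpha> is H divided by a nonvanishing holomorphic U, so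
  dividing \<open>zor_poly\<close> by U exhibits the same order. The identity is asked only where U
  is nonzero, since elsewhere \<Phi> may carry a default value.\<close>

lemma zorder_unit_factor:
  assumes H: "H holomorphic_on UNIV" "H z = 0" "\<exists>v. H v \<noteq> 0"
    and U: "U holomorphic_on UNIV" "U z \<noteq> 0" "\<And>v. U v \<noteq> 0 \<Longrightarrow> H v = U v * (\<Phi> v - \<alpha>)"
  shows "\<exists>N G. 0 < N \<and> zorder H z = int N \<and> zorder (\<lambda>v. \<Phi> v - \<alpha>) z = int N \<and> isCont G z \<and> G z \<noteq> 0 \<and>
       (\<forall>\<^sub>F v in nhds z. \<Phi> v - \<alpha> = G v * (v - z) ^ N)"
proof -
  define N where "N = nat (zorder H z)"
  define G where "G v = zor_poly H z v / U v" for v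
  have "0 < zorder H z \<and> (\<exists>r>0. cball z r \<subseteq> UNIV \<and> zor_poly H z holomorphic_on cball z r \<and>
     (\<forall>v\<in>cball z r. H v = zor_poly H z v * (v - z) ^ N \<and> zor_poly H z v \<noteq> 0))"
    using zorder_exist_zero[OF H(1), of z] H unfolding N_def by auto
  then obtain r where r: "0 < zorder H z" "0 < r" "zor_poly H z holomorphic_on cball z r"
    "\<And>v. v \<in> cball z r \<Longrightarrow> H v = zor_poly H z v * (v - z) ^ N \<and> zor_poly H z v \<noteq> 0" by blast
  define S where "S = ball z r \<inter> {v. U v \<noteq> 0}"
  have "open {v. U v \<noteq> 0}"
    using holomorphic_on_imp_continuous_on[OF U(1)] by (intro open_Collect_neq continuous_on_const)
  then have S: "open S" "z \<in> S" using r U by (auto simp: S_def)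
  have hol: "G holomorphic_on S" unfolding G_def
    by (intro holomorphic_on_divide holomorphic_on_subset[OF r(3)] holomorphic_on_subset[OF U(1)]) (auto simp: S_def)
  have Gz: "G z \<noteq> 0" using r(2) r(4)[of z] U(2) by (simp add: G_def)
  have eq: "\<Phi> v - \<alpha> = G v * (v - z) ^ N" if "v \<in> S" for v
  proof -
    have "U v * (\<Phi> v - \<alpha>) = zor_poly H z v * (v - z) ^ N" "U v \<noteq> 0"
      using that r(4)[of v] U(3)[of v] by (auto simp: S_def)
    then show ?thesis by (simp add: G_def field_simps)
  qed
  have N: "zorder H z = int N" "0 < N" using r(1) by (auto simp: N_def)
  have "zorder (\<lambda>v. \<Phi> v - \<alpha>) z = int N"
    by (rule zorder_eqI[OF S hol Gz]) (simp add: eq)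
  moreover have "isCont G z"
    using hol S holomorphic_on_imp_continuous_on continuous_on_eq_continuous_at by blast
  moreover have "\<forall>\<^sub>F v in nhds z. \<Phi> v - \<alpha> = G v * (v - z) ^ N"
    using eq S eventually_nhds by blast
  ultimately show ?thesis using N Gz by blast
qed

text \<open>The numerator vanishes only at points with negative real part, the denominator only at
  points with positive real part.\<close>

lemma (in product_quotient) no_common_zero: "gprod x v = 0 \<Longrightarrow> gprod y (- v) \<noteq> 0"
proof
  assume "gprod x v = 0" "gprod y (- v) = 0"
  then obtain n m where nm: "1 + v * of_real (x n) = 0" "1 + - v * of_real (y m) = 0"
    using X.gprod_eq_0_iff Y.gprod_eq_0_iff by metis
  have "Re v * y m = 1" "Re v * x n = - 1" using nm by (auto simp: complex_eq_iff)
  then show False using X.nonneg[of n] Y.nonneg[of m]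
    by (metis less_numeral_extra(1) mult_nonneg_nonneg neg_0_le_iff_le not_le zero_less_mult_pos2 mult_nonpos_nonneg linear)
qed

theorem mainTheorem13:
  fixes j k i :: nat and p :: int and \<alpha> :: complex
    and f g H F :: "complex \<Rightarrow> complex"
  assumes jk: "coprime j k" and k2: "2 \<le> k"
    and f: "genus0_neg f" and g: "genus0_neg (\<lambda>z. g (- z))"
    and nonconst: "\<not> f constant_on UNIV \<or> \<not> g constant_on UNIV"
    and i: "i \<in> {1, 2}"
    and p: "p = (- 1) ^ i * int j"
    and \<alpha>: "\<alpha> = - (g 0 / f 0)"
    and H: "H = (if i = 1 then (\<lambda>z. f (z ^ k) + z ^ j * g (z ^ k))
                 else (\<lambda>z. g (z ^ k) + z ^ j * f (z ^ k)))"
    and F: "F = (\<lambda>z. z powi p * ((f (z ^ k) / f 0) / (g (z ^ k) / g 0)))"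
  shows
    \<comment> \<open>At the poles of F, division by zero yields the value 0, which differs from \<alpha>.\<close>
    "{z. H z = 0} = {z. F z = \<alpha>} \<and>
     (\<forall>z. H z = 0 \<longrightarrow> zorder H z = zorder (\<lambda>w. F w - \<alpha>) z) \<and>
     (\<forall>q \<kappa> :: int. 0 \<le> q \<and> q < int k \<and> \<kappa> \<in> {0, 1} \<and> \<alpha> \<in> Qtilde k (2 * q - \<kappa>) \<longrightarrow>
       \<comment> \<open>(A)\<close>
       (Im (\<alpha> ^ k) \<noteq> 0 \<longrightarrow>
          (\<forall>z. H z = 0 \<longrightarrow> zorder H z = 1 \<and> Im (z ^ k) \<noteq> 0) \<and>
          (\<forall>z w. H z = 0 \<and> H w = 0 \<and> z \<noteq> w \<longrightarrow> cmod z \<noteq> cmod w) \<and>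
          (\<forall>z w. \<forall>m \<sigma> :: int. next_zero H z w \<and> \<sigma> \<in> {0, 1} \<and> z \<in> Q k (2 * m - \<sigma>) \<longrightarrow>
             (\<exists>l :: int. [p * (l + m) = 2 * q + 1 - \<kappa> - \<sigma>] (mod int k) \<and>
                w \<in> Q k (2 * l - 1 + \<sigma>)))) \<and>
       \<comment> \<open>(B)\<close>
       (Im (\<alpha> ^ k) = 0 \<longrightarrow>
          (\<forall>s :: int. Im (\<alpha> * eunit k (p * s)) = 0 \<longrightarrow>
            (let star = (\<lambda>z. cnj z * eunit k (- 2 * s)) in
              (\<forall>z. H z = 0 \<longrightarrow> {w. H w = 0 \<and> cmod w = cmod z} = {z, star z}) \<and>
              (\<forall>z. \<forall>m l :: int. H z = 0 \<and> [p * (m - l) = 1] (mod int k) \<and>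
                 z \<in> Q k (2 * m) \<union> Q k (- 2 * s - 2 * m - 1) \<longrightarrow>
                   z \<noteq> star z \<and> zorder H z = 1 \<and> zorder H (star z) = 1 \<and>
                   (\<forall>w. next_zero H z w \<longrightarrow>
                      w \<in> Qbar k (2 * l) \<union> Qbar k (- 2 * s - 2 * l - 1))) \<and>
              (\<forall>z w. next_zero H z w \<and> z = star z \<and> Arg z = Arg w \<longrightarrow>
                 zorder H z = 1 \<and> zorder H w = 1 \<and>
                 (\<forall>v. next_zero H v z \<longrightarrow> Arg v \<noteq> Arg z) \<and>
                 (\<forall>v. next_zero H w v \<longrightarrow> Arg v \<noteq> Arg w)) \<and>
              (\<forall>z w. next_zero H z w \<and> z = star z \<and> Arg z \<noteq> Arg w \<longrightarrow>
                 zorder H z \<in> {1, 2} \<and>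
                 (\<forall>v. next_zero H v z \<longrightarrow>
                    (zorder H z = 1 \<longleftrightarrow> Arg z = Arg v) \<and>
                    (zorder H z = 2 \<longleftrightarrow> Arg z \<noteq> Arg v)) \<and>
                 (\<forall>m l :: int. [p * (m - l) = 1] (mod int k) \<and>
                    z \<in> Qbar k (2 * m) \<inter> Qbar k (- 2 * s - 2 * m - 1) \<longrightarrow>
                      w \<in> Qbar k (2 * l) \<union> Qbar k (- 2 * s - 2 * l - 1))) \<and>
              (\<forall>z. H z = 0 \<and> z = star z \<and> \<not> (\<exists>w. next_zero H z w) \<longrightarrow> zorder H z \<le> 2)))) \<and>
       \<comment> \<open>(C)\<close>
       (i = 2 \<and> (\<exists>z. H z = 0) \<longrightarrow>
          (\<forall>m :: int. [p * m = q] (mod int k) \<longrightarrow>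
            (\<not> neg_real (\<alpha> ^ k) \<longrightarrow>
               (\<exists>z. simple_separate_first_zero H z \<and>
                  (\<alpha> \<in> Q k (2 * q - \<kappa>) \<longrightarrow> z \<in> Q k (2 * m - \<kappa>)) \<and>
                  (pos_real (\<alpha> * eunit k (- 2 * q)) \<longrightarrow> pos_real (z * eunit k (- 2 * m))))) \<and>
            (neg_real (\<alpha> ^ k) \<longrightarrow>
               (\<exists>a b. first_two_zeros H a b) \<and>
               (\<forall>a b. first_two_zeros H a b \<longrightarrow>
                  (Arg a = Arg b \<and> p = 1 \<and>
                     pos_real (a * eunit k (- 2 * m + 1)) \<and> pos_real (b * eunit k (- 2 * m + 1))) \<or>
                  (a \<noteq> b \<and> cmod a = cmod b \<and>
                     (\<forall>m' s :: int. [p * m' = q - 1] (mod int k) \<and>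
                        Im (\<alpha> * eunit k (p * s)) = 0 \<longrightarrow>
                          Q k (2 * m') = Q k (- 2 * m - 2 * s) \<and>
                          (a \<in> Q k (2 * m - 1) \<and> b \<in> Q k (2 * m') \<or>
                           b \<in> Q k (2 * m - 1) \<and> a \<in> Q k (2 * m')))))))) \<and>
       \<comment> \<open>(D)\<close>
       (i = 1 \<and> (\<exists>z. H z = 0) \<longrightarrow>
          (\<alpha> \<in> Q k (2 * q - \<kappa>) \<longrightarrow>
             (\<forall>(\<sigma> :: nat) (m :: int). int \<sigma> = (if even p then \<kappa> else 1 - \<kappa>) \<and>
                [p * m = q - (- 1) ^ \<sigma> * \<lceil>real_of_int p / 2\<rceil>] (mod int k) \<longrightarrow>
                  (\<exists>z. simple_separate_first_zero H z \<and> z \<in> Q k (2 * m - int \<sigma>)))) \<and>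
          (pos_real (\<alpha> * eunit k (- 2 * q + \<kappa>)) \<and> (even p \<longleftrightarrow> even \<kappa>) \<longrightarrow>
             (\<forall>m :: int. [p * m = q + \<lceil>real_of_int (p - 1) / 2\<rceil>] (mod int k) \<longrightarrow>
                (\<exists>z. simple_separate_first_zero H z \<and> pos_real (z * eunit k (- 2 * m + 1))))) \<and>
          (pos_real (\<alpha> * eunit k (- 2 * q + \<kappa>)) \<and> (even p \<longleftrightarrow> odd \<kappa>) \<longrightarrow>
             (\<forall>m :: int. [p * m = q - \<lceil>real_of_int (p + 1) / 2\<rceil>] (mod int k) \<longrightarrow>
                (\<exists>a b. first_two_zeros H a b) \<and>
                (\<forall>a b. first_two_zeros H a b \<longrightarrow>
                   (Arg a = Arg b \<and> p = - 1 \<and>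
                      pos_real (a * eunit k (- 2 * m)) \<and> pos_real (b * eunit k (- 2 * m))) \<or>
                   (a \<noteq> b \<and> cmod a = cmod b \<and>
                      (\<forall>s :: int. Im (\<alpha> * eunit k (p * s)) = 0 \<longrightarrow>
                         a \<in> Q k (2 * m) \<and> b \<in> Q k (- 2 * s - 2 * m - 1) \<or>
                         b \<in> Q k (2 * m) \<and> a \<in> Q k (- 2 * s - 2 * m - 1))))))))"
proof -
  obtain cf x where cf: "cf \<noteq> 0" "summable_weights x" "\<And>z. f z = cf * gprod x z"
    using genus0_neg_gprod[OF f] by blast
  obtain cg y where cg: "cg \<noteq> 0" "summable_weights y" "\<And>z. g (- z) = cg * gprod y z"
    using genus0_neg_gprod[OF g] by blast
  interpret X: summable_weights x by fact
  interpret Y: summable_weights y by fact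
  have gz: "g z = cg * gprod y (- z)" for z using cg(3)[of "- z"] by simp
  have f0: "f 0 = cf" "g 0 = cg" by (simp_all add: cf gz)
  \<comment> \<open>For j = 0 coprimality would force k = 1.\<close>
  have j0: "0 < j" using jk k2 by (cases j) auto
  have p_cases: "i = 1 \<and> p = - int j \<or> i = 2 \<and> p = int j" using i p by auto
  have p_nz: "p \<noteq> 0" using p_cases j0 by auto
  have cop: "coprime p (int k)" using p_cases jk by auto
  have \<alpha>_nz: "\<alpha> \<noteq> 0" using \<alpha> f0 cf(1) cg(1) by simp
  define \<rho> where "\<rho> = cmod \<alpha>"
  have \<rho>: "0 < \<rho>" using \<alpha>_nz by (simp add: \<rho>_def)
  have nontriv: "(\<exists>n. x n \<noteq> 0) \<or> (\<exists>n. y n \<noteq> 0)"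
  proof (rule ccontr)
    assume "\<not> ?thesis"
    then have "f z = cf" "g z = cg" for z
      using X.gprod_zero_weights Y.gprod_zero_weights by (auto simp: cf gz)
    then show False using nonconst by (auto simp: constant_on_def)
  qed
  interpret pq: product_quotient x y k p \<rho>
    by unfold_locales (fact k2 p_nz \<rho> nontriv)+
  have FFn: "F = pq.Fn"
    unfolding F by (rule ext) (simp add: pq.Fn_def f0 cf(1) cg(1), simp add: cf cg(1) gz)
  \<comment> \<open>U clears the denominators in H = U (F - \<alpha>); for i = 1 the exponent p = -j
    contributes the factor z^j.\<close>
  define U where "U z = (if i = 1 then cf * z ^ j * gprod y (- (z ^ k)) else cf * gprod y (- (z ^ k)))" for z
  have hX: "(\<lambda>z. gprod x (z ^ k)) holomorphic_on UNIV"
    by (rule holomorphic_on_compose_gen[OF _ X.gprod_holomorphic[of UNIV], unfolded o_def]) (auto intro!: holomorphic_intros)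
  have hY: "(\<lambda>z. gprod y (- (z ^ k))) holomorphic_on UNIV"
    by (rule holomorphic_on_compose_gen[OF _ Y.gprod_holomorphic[of UNIV], unfolded o_def]) (auto intro!: holomorphic_intros)
  have H_eq: "H z = (if i = 1 then cf * gprod x (z ^ k) + z ^ j * (cg * gprod y (- (z ^ k)))
      else cg * gprod y (- (z ^ k)) + z ^ j * (cf * gprod x (z ^ k)))" for z
    unfolding H by (simp add: cf gz)
  have H_hol: "H holomorphic_on UNIV"
    unfolding H_eq[abs_def] by (cases "i = 1") (auto intro!: holomorphic_intros hX hY)
  have U_hol: "U holomorphic_on UNIV"
    unfolding U_def[abs_def] by (cases "i = 1") (auto intro!: holomorphic_intros hY)
  have H0: "H 0 \<noteq> 0" using k2 j0 cf(1) cg(1) by (simp add: H_eq power_0_left)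
  have HU: "H z = U z * (pq.Fn z - \<alpha>)" if "U z \<noteq> 0" for z
    using p_cases
  proof
    assume c: "i = 1 \<and> p = - int j"
    have nz: "z ^ j \<noteq> 0" "gprod y (- (z ^ k)) \<noteq> 0" using that c by (auto simp: U_def)
    have "pq.Fn z - \<alpha> = gprod x (z ^ k) / (z ^ j * gprod y (- (z ^ k))) + cg / cf"
    proof -
      have "z powi p = inverse (z ^ j)" using c by (simp add: power_int_minus)
      then show ?thesis unfolding pq.Fn_def by (simp add: \<alpha> f0 divide_inverse mult_ac)
    qed
    then show ?thesis using c nz cf(1) by (simp add: U_def H_eq field_simps)
  next
    assume c: "i = 2 \<and> p = int j"
    have nz: "gprod y (- (z ^ k)) \<noteq> 0" using that c by (auto simp: U_def)
    have "pq.Fn z - \<alpha> = z ^ j * gprod x (z ^ k) / gprod y (- (z ^ k)) + cg / cf"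
    proof -
      have "z powi p = z ^ j" using c by simp
      then show ?thesis unfolding pq.Fn_def by (simp add: \<alpha> f0)
    qed
    then show ?thesis using c nz cf(1) by (simp add: U_def H_eq field_simps)
  qed
  have U_nz: "U z \<noteq> 0" if "z \<noteq> 0" "gprod y (- (z ^ k)) \<noteq> 0" for z
    using that cf(1) by (simp add: U_def)
  have H_zero: "H z = 0 \<longleftrightarrow> z \<noteq> 0 \<and> gprod y (- (z ^ k)) \<noteq> 0 \<and> pq.Fn z = \<alpha>" for z
  proof
    assume z: "H z = 0"
    have z0: "z \<noteq> 0" using z H0 by auto
    have gy: "gprod y (- (z ^ k)) \<noteq> 0"
    proof
      assume y0: "gprod y (- (z ^ k)) = 0"
      then have "gprod x (z ^ k) = 0" using z z0 cf(1) by (auto simp: H_eq split: if_splits)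
      then show False using pq.no_common_zero y0 by blast
    qed
    show "z \<noteq> 0 \<and> gprod y (- (z ^ k)) \<noteq> 0 \<and> pq.Fn z = \<alpha>"
      using z0 gy z HU[OF U_nz[OF z0 gy]] U_nz[OF z0 gy] by simp
  next
    assume "z \<noteq> 0 \<and> gprod y (- (z ^ k)) \<noteq> 0 \<and> pq.Fn z = \<alpha>"
    then show "H z = 0" using HU[OF U_nz] by simp
  qed
  have order: "\<exists>N G. 0 < N \<and> zorder H z = int N \<and> zorder (\<lambda>v. pq.Fn v - \<alpha>) z = int N \<and> isCont G z \<and> G z \<noteq> 0 \<and>
       (\<forall>\<^sub>F v in nhds z. pq.Fn v - \<alpha> = G v * (v - z) ^ N)" if "H z = 0" for z
    by (rule zorder_unit_factor[OF H_hol that _ U_hol _ HU]) (use H0 H_zero[of z] that U_nz in auto)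
  have zeros: "{z. H z = 0} = {z. F z = \<alpha>}"
  proof -
    \<comment> \<open>At the origin (as p is nonzero) and at the zeros of the denominator, F takes
      the default value 0, and \<alpha> is nonzero.\<close>
    have "z \<noteq> 0" "gprod y (- (z ^ k)) \<noteq> 0" if "pq.Fn z = \<alpha>" for z
      using that \<alpha>_nz p_nz by (auto simp: pq.Fn_def power_int_0_left_if)
    then show ?thesis unfolding FFn using H_zero by blast
  qed
  have orders: "\<forall>z. H z = 0 \<longrightarrow> zorder H z = zorder (\<lambda>w. F w - \<alpha>) z"
    unfolding FFn using order by fastforce
  have level: "quotient_level x y k p \<rho> t H" if "\<alpha> = pol k \<rho> t" for t
  proof
    show "coprime p (int k)" by (rule cop)
    show "H z = 0 \<longleftrightarrow> z \<noteq> 0 \<and> gprod y (- (z ^ k)) \<noteq> 0 \<and> pq.Fn z = pol k \<rho> t" for z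
      using H_zero that by simp
    show "H z = 0 \<Longrightarrow> \<exists>N G. 0 < N \<and> zorder H z = int N \<and> isCont G z \<and> G z \<noteq> 0 \<and>
       (\<forall>\<^sub>F v in nhds z. pq.Fn v - pol k \<rho> t = G v * (v - z) ^ N)" for z
      using order[of z] that by blast
  qed
  show ?thesis
  proof (rule conjI[OF zeros], rule conjI[OF orders], intro allI impI, elim conjE, goal_cases)
    case (1 q \<kappa>)
    have \<kappa>: "\<kappa> \<in> {0, 1}" and \<alpha>Q: "\<alpha> \<in> Qtilde k (2 * q - \<kappa>)" by fact+
    have kpos: "0 < k" using k2 by simp
    have \<alpha>pol: "\<alpha> = pol k \<rho> (k / pi * Arg \<alpha>)"
      using rcis_cmod_Arg[of \<alpha>] kpos by (simp add: pol_def \<rho>_def rcis_def)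
    then obtain n :: int where n: "of_int (2 * q - \<kappa>) \<le> k / pi * Arg \<alpha> + 2 * real k * of_int n"
      "k / pi * Arg \<alpha> + 2 * real k * of_int n < of_int (2 * q - \<kappa>) + 1"
      using Qtilde_pol[OF kpos \<rho>] \<alpha>Q by metis
    \<comment> \<open>A full turn is 2 k units; this representative of the argument of \<alpha> lies
      in the window fixed by q and \<kappa>.\<close>
    define t where "t = k / pi * Arg \<alpha> + 2 * real k * of_int n"
    have t: "of_int (2 * q - \<kappa>) \<le> t" "t < of_int (2 * q - \<kappa>) + 1" using n by (simp_all add: t_def)
    have \<alpha>t: "\<alpha> = pol k \<rho> t"
      unfolding t_def by (subst \<alpha>pol, subst pol_eq_iff) (use kpos \<rho> in \<open>auto intro!: exI[of _ "- n"]\<close>)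
    interpret ql: quotient_level x y k p \<rho> t H by (rule level[OF \<alpha>t])
    note A = ql.zc.zeros_nonreal[OF \<rho> t, folded \<alpha>t]
    note B = ql.zc.zeros_real[OF \<rho>, folded \<alpha>t]
    have pos: "0 < p" if "i = 2" using p_cases j0 that by auto
    note C1 = ql.zc.first_zero_pos[OF \<rho> t \<kappa> pos, folded \<alpha>t]
    note C2 = ql.zc.first_two_zeros_pos[OF \<rho> t \<kappa> pos, folded \<alpha>t]
    have neg: "p < 0" if "i = 1" using p_cases j0 that by auto
    note D1 = ql.zc.first_zero_neg_nonreal[OF \<rho> t \<kappa> neg, folded \<alpha>t]
    note D2 = ql.zc.first_zero_neg_real[OF \<rho> t \<kappa> neg, folded \<alpha>t]
    note D3 = ql.zc.first_two_zeros_neg[OF \<rho> t \<kappa> neg, folded \<alpha>t]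
    show ?case
    proof (intro conjI, goal_cases)
      case 1
      show ?case using A by (rule impI)
    next
      case 2
      show ?case using B by (intro impI allI)
    next
      case 3
      show ?case
        by (rule impI, elim conjE, intro allI impI, rule conjI; rule impI, rule C1 C2)
    next
      case 4
      show ?case
        by (rule impI, elim conjE, intro conjI; rule impI; (elim conjE)?; intro allI; rule impI;
            (elim conjE)?; rule D1 D2 D3)
    qed
  qed
qed

end
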